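(* Let $F$ be a finite field of characteristic $2$ containing $q=2^k$ elements and let $G=C_n\times Q_{12}$. If $n$ is odd, then $$U(FG)\cong (C_2^{5nk}\times C_4^{nk})\rtimes\Bigg(\bigg(C_{q-1}\times GL(2,F)\bigg)\times\bigg(\prod_{l>1,\ l\mid n}\big(C_{q^{d_l}-1}\times GL(2,F_{d_l})\big)^{e_l}\bigg)\Bigg),$$ where $d_l=\mathrm{ord}_l(q)$ and $e_l=\phi(l)/d_l$.
   Context: $C_m$ denotes the cyclic group of order $m$, and $C_m^j$ the direct product of $j$ copies of $C_m$ (powers of groups denote direct powers). $Q_{12}$ is the quaternion (dicyclic) group of order 12, $Q_{12}=\langle x,y\mid x^3=y^4=1,\ xy=yx^2\rangle$. $FG$ is the group algebra of $G$ over $F$ and $U(FG)$ is its group of units. $F_d$ denotes the extension field of $F$ of degree $d$, and $GL(2,F)$ is the general linear group of degree $2$ over $F$. For coprime integers $a$ and $m$, $\mathrm{ord}_m(a)$ is the multiplicative order of $a$ modulo $m$; $\phi$ is Euler's totient function. The product runs over all divisors $l>1$ of $n$. The symbol $A\rtimes B$ denotes a semidirect product with normal factor $A$ for some action of $B$ on $A$. *)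

theory Defs
  imports "HOL-Algebra.Algebra" "HOL-Number_Theory.Number_Theory"
begin

section \<open>Group presentations\<close>

text \<open>
  A word in generators and their formal inverses is a list of pairs \<open>(g, s)\<close>, where \<open>s = True\<close>
  stands for \<open>g\<close> and \<open>s = False\<close> for its inverse. Every element of the type \<open>'g\<close> is a generator.
  A relation \<open>(r, r')\<close> imposes \<open>r = r'\<close>.
\<close>

type_synonym 'g word = "('g \<times> bool) list"

inductive word_eq :: "('g word \<times> 'g word) set \<Rightarrow> 'g word \<Rightarrow> 'g word \<Rightarrow> bool"
  for R :: "('g word \<times> 'g word) set" where
  refl: "word_eq R u u"
| sym: "word_eq R u v \<Longrightarrow> word_eq R v u"
| trans: "word_eq R u v \<Longrightarrow> word_eq R v w \<Longrightarrow> word_eq R u w"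
| cancel: "word_eq R (u @ [(g, s), (g, \<not> s)] @ v) (u @ v)"
| relation: "(r, r') \<in> R \<Longrightarrow> word_eq R (u @ r @ v) (u @ r' @ v)"

definition presented_group :: "('g word \<times> 'g word) set \<Rightarrow> 'g word set monoid" where
  "presented_group R =
    \<lparr>carrier = UNIV // {(u, v). word_eq R u v},
     monoid.mult = (\<lambda>A B. {w. \<exists>u\<in>A. \<exists>v\<in>B. word_eq R (u @ v) w}),
     one = {w. word_eq R [] w}\<rparr>"

datatype xy_generator = Gen_x | Gen_y

definition Q12 :: "xy_generator word set monoid" where
  "Q12 = (let x = (Gen_x, True); y = (Gen_y, True) in
     presented_group {([x, x, x], []), ([y, y, y, y], []), ([x, y], [y, x, x])})"

section \<open>Direct powers and semidirect products\<close>

definition direct_power :: "('a, 'm) monoid_scheme \<Rightarrow> nat \<Rightarrow> (nat \<Rightarrow> 'a) monoid" where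
  "direct_power G j = product_group {..<j} (\<lambda>_. G)"

text \<open>The action \<open>\<theta>\<close> is meant to be an element of \<open>hom B (AutoGroup A)\<close>.\<close>

definition semidirect_product ::
  "('a, 'm) monoid_scheme \<Rightarrow> ('b, 'n) monoid_scheme \<Rightarrow> ('b \<Rightarrow> 'a \<Rightarrow> 'a) \<Rightarrow> ('a \<times> 'b) monoid" where
  "semidirect_product A B \<theta> =
    \<lparr>carrier = carrier A \<times> carrier B,
     monoid.mult = (\<lambda>(a, b) (a', b'). (a \<otimes>\<^bsub>A\<^esub> \<theta> b a', b \<otimes>\<^bsub>B\<^esub> b')),
     one = (\<one>\<^bsub>A\<^esub>, \<one>\<^bsub>B\<^esub>)\<rparr>"

section \<open>Group algebras\<close>

text \<open>
  An element \<open>\<Sum>g. a g \<cdot> g\<close> is represented by its finitely supported coefficient function \<open>a\<close>,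
  extended by \<open>undefined\<close> outside \<open>carrier G\<close>.
\<close>

definition group_algebra ::
  "('a, 'm) ring_scheme \<Rightarrow> ('g, 'n) monoid_scheme \<Rightarrow> ('g \<Rightarrow> 'a) ring" where
  "group_algebra F G =
    \<lparr>carrier = {a \<in> carrier G \<rightarrow>\<^sub>E carrier F. finite {g \<in> carrier G. a g \<noteq> \<zero>\<^bsub>F\<^esub>}},
     monoid.mult = (\<lambda>a b. \<lambda>g\<in>carrier G.
       \<Oplus>\<^bsub>F\<^esub>h\<in>{h \<in> carrier G. a h \<noteq> \<zero>\<^bsub>F\<^esub>}. a h \<otimes>\<^bsub>F\<^esub> b (inv\<^bsub>G\<^esub> h \<otimes>\<^bsub>G\<^esub> g)),
     one = (\<lambda>g\<in>carrier G. if g = \<one>\<^bsub>G\<^esub> then \<one>\<^bsub>F\<^esub> else \<zero>\<^bsub>F\<^esub>),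
     ring.zero = (\<lambda>g\<in>carrier G. \<zero>\<^bsub>F\<^esub>),
     ring.add = (\<lambda>a b. \<lambda>g\<in>carrier G. a g \<oplus>\<^bsub>F\<^esub> b g)\<rparr>"

section \<open>General linear groups\<close>

definition matrix_monoid :: "nat \<Rightarrow> ('a, 'm) ring_scheme \<Rightarrow> (nat \<times> nat \<Rightarrow> 'a) monoid" where
  "matrix_monoid m R =
    \<lparr>carrier = {..<m} \<times> {..<m} \<rightarrow>\<^sub>E carrier R,
     monoid.mult = (\<lambda>M N. \<lambda>(i, j)\<in>{..<m} \<times> {..<m}.
       \<Oplus>\<^bsub>R\<^esub>l\<in>{..<m}. M (i, l) \<otimes>\<^bsub>R\<^esub> N (l, j)),
     one = (\<lambda>(i, j)\<in>{..<m} \<times> {..<m}. if i = j then \<one>\<^bsub>R\<^esub> else \<zero>\<^bsub>R\<^esub>)\<rparr>"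

definition GL :: "nat \<Rightarrow> ('a, 'm) ring_scheme \<Rightarrow> (nat \<times> nat \<Rightarrow> 'a) monoid" where
  "GL m R = units_of (matrix_monoid m R)"

section \<open>Fields\<close>

definition ring_char :: "('a, 'm) ring_scheme \<Rightarrow> nat" where
  "ring_char R =
    (if \<exists>m::nat. m > 0 \<and> add_pow R m \<one>\<^bsub>R\<^esub> = \<zero>\<^bsub>R\<^esub>
     then LEAST m::nat. m > 0 \<and> add_pow R m \<one>\<^bsub>R\<^esub> = \<zero>\<^bsub>R\<^esub>
     else 0)"

text \<open>
  The base field need not be a subset of the extension field: it is embedded by a ring homomorphism
  \<open>h\<close>, which is injective because both rings are fields.
\<close>

definition extension_field_of_degree ::
  "('a, 'm) ring_scheme \<Rightarrow> nat \<Rightarrow> ('k, 'n) ring_scheme \<Rightarrow> bool" where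
  "extension_field_of_degree F d K \<longleftrightarrow>
    field K \<and> (\<exists>h \<in> ring_hom F K. ring.dimension K d (h ` carrier F) (carrier K))"

end

theory Submission
  imports Defs
begin

text \<open>
  The coefficient algebra \<open>F C\<^sub>n\<close> is semisimple, so it is a product \<open>P\<close> of fields: one copy of
  \<open>F\<^bsub>d\<^sub>l\<^esub>\<close> for each Frobenius orbit of primitive \<open>l\<close>-th roots of unity, \<open>l\<close> dividing \<open>n\<close>. Hence
  \<open>F G = P Q\<^sub>1\<^sub>2\<close>. The idempotent \<open>x + x\<^sup>2\<close> splits \<open>P Q\<^sub>1\<^sub>2\<close> into \<open>P C\<^sub>4\<close> and a quaternion algebra over
  \<open>P C\<^sub>2 = P[z]\<close>, which is the full \<open>2 \<times> 2\<close> matrix ring because the central involution \<open>z = y\<^sup>2\<close> is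
  the norm of \<open>1 + (1 + z) \<omega>\<close>, with \<open>\<omega>\<close> a primitive cube root of unity. The augmentations of \<open>P C\<^sub>4\<close> and
  \<open>P C\<^sub>2\<close> give a split surjection of the unit group onto \<open>U(P) \<times> GL(2, P)\<close>. Its kernel is abelian of
  exponent 4 and order \<open>|P|\<^sup>7\<close>, and its squares are the \<open>1 + u\<^sup>2 (1 + z)\<close> in the first block, with
  \<open>u\<close> in \<open>P\<close>; this determines the kernel.

  That \<open>F C\<^sub>n \<rightarrow> P\<close> is injective follows from Fourier inversion, where sums over primitive \<open>l\<close>-th roots
  of unity are Ramanujan sums. These are integers, so that the contributions of the different fields
  can be added up in \<open>F\<close>.
\<close>

section \<open>Group theory: split extensions and abelian groups of exponent four\<close>

section \<open>Split extensions\<close>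

text \<open>The identification of the group algebra is by injectivity and counting: the twelve words
  in the images of x and y are independent over P, F C_n embeds in P, and |F|^(12 n) = |P|^12 gives
  surjectivity. The quaternion block splits even when F has no primitive cube root of unity, since
  \<omega> can be taken to be a matrix with entries 0 and 1; the same formulas then serve every P.
  The exponents 5nk and nk arise as follows. The augmentation kernel has three free coordinates in
  the first block and four in the second, so its order is 2^(7nk). An abelian group of exponent
  dividing 4 is determined by its order and its number of squares; 2^(nk) squares mean nk factors
  C_4, which account for 2nk of the 7nk. The obstacle to injectivity of F C_n -> P is that P
  contains just one root of unity per Frobenius orbit, whereas Fourier inversion sums over all of
  them. The coefficients lie in F and are fixed by x -> x^q, so vanishing at one root carries over
  to its whole orbit.\<close>

lemma split_extension_iso_semidirect_product:
  fixes U (structure)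
  assumes U: "group U" and A: "group A" and B: "group B"
    and p: "p \<in> hom U B" and s: "s \<in> hom B U"
    and ps: "\<And>b. b \<in> carrier B \<Longrightarrow> p (s b) = b"
    and \<alpha>: "\<alpha> \<in> iso A (U\<lparr>carrier := kernel U B p\<rparr>)"
  shows "\<exists>\<theta> \<in> hom B (AutoGroup A). U \<cong> semidirect_product A B \<theta>"
proof -
  interpret U: group U by (rule U)
  interpret A: group A by (rule A)
  interpret B: group B by (rule B)
  interpret p: group_hom U B p by (simp add: U B p group_hom_def group_hom_axioms_def)
  interpret s: group_hom B U s by (simp add: U B s group_hom_def group_hom_axioms_def)
  \<comment> \<open>\<open>?n u\<close> is the kernel component of \<open>u\<close>: every
    \<open>u\<close> factors as \<open>?n u\<close> times \<open>s (p u)\<close>. The action is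
    conjugation by \<open>s b\<close>, transported to \<open>A\<close> along
    \<open>\<alpha>\<close>.\<close>
  let ?N = "kernel U B p" and ?n = "\<lambda>u. u \<otimes> inv s (p u)"
  have inv_cancel: "inv x \<otimes> (x \<otimes> y) = y" if "x \<in> carrier U" "y \<in> carrier U" for x y
    using that by (simp add: U.m_assoc[symmetric])
  define \<beta> where "\<beta> = inv_into (carrier A) \<alpha>"
  have bij: "bij_betw \<alpha> (carrier A) ?N" and \<alpha>_mult: "\<And>x y. x \<in> carrier A \<Longrightarrow> y \<in> carrier A \<Longrightarrow>
      \<alpha> (x \<otimes>\<^bsub>A\<^esub> y) = \<alpha> x \<otimes> \<alpha> y"
    using \<alpha> by (auto simp: iso_def hom_def)
  have \<alpha>N: "\<alpha> a \<in> carrier U" "p (\<alpha> a) = \<one>\<^bsub>B\<^esub>" if "a \<in> carrier A" for a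
    using bij that by (auto simp: bij_betw_def kernel_def)
  have \<beta>: "\<beta> u \<in> carrier A" "\<alpha> (\<beta> u) = u" if "u \<in> carrier U" "p u = \<one>\<^bsub>B\<^esub>" for u
    using bij that unfolding \<beta>_def bij_betw_def
    by (auto simp: kernel_def intro!: inv_into_into f_inv_into_f)
  have \<alpha>_inj: "x = y" if "x \<in> carrier A" "y \<in> carrier A" "\<alpha> x = \<alpha> y" for x y
    using bij that by (auto simp: bij_betw_def inj_on_def)
  \<comment> \<open>Members of \<open>AutoGroup A\<close> are extensional, hence the restriction to
    \<open>carrier A\<close>.\<close>
  define \<theta> where "\<theta> b = (\<lambda>a\<in>carrier A. \<beta> (s b \<otimes> \<alpha> a \<otimes> inv (s b)))" for b
  have \<theta>: "\<theta> b a \<in> carrier A" "\<alpha> (\<theta> b a) = s b \<otimes> \<alpha> a \<otimes> inv (s b)"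
    if "b \<in> carrier B" "a \<in> carrier A" for a b
    using that \<beta> \<alpha>N by (auto simp: \<theta>_def ps)
  have \<theta>_mult: "\<theta> (b \<otimes>\<^bsub>B\<^esub> b') a = \<theta> b (\<theta> b' a)"
    if "b \<in> carrier B" "b' \<in> carrier B" "a \<in> carrier A" for a b b'
    by (rule \<alpha>_inj) (use that \<theta> \<alpha>N in \<open>auto simp: U.m_assoc U.inv_mult_group\<close>)
  have \<theta>_one: "\<theta> \<one>\<^bsub>B\<^esub> a = a" if "a \<in> carrier A" for a
    by (rule \<alpha>_inj) (use that \<theta> \<alpha>N in auto)
  have \<theta>_auto: "\<theta> b \<in> auto A" if b: "b \<in> carrier B" for b
  proof -
    have "\<theta> b \<in> hom A A"
    proof (rule homI)
      fix x y assume xy: "x \<in> carrier A" "y \<in> carrier A"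
      have "s b \<otimes> (\<alpha> x \<otimes> \<alpha> y) \<otimes> inv (s b)
          = (s b \<otimes> \<alpha> x \<otimes> inv (s b)) \<otimes> (s b \<otimes> \<alpha> y \<otimes> inv (s b))"
        using b xy \<alpha>N(1) by (simp add: U.m_assoc inv_cancel)
      then show "\<theta> b (x \<otimes>\<^bsub>A\<^esub> y) = \<theta> b x \<otimes>\<^bsub>A\<^esub> \<theta> b y"
        by (intro \<alpha>_inj) (use b xy \<theta> in \<open>auto simp: \<alpha>_mult\<close>)
    qed (use b \<theta> in auto)
    moreover have "bij_betw (\<theta> b) (carrier A) (carrier A)"
      by (rule bij_betwI[where g = "\<theta> (inv\<^bsub>B\<^esub> b)"])
        (use b \<theta> in \<open>auto simp: \<theta>_mult[symmetric] \<theta>_one\<close>)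
    ultimately show ?thesis by (simp add: auto_def Bij_def \<theta>_def)
  qed
  have "\<theta> \<in> hom B (AutoGroup A)"
  proof (rule homI)
    fix b b' assume "b \<in> carrier B" "b' \<in> carrier B"
    moreover from this have "\<theta> (b \<otimes>\<^bsub>B\<^esub> b') = compose (carrier A) (\<theta> b) (\<theta> b')"
      by (intro extensionalityI[of _ "carrier A"])
        (auto simp: \<theta>_mult compose_def, simp_all add: \<theta>_def)
    ultimately show "\<theta> (b \<otimes>\<^bsub>B\<^esub> b') = \<theta> b \<otimes>\<^bsub>AutoGroup A\<^esub> \<theta> b'"
      using \<theta>_auto by (auto simp: AutoGroup_def BijGroup_def auto_def)
  qed (simp add: AutoGroup_def \<theta>_auto)
  moreover have "(\<lambda>u. (\<beta> (?n u), p u)) \<in> iso U (semidirect_product A B \<theta>)"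
  proof (rule isoI)
    have kU: "?n u \<in> carrier U" "p (?n u) = \<one>\<^bsub>B\<^esub>"
      if "u \<in> carrier U" for u
      using that by (auto simp: ps)
    show "(\<lambda>u. (\<beta> (?n u), p u)) \<in> hom U (semidirect_product A B \<theta>)"
    proof (rule homI)
      fix u v assume uv: "u \<in> carrier U" "v \<in> carrier U"
      have "\<beta> (?n (u \<otimes> v))
          = \<beta> (?n u) \<otimes>\<^bsub>A\<^esub> \<theta> (p u) (\<beta> (?n v))"
      proof (rule \<alpha>_inj)
        have eq: "\<alpha> (\<beta> (?n (u \<otimes> v))) = ?n (u \<otimes> v)"
          using uv by (intro \<beta>(2) kU) auto
        show "\<alpha> (\<beta> (?n (u \<otimes> v)))
            = \<alpha> (\<beta> (?n u) \<otimes>\<^bsub>A\<^esub> \<theta> (p u) (\<beta> (?n v)))"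
          unfolding eq using uv kU[OF uv(1)] kU[OF uv(2)] \<beta> \<theta>
          by (simp add: \<alpha>_mult U.m_assoc U.inv_mult_group inv_cancel)
        show "\<beta> (?n (u \<otimes> v)) \<in> carrier A"
          using uv by (intro \<beta>(1) kU) auto
      qed (use uv kU \<beta> \<theta> in auto)
      then show "(\<beta> (?n (u \<otimes> v)), p (u \<otimes> v)) =
          (\<beta> (?n u), p u) \<otimes>\<^bsub>semidirect_product A B \<theta>\<^esub> (\<beta> (?n v), p v)"
        using uv by (simp add: semidirect_product_def)
    qed (use kU \<beta> in \<open>auto simp: semidirect_product_def\<close>)
    show "bij_betw (\<lambda>u. (\<beta> (?n u), p u)) (carrier U) (carrier (semidirect_product A B \<theta>))"
    proof (rule bij_betwI[where g = "\<lambda>(a, b). \<alpha> a \<otimes> s b"])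
      show "(case (\<beta> (?n u), p u) of (a, b) \<Rightarrow> \<alpha> a \<otimes> s b) = u" if "u \<in> carrier U" for u
        using that kU[OF that] \<beta> by (simp add: U.m_assoc)
      show "(\<beta> ((case y of (a, b) \<Rightarrow> \<alpha> a \<otimes> s b) \<otimes> inv s (p (case y of (a, b) \<Rightarrow> \<alpha> a \<otimes> s b))),
          p (case y of (a, b) \<Rightarrow> \<alpha> a \<otimes> s b)) = y" if "y \<in> carrier (semidirect_product A B \<theta>)" for y
      proof -
        obtain a b where y: "y = (a, b)" "a \<in> carrier A" "b \<in> carrier B"
          using \<open>y \<in> _\<close> by (auto simp: semidirect_product_def)
        then have "\<alpha> a \<otimes> s b \<otimes> inv s b = \<alpha> a"
          using \<alpha>N by (simp add: U.m_assoc)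
        moreover have "\<beta> (\<alpha> a) = a"
          using y bij by (simp add: \<beta>_def bij_betw_def)
        ultimately show ?thesis using y \<alpha>N by (simp add: ps)
      qed
    qed (use kU \<beta> \<alpha>N in \<open>auto simp: semidirect_product_def\<close>)
  qed
  ultimately show ?thesis by (auto simp: is_iso_def)
qed

section \<open>Finite abelian groups of exponent four\<close>

text \<open>Exponents are added modulo \<open>m\<close>; the hypothesis
  \<open>g i [^] m = \<one>\<close> lets this reduction be undone inside each power.\<close>

lemma (in comm_group) hom_direct_power:
  assumes g: "\<And>i. i < j \<Longrightarrow> g i \<in> carrier G" and ord: "\<And>i. i < j \<Longrightarrow> g i [^] m = \<one>"
  shows "(\<lambda>f. \<Otimes>i\<in>{..<j}. g i [^] (f i :: int)) \<in> hom (direct_power (integer_mod_group m) j) G"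
proof (rule homI)
  fix x y
  have "g i [^] ((x i + y i) mod int m) = g i [^] x i \<otimes> g i [^] y i" if "i < j" for i
  proof -
    have "g i [^] (x i + y i) = g i [^] (int m * ((x i + y i) div int m) + (x i + y i) mod int m)"
      by simp
    also have "\<dots> = (g i [^] int m) [^] ((x i + y i) div int m) \<otimes> g i [^] ((x i + y i) mod int m)"
      using g that by (subst int_pow_mult) (auto simp: int_pow_pow)
    also have "g i [^] int m = \<one>" using ord[OF that] by (simp add: int_pow_int)
    finally show ?thesis using g that by (simp add: int_pow_mult)
  qed
  then have "(\<Otimes>i\<in>{..<j}. g i [^] ((x \<otimes>\<^bsub>direct_power (integer_mod_group m) j\<^esub> y) i))
     = (\<Otimes>i\<in>{..<j}. g i [^] x i \<otimes> g i [^] y i)"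
    using g by (intro finprod_cong') (auto simp: direct_power_def)
  also have "\<dots> = (\<Otimes>i\<in>{..<j}. g i [^] x i) \<otimes> (\<Otimes>i\<in>{..<j}. g i [^] y i)"
    using g by (intro finprod_multf) auto
  finally show "(\<Otimes>i\<in>{..<j}. g i [^] ((x \<otimes>\<^bsub>direct_power (integer_mod_group m) j\<^esub> y) i))
     = (\<Otimes>i\<in>{..<j}. g i [^] x i) \<otimes> (\<Otimes>i\<in>{..<j}. g i [^] y i)" .
qed (use g in \<open>auto intro!: finprod_closed\<close>)

lemma (in comm_group) generator_in_image_direct_power:
  assumes "\<And>i. i < j \<Longrightarrow> g i \<in> carrier G" and "i < j" and "m > 1"
  shows "g i \<in> (\<lambda>f. \<Otimes>i\<in>{..<j}. g i [^] (f i :: int)) ` carrier (direct_power (integer_mod_group m) j)"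
proof (rule image_eqI)
  have "(\<Otimes>k\<in>{..<j}. g k [^] ((\<lambda>k\<in>{..<j}. if k = i then 1 else 0 :: int) k))
      = (\<Otimes>k\<in>{..<j}. if i = k then g k else \<one>)"
    using assms by (intro finprod_cong) (auto simp: simp_implies_def)
  also have "\<dots> = g i" using assms by (intro finprod_singleton) auto
  finally show "g i = (\<Otimes>k\<in>{..<j}. g k [^] ((\<lambda>k\<in>{..<j}. if k = i then 1 else 0 :: int) k))" by simp
  show "(\<lambda>k\<in>{..<j}. if k = i then 1 else 0) \<in> carrier (direct_power (integer_mod_group m) j)"
    using \<open>m > 1\<close> by (auto simp: direct_power_def carrier_integer_mod_group)
qed

lemma (in comm_group) subgroup_insert_involution:
  assumes S: "subgroup S G" and x: "x \<in> carrier G" "x \<otimes> x = \<one>"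
  shows "subgroup (S \<union> (\<lambda>s. x \<otimes> s) ` S) G"
proof -
  interpret S: subgroup S G by (rule S)
  have ne: "S \<noteq> {}" using S.one_closed by blast
  have xx: "x \<otimes> (x \<otimes> t) = t" if "t \<in> carrier G" for t
    using that x by (simp add: m_assoc[symmetric])
  have *: "s \<otimes> (x \<otimes> t) = x \<otimes> (s \<otimes> t)" "x \<otimes> s \<otimes> (x \<otimes> t) = s \<otimes> t"
    if "s \<in> S" "t \<in> S" for s t
  proof -
    have st: "s \<in> carrier G" "t \<in> carrier G" using that by auto
    show "s \<otimes> (x \<otimes> t) = x \<otimes> (s \<otimes> t)" using st x by (intro m_lcomm)
    then show "x \<otimes> s \<otimes> (x \<otimes> t) = s \<otimes> t" using st x xx[of "s \<otimes> t"] by (simp add: m_assoc)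
  qed
  have i: "inv (x \<otimes> s) = x \<otimes> inv s" if "s \<in> carrier G" for s
    using that x inv_equality[of x x] by (simp add: inv_mult)
  show ?thesis
  proof (rule subgroupI)
    fix u v assume "u \<in> S \<union> (\<lambda>s. x \<otimes> s) ` S" "v \<in> S \<union> (\<lambda>s. x \<otimes> s) ` S"
    then show "u \<otimes> v \<in> S \<union> (\<lambda>s. x \<otimes> s) ` S"
      using x by (auto simp: * m_assoc[of x] xx)
  qed (use x ne in \<open>auto simp: i\<close>)
qed

text \<open>T/S is a vector space of dimension \<open>a\<close> over the field with two elements,
  and \<open>w\<close> lifts a basis: each new vector doubles \<open>S\<close>. Spanning is
  expressed through subgroups \<open>H\<close>; independence is left out because injectivity will
  follow from counting.\<close>

lemma (in comm_group) elementary_abelian_2_spanned: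
  assumes "finite (carrier G)" and "subgroup S G" and T: "subgroup T G" and "S \<subseteq> T"
    and inv: "\<And>t. t \<in> T \<Longrightarrow> t \<otimes> t = \<one>" and "card T = 2 ^ a * card S"
  shows "\<exists>w. (\<forall>i<a. w i \<in> T) \<and> (\<forall>H. subgroup H G \<longrightarrow> S \<subseteq> H \<longrightarrow> (\<forall>i<a. w i \<in> H) \<longrightarrow> T \<subseteq> H)"
  using assms(2,4,6)
proof (induction a arbitrary: S)
  case 0
  have "finite T" using T assms(1) subgroup.subset finite_subset by metis
  with 0 have "S = T" by (simp add: card_subset_eq)
  then show ?case by auto
next
  case (Suc a)
  interpret S: subgroup S G by fact
  interpret T: subgroup T G by fact
  have fT: "finite T" using T assms(1) subgroup.subset finite_subset by metis
  have "card S > 0" using \<open>S \<subseteq> T\<close> fT S.one_closed by (metis card_gt_0_iff empty_iff finite_subset)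
  then have "S \<noteq> T" using Suc.prems(3) by auto
  then obtain x where x: "x \<in> T" "x \<notin> S" using \<open>S \<subseteq> T\<close> by blast
  let ?S = "S \<union> (\<lambda>s. x \<otimes> s) ` S"
  have sub: "subgroup ?S G" using subgroup_insert_involution[OF Suc.prems(1)] x inv by auto
  have "S \<inter> (\<lambda>s. x \<otimes> s) ` S = {}"
  proof (rule ccontr)
    assume "S \<inter> (\<lambda>s. x \<otimes> s) ` S \<noteq> {}"
    then obtain s where s: "s \<in> S" "x \<otimes> s \<in> S" by auto
    then have "x \<otimes> s \<otimes> inv s \<in> S" by blast
    then show False using x s by (simp add: m_assoc)
  qed
  moreover have "card ((\<lambda>s. x \<otimes> s) ` S) = card S"
    using x by (intro card_image) (auto simp: inj_on_def)
  ultimately have "card ?S = 2 * card S"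
    using \<open>S \<subseteq> T\<close> fT by (subst card_Un_disjoint) (auto dest: finite_subset)
  then have "card T = 2 ^ a * card ?S" using Suc.prems(3) by simp
  moreover have "?S \<subseteq> T" using x \<open>S \<subseteq> T\<close> by auto
  ultimately obtain w where w: "\<forall>i<a. w i \<in> T"
      "\<And>H. subgroup H G \<Longrightarrow> ?S \<subseteq> H \<Longrightarrow> (\<forall>i<a. w i \<in> H) \<Longrightarrow> T \<subseteq> H"
    using Suc.IH[OF sub] by blast
  show ?case
  proof (intro exI[of _ "w(a := x)"] conjI allI impI)
    fix H assume H: "subgroup H G" "S \<subseteq> H" "\<forall>i<Suc a. (w(a := x)) i \<in> H"
    then have xH: "x \<in> H" and "\<forall>i<a. w i \<in> H"
      by (metis fun_upd_same lessI, metis fun_upd_other less_SucI less_irrefl)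
    moreover have "?S \<subseteq> H" using H xH by (auto intro: subgroup.m_closed)
    ultimately show "T \<subseteq> H" using w(2) H by blast
  qed (use w(1) x in \<open>auto simp: less_Suc_eq\<close>)
qed

lemma (in group_hom) card_kernel_times_card_image:
  assumes "finite (carrier G)"
  shows "card (kernel G H h) * card (h ` carrier G) = card (carrier G)"
proof -
  interpret im: group_hom G "H\<lparr>carrier := h ` carrier G\<rparr>" h
    using H.subgroup_imp_group[OF img_is_subgroup]
    by (auto simp: group_hom_def group_hom_axioms_def hom_def)
  have "card (carrier (G Mod kernel G H h)) = card (h ` carrier G)"
    using im.FactGroup_iso iso_same_card by (fastforce simp: kernel_def)
  then show ?thesis
    using G.lagrange[OF subgroup_kernel] by (simp add: FactGroup_def order_def mult.commute)
qed

text \<open>Let S be the image and T the kernel of squaring, so S lies in T and |T| = 2^a |S|.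
  Square roots of a basis of S generate the factors C_4, and elements completing S to T generate the
  factors C_2. The resulting homomorphism is onto, and both sides have order 2^(a + 2b).\<close>

lemma (in comm_group) exponent_four_iso:
  assumes fin: "finite (carrier G)" and exp: "\<And>x. x \<in> carrier G \<Longrightarrow> (x \<otimes> x) \<otimes> (x \<otimes> x) = \<one>"
    and cardG: "card (carrier G) = 2 ^ (a + 2 * b)" and cardS: "card ((\<lambda>x. x \<otimes> x) ` carrier G) = 2 ^ b"
  shows "direct_power (integer_mod_group 2) a \<times>\<times> direct_power (integer_mod_group 4) b \<cong> G"
proof -
  let ?sq = "\<lambda>x. x \<otimes> x"
  let ?S = "?sq ` carrier G"
  let ?C2 = "direct_power (integer_mod_group 2) a" and ?C4 = "direct_power (integer_mod_group 4) b"
  let ?C = "?C2 \<times>\<times> ?C4"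
  interpret sq: group_hom G G ?sq
    by unfold_locales (auto simp: hom_def m_ac)
  define T where "T = kernel G G ?sq"
  have subT: "subgroup T G" and subS: "subgroup ?S G"
    by (simp_all add: T_def sq.subgroup_kernel sq.img_is_subgroup)
  have "card T * 2 ^ b = 2 ^ (a + 2 * b)"
    using sq.card_kernel_times_card_image[OF fin] by (simp add: cardG cardS T_def)
  then have "card T * 2 ^ b = (2 ^ a * 2 ^ b) * 2 ^ b"
    by (simp add: power_add mult_2 mult.assoc)
  then have cardT: "card T = 2 ^ a * card ?S" by (simp add: cardS)
  have S1: "card ?S = 2 ^ b * card {\<one>}" "{\<one>} \<subseteq> ?S" "\<And>t. t \<in> ?S \<Longrightarrow> t \<otimes> t = \<one>"
    using exp subgroup.one_closed[OF subS] by (auto simp: cardS)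
  obtain v where v: "\<forall>i<b. v i \<in> ?S"
      "\<And>H. subgroup H G \<Longrightarrow> {\<one>} \<subseteq> H \<Longrightarrow> (\<forall>i<b. v i \<in> H) \<Longrightarrow> ?S \<subseteq> H"
    using elementary_abelian_2_spanned[OF fin triv_subgroup subS S1(2,3,1)] by blast
  have "\<forall>i<b. \<exists>u. u \<in> carrier G \<and> v i = u \<otimes> u" using v(1) by blast
  then obtain u where u: "\<And>i. i < b \<Longrightarrow> u i \<in> carrier G \<and> v i = u i \<otimes> u i" by metis
  have ST: "?S \<subseteq> T" and T1: "\<And>t. t \<in> T \<Longrightarrow> t \<otimes> t = \<one>"
    using exp by (auto simp: T_def kernel_def)
  obtain w where w: "\<forall>i<a. w i \<in> T"
      "\<And>H. subgroup H G \<Longrightarrow> ?S \<subseteq> H \<Longrightarrow> (\<forall>i<a. w i \<in> H) \<Longrightarrow> T \<subseteq> H"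
    using elementary_abelian_2_spanned[OF fin subS subT _ _ cardT] ST T1 by blast
  have w': "w i \<in> carrier G" "w i \<otimes> w i = \<one>" if "i < a" for i
    using w that by (auto simp: T_def kernel_def)
  define \<phi> where "\<phi> = (\<lambda>f. \<Otimes>i\<in>{..<a}. w i [^] (f i :: int))"
  define \<psi> where "\<psi> = (\<lambda>f. \<Otimes>i\<in>{..<b}. u i [^] (f i :: int))"
  have \<phi>: "\<phi> \<in> hom ?C2 G"
    unfolding \<phi>_def by (rule hom_direct_power) (use w' in \<open>auto simp: numeral_2_eq_2\<close>)
  have \<psi>: "\<psi> \<in> hom ?C4 G"
    unfolding \<psi>_def by (rule hom_direct_power) (use u exp in \<open>auto simp: numeral_eq_Suc m_assoc\<close>)
  have gC: "group (direct_power (integer_mod_group m) j)" for m j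
    by (simp add: direct_power_def)
  define \<chi> where "\<chi> = (\<lambda>(f, g). \<phi> f \<otimes> \<psi> g)"
  have "\<chi> \<in> hom ?C G"
    using \<phi> \<psi> by (auto simp: hom_def \<chi>_def m_ac Pi_iff)
  then interpret \<chi>: group_hom ?C G \<chi>
    by (simp add: group_hom_def group_hom_axioms_def DirProd_group gC is_group)
  define I where "I = \<chi> ` carrier ?C"
  have subI: "subgroup I G" unfolding I_def by (rule \<chi>.img_is_subgroup)
  have "\<phi> ` carrier ?C2 \<subseteq> I"
  proof
    fix y assume "y \<in> \<phi> ` carrier ?C2"
    then obtain f where f: "f \<in> carrier ?C2" "y = \<phi> f" by auto
    then have "y = \<chi> (f, \<one>\<^bsub>?C4\<^esub>)"
      using hom_one[OF \<psi> gC is_group] hom_in_carrier[OF \<phi>] by (simp add: \<chi>_def)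
    then show "y \<in> I" using f group.is_monoid[OF gC] by (auto simp: I_def intro!: monoid.one_closed)
  qed
  moreover have "w i \<in> \<phi> ` carrier ?C2" if "i < a" for i
    using generator_in_image_direct_power[of a w i 2] w' that by (simp add: \<phi>_def)
  ultimately have wI: "\<forall>i<a. w i \<in> I" by blast
  have "\<psi> ` carrier ?C4 \<subseteq> I"
  proof
    fix y assume "y \<in> \<psi> ` carrier ?C4"
    then obtain f where f: "f \<in> carrier ?C4" "y = \<psi> f" by auto
    then have "y = \<chi> (\<one>\<^bsub>?C2\<^esub>, f)"
      using hom_one[OF \<phi> gC is_group] hom_in_carrier[OF \<psi>] by (simp add: \<chi>_def)
    then show "y \<in> I" using f group.is_monoid[OF gC] by (auto simp: I_def intro!: monoid.one_closed)
  qed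
  moreover have "u i \<in> \<psi> ` carrier ?C4" if "i < b" for i
    using generator_in_image_direct_power[of b u i 4] u that by (simp add: \<psi>_def)
  ultimately have uI: "\<forall>i<b. u i \<in> I" by blast
  have "subgroup (?sq ` I) G" using subI by (rule sq.subgroup_img_is_subgroup)
  moreover have "{\<one>} \<subseteq> ?sq ` I"
    using subgroup.one_closed[OF subI] by (auto intro: image_eqI[where x = \<one>])
  moreover have "\<forall>i<b. v i \<in> ?sq ` I" using u uI by auto
  ultimately have S_sq: "?S \<subseteq> ?sq ` I" by (rule v(2))
  moreover have "?sq ` I \<subseteq> I" using subI by (auto intro: subgroup.m_closed)
  ultimately have TI: "T \<subseteq> I" using w(2)[OF subI] wI by blast
  have "carrier G \<subseteq> I"
  proof
    \<comment> \<open>Every square of G is already the square of some y in \<open>I\<close>; then x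
      and y differ by an element of \<open>T\<close>, which lies in \<open>I\<close>.\<close>
    fix x assume x: "x \<in> carrier G"
    then obtain y where y: "y \<in> I" "x \<otimes> x = y \<otimes> y" using S_sq by blast
    then have yG: "y \<in> carrier G" using subI subgroup.mem_carrier by metis
    have "(x \<otimes> inv y) \<otimes> (x \<otimes> inv y) = (x \<otimes> x) \<otimes> inv (y \<otimes> y)"
      using x yG sq.hom_mult[of x "inv y"] sq.hom_inv[of y] by simp
    then have "x \<otimes> inv y \<in> T" using x yG y by (simp add: T_def kernel_def)
    then have "(x \<otimes> inv y) \<otimes> y \<in> I" using TI y subI by (meson subgroup.m_closed subsetD)
    then show "x \<in> I" using x yG by (simp add: m_assoc)
  qed
  then have surj: "\<chi> ` carrier ?C = carrier G" using I_def subI subgroup.subset by blast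
  have "card (carrier ?C) = 2 ^ a * 4 ^ b"
    by (simp add: direct_power_def carrier_integer_mod_group card_PiE card_cartesian_product)
  also have "\<dots> = card (carrier G)" by (simp add: cardG power_add power_mult)
  finally have "card (\<chi> ` carrier ?C) = card (carrier ?C)" using surj by simp
  then have "inj_on \<chi> (carrier ?C)"
    by (intro eq_card_imp_inj_on)
      (auto simp: direct_power_def carrier_integer_mod_group intro!: finite_PiE)
  then show ?thesis
    using surj \<chi>.homh by (auto simp: is_iso_def iso_def bij_betw_def)
qed

section \<open>Ring constructions and the behaviour of their unit groups\<close>

section \<open>Finite sums\<close>

lemma (in abelian_monoid) finsum_swap:
  assumes "finite A" and "finite B" and "\<And>i j. i \<in> A \<Longrightarrow> j \<in> B \<Longrightarrow> f i j \<in> carrier G"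
  shows "(\<Oplus>i\<in>A. \<Oplus>j\<in>B. f i j) = (\<Oplus>j\<in>B. \<Oplus>i\<in>A. f i j)"
  using assms
proof (induction A rule: finite_induct)
  case (insert a A)
  have "(\<Oplus>i\<in>insert a A. \<Oplus>j\<in>B. f i j) = (\<Oplus>j\<in>B. f a j) \<oplus> (\<Oplus>i\<in>A. \<Oplus>j\<in>B. f i j)"
    using insert by (intro finsum_insert) (auto intro!: finsum_closed)
  also have "\<dots> = (\<Oplus>j\<in>B. f a j) \<oplus> (\<Oplus>j\<in>B. \<Oplus>i\<in>A. f i j)"
    using insert by simp
  also have "\<dots> = (\<Oplus>j\<in>B. f a j \<oplus> (\<Oplus>i\<in>A. f i j))"
    using insert by (intro finsum_addf[symmetric]) (auto intro!: finsum_closed)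
  also have "\<dots> = (\<Oplus>j\<in>B. \<Oplus>i\<in>insert a A. f i j)"
    using insert by (intro finsum_cong') (auto intro!: finsum_closed finsum_insert[symmetric])
  finally show ?case .
qed simp

lemma (in abelian_monoid) finsum_Sigma:
  assumes "finite A" and "finite B" and "\<And>i j. i \<in> A \<Longrightarrow> j \<in> B \<Longrightarrow> f (i, j) \<in> carrier G"
  shows "(\<Oplus>p\<in>A \<times> B. f p) = (\<Oplus>i\<in>A. \<Oplus>j\<in>B. f (i, j))"
  using assms
proof (induction A rule: finite_induct)
  case (insert a A)
  have "insert a A \<times> B = Pair a ` B \<union> A \<times> B" by auto
  then have "(\<Oplus>p\<in>insert a A \<times> B. f p) = (\<Oplus>p\<in>Pair a ` B. f p) \<oplus> (\<Oplus>p\<in>A \<times> B. f p)"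
    by (simp only:) (rule finsum_Un_disjoint, use insert in auto)
  also have "(\<Oplus>p\<in>Pair a ` B. f p) = (\<Oplus>j\<in>B. f (a, j))"
    using insert by (subst finsum_reindex) (auto simp: inj_on_def)
  also have "\<dots> \<oplus> (\<Oplus>p\<in>A \<times> B. f p) = (\<Oplus>i\<in>insert a A. \<Oplus>j\<in>B. f (i, j))"
    using insert by (subst finsum_insert) (auto intro!: finsum_closed)
  finally show ?case .
qed simp

text \<open>Phrased for additive maps, because besides ring homomorphisms it is applied to
  coordinate projections and to the powers \<open>x [^] (2 ^ k)\<close> in characteristic
  two.\<close>

lemma additive_hom_finsum:
  assumes R: "abelian_group R" and S: "abelian_group S"
    and h: "\<And>x. x \<in> carrier R \<Longrightarrow> h x \<in> carrier S"
    and add: "\<And>x y. x \<in> carrier R \<Longrightarrow> y \<in> carrier R \<Longrightarrow> h (x \<oplus>\<^bsub>R\<^esub> y) = h x \<oplus>\<^bsub>S\<^esub> h y"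
    and "f \<in> A \<rightarrow> carrier R"
  shows "h (\<Oplus>\<^bsub>R\<^esub>i\<in>A. f i) = (\<Oplus>\<^bsub>S\<^esub>i\<in>A. h (f i))"
proof -
  interpret R: abelian_group R by (rule R)
  interpret S: abelian_group S by (rule S)
  have "h \<zero>\<^bsub>R\<^esub> \<oplus>\<^bsub>S\<^esub> h \<zero>\<^bsub>R\<^esub> = h \<zero>\<^bsub>R\<^esub>" by (simp flip: add)
  then have zero: "h \<zero>\<^bsub>R\<^esub> = \<zero>\<^bsub>S\<^esub>" using h by (simp add: S.add.l_cancel_one)
  show ?thesis
    using assms(5)
  proof (induction A rule: infinite_finite_induct)
    case (insert a A)
    then show ?case by (simp add: add h R.finsum_insert S.finsum_insert Pi_iff)
  qed (simp_all add: zero)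
qed

section \<open>Matrix rings\<close>

text \<open>\<open>GL\<close> is built on the bare multiplicative monoid; adding the additive
  structure makes the ring laws available for it and for the algebra M_2(P)[z].\<close>

definition matrix_ring :: "nat \<Rightarrow> ('a, 'm) ring_scheme \<Rightarrow> (nat \<times> nat \<Rightarrow> 'a) ring" where
  "matrix_ring m R =
    \<lparr>carrier = carrier (matrix_monoid m R), monoid.mult = monoid.mult (matrix_monoid m R),
     one = one (matrix_monoid m R), ring.zero = (\<lambda>_\<in>{..<m} \<times> {..<m}. \<zero>\<^bsub>R\<^esub>),
     ring.add = (\<lambda>M N. \<lambda>p\<in>{..<m} \<times> {..<m}. M p \<oplus>\<^bsub>R\<^esub> N p)\<rparr>"

lemmas matrix_ring_simps = matrix_ring_def matrix_monoid_def

lemma matrix_ring_mult: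
  "M \<otimes>\<^bsub>matrix_ring m R\<^esub> N
    = (\<lambda>(i, j)\<in>{..<m} \<times> {..<m}. \<Oplus>\<^bsub>R\<^esub>l\<in>{..<m}. M (i, l) \<otimes>\<^bsub>R\<^esub> N (l, j))"
  by (simp add: matrix_ring_simps)

lemma matrix_ring_add:
  "M \<oplus>\<^bsub>matrix_ring m R\<^esub> N = (\<lambda>p\<in>{..<m} \<times> {..<m}. M p \<oplus>\<^bsub>R\<^esub> N p)"
  by (simp add: matrix_ring_simps)

lemma ring_matrix_ring:
  fixes R (structure)
  assumes "ring R" shows "ring (matrix_ring m R)"
proof -
  interpret ring R by fact
  let ?I = "{..<m} \<times> {..<m}" and ?M = "matrix_ring m R"
  have mem: "M (i, j) \<in> carrier R" if "M \<in> ?I \<rightarrow>\<^sub>E carrier R" "i < m" "j < m" for M i j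
    using that by auto
  have closed: "(\<lambda>p\<in>?I. f p) \<in> ?I \<rightarrow>\<^sub>E carrier R" if "\<And>i j. i < m \<Longrightarrow> j < m \<Longrightarrow> f (i, j) \<in> carrier R" for f
    using that by auto
  show ?thesis
  proof (intro ringI abelian_groupI monoidI)
    fix M N L
    assume "M \<in> carrier ?M" "N \<in> carrier ?M" "L \<in> carrier ?M"
    then have M: "M \<in> ?I \<rightarrow>\<^sub>E carrier R" and N: "N \<in> ?I \<rightarrow>\<^sub>E carrier R" and L: "L \<in> ?I \<rightarrow>\<^sub>E carrier R"
      by (auto simp: matrix_ring_simps)
    note mm = mem[OF M] mem[OF N] mem[OF L]
    show "M \<otimes>\<^bsub>?M\<^esub> N \<otimes>\<^bsub>?M\<^esub> L = M \<otimes>\<^bsub>?M\<^esub> (N \<otimes>\<^bsub>?M\<^esub> L)"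
    proof -
      have "(\<Oplus>l\<in>{..<m}. (M \<otimes>\<^bsub>?M\<^esub> N) (i, l) \<otimes> L (l, j))
        = (\<Oplus>k\<in>{..<m}. M (i, k) \<otimes> (N \<otimes>\<^bsub>?M\<^esub> L) (k, j))" if ij: "i < m" "j < m" for i j
      proof -
        have "(\<Oplus>l\<in>{..<m}. (M \<otimes>\<^bsub>?M\<^esub> N) (i, l) \<otimes> L (l, j))
          = (\<Oplus>l\<in>{..<m}. \<Oplus>k\<in>{..<m}. M (i, k) \<otimes> N (k, l) \<otimes> L (l, j))"
          using ij mm by (intro finsum_cong') (auto simp: matrix_ring_simps intro!: finsum_closed finsum_ldistr)
        also have "\<dots> = (\<Oplus>k\<in>{..<m}. \<Oplus>l\<in>{..<m}. M (i, k) \<otimes> N (k, l) \<otimes> L (l, j))"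
          using ij mm by (intro finsum_swap) auto
        also have "\<dots> = (\<Oplus>k\<in>{..<m}. M (i, k) \<otimes> (N \<otimes>\<^bsub>?M\<^esub> L) (k, j))"
          using ij mm by (intro finsum_cong')
            (auto intro!: finsum_closed finsum_cong' simp: matrix_ring_simps finsum_rdistr m_assoc)
        finally show ?thesis .
      qed
      then show ?thesis
        unfolding matrix_ring_mult[of m R "_ \<otimes>\<^bsub>?M\<^esub> _"]
          matrix_ring_mult[of m R M "_ \<otimes>\<^bsub>?M\<^esub> _"]
        by (auto intro!: restrict_ext)
    qed
    have "(\<Oplus>l\<in>{..<m}. (M \<oplus>\<^bsub>?M\<^esub> N) (i, l) \<otimes> L (l, j)) = (\<Oplus>l\<in>{..<m}. M (i, l) \<otimes> L (l, j)) \<oplus> (\<Oplus>l\<in>{..<m}. N (i, l) \<otimes> L (l, j))" if "i < m" "j < m" for i j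
    proof -
      have "(\<Oplus>l\<in>{..<m}. (M \<oplus>\<^bsub>?M\<^esub> N) (i, l) \<otimes> L (l, j)) = (\<Oplus>l\<in>{..<m}. M (i, l) \<otimes> L (l, j) \<oplus> N (i, l) \<otimes> L (l, j))"
        using that mm by (intro finsum_cong') (auto simp: matrix_ring_add l_distr)
      also have "\<dots> = (\<Oplus>l\<in>{..<m}. M (i, l) \<otimes> L (l, j)) \<oplus> (\<Oplus>l\<in>{..<m}. N (i, l) \<otimes> L (l, j))"
        using that mm by (intro finsum_addf) auto
      finally show ?thesis .
    qed
    then show "(M \<oplus>\<^bsub>?M\<^esub> N) \<otimes>\<^bsub>?M\<^esub> L
        = M \<otimes>\<^bsub>?M\<^esub> L \<oplus>\<^bsub>?M\<^esub> N \<otimes>\<^bsub>?M\<^esub> L"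
      unfolding matrix_ring_mult[of m R] matrix_ring_add[of m R "restrict _ _"]
      by (auto intro!: restrict_ext)
    have "(\<Oplus>l\<in>{..<m}. L (i, l) \<otimes> (M \<oplus>\<^bsub>?M\<^esub> N) (l, j)) = (\<Oplus>l\<in>{..<m}. L (i, l) \<otimes> M (l, j)) \<oplus> (\<Oplus>l\<in>{..<m}. L (i, l) \<otimes> N (l, j))" if "i < m" "j < m" for i j
    proof -
      have "(\<Oplus>l\<in>{..<m}. L (i, l) \<otimes> (M \<oplus>\<^bsub>?M\<^esub> N) (l, j)) = (\<Oplus>l\<in>{..<m}. L (i, l) \<otimes> M (l, j) \<oplus> L (i, l) \<otimes> N (l, j))"
        using that mm by (intro finsum_cong') (auto simp: matrix_ring_add r_distr)
      also have "\<dots> = (\<Oplus>l\<in>{..<m}. L (i, l) \<otimes> M (l, j)) \<oplus> (\<Oplus>l\<in>{..<m}. L (i, l) \<otimes> N (l, j))"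
        using that mm by (intro finsum_addf) auto
      finally show ?thesis .
    qed
    then show "L \<otimes>\<^bsub>?M\<^esub> (M \<oplus>\<^bsub>?M\<^esub> N)
        = L \<otimes>\<^bsub>?M\<^esub> M \<oplus>\<^bsub>?M\<^esub> L \<otimes>\<^bsub>?M\<^esub> N"
      unfolding matrix_ring_mult[of m R] matrix_ring_add[of m R "restrict _ _"]
      by (auto intro!: restrict_ext)
  next
    fix M assume "M \<in> carrier ?M"
    then have M: "M \<in> ?I \<rightarrow>\<^sub>E carrier R" by (simp add: matrix_ring_simps)
    have "(\<Oplus>l\<in>{..<m}. (if i = l then \<one> else \<zero>) \<otimes> M (l, j)) = M (i, j)" if "i < m" "j < m" for i j
    proof -
      have "(\<Oplus>l\<in>{..<m}. (if i = l then \<one> else \<zero>) \<otimes> M (l, j)) = (\<Oplus>l\<in>{..<m}. if i = l then M (l, j) else \<zero>)"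
        using that mem[OF M] by (intro finsum_cong') auto
      then show ?thesis using that mem[OF M] by (simp add: finsum_singleton)
    qed
    then show "\<one>\<^bsub>?M\<^esub> \<otimes>\<^bsub>?M\<^esub> M = M"
      using M by (auto simp: matrix_ring_simps PiE_iff extensional_def fun_eq_iff cong: finsum_cong)
    have "(\<Oplus>l\<in>{..<m}. M (i, l) \<otimes> (if l = j then \<one> else \<zero>)) = M (i, j)" if "i < m" "j < m" for i j
    proof -
      have "(\<Oplus>l\<in>{..<m}. M (i, l) \<otimes> (if l = j then \<one> else \<zero>)) = (\<Oplus>l\<in>{..<m}. if j = l then M (i, l) else \<zero>)"
        using that mem[OF M] by (intro finsum_cong') auto
      then show ?thesis using that mem[OF M] by (simp add: finsum_singleton)
    qed
    then show "M \<otimes>\<^bsub>?M\<^esub> \<one>\<^bsub>?M\<^esub> = M"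
      using M by (auto simp: matrix_ring_simps PiE_iff extensional_def fun_eq_iff cong: finsum_cong)
    show "\<exists>N\<in>carrier ?M. N \<oplus>\<^bsub>?M\<^esub> M = \<zero>\<^bsub>?M\<^esub>"
      using mem[OF M]
      by (intro bexI[where x = "\<lambda>p\<in>?I. \<ominus> M p"]) (auto simp: matrix_ring_simps l_neg intro!: restrict_ext)
  qed (auto simp: matrix_ring_simps PiE_iff extensional_def a_ac fun_eq_iff intro!: finsum_closed)
qed

lemma matrix_monoid_eq:
  "carrier (matrix_monoid m R) = carrier (matrix_ring m R)"
  "monoid.mult (matrix_monoid m R) = monoid.mult (matrix_ring m R)"
  "\<one>\<^bsub>matrix_monoid m R\<^esub> = \<one>\<^bsub>matrix_ring m R\<^esub>"
  by (simp_all add: matrix_ring_def)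

lemma monoid_matrix_monoid: "ring R \<Longrightarrow> monoid (matrix_monoid m R)"
  using ring.is_monoid[OF ring_matrix_ring] unfolding monoid_def matrix_monoid_eq .

lemma group_GL: "ring R \<Longrightarrow> group (GL m R)"
  unfolding GL_def by (intro monoid.units_group monoid_matrix_monoid)

section \<open>Adjoining a square root of a central element\<close>

text \<open>The ring \<open>R[y]/(y\<^sup>2 - c)\<close>; the pair \<open>(a, b)\<close> stands for \<open>a + b y\<close>.\<close>

definition sqrt_ext :: "('a, 'm) ring_scheme \<Rightarrow> 'a \<Rightarrow> ('a \<times> 'a) ring" where
  "sqrt_ext R c =
    \<lparr>carrier = carrier R \<times> carrier R,
     monoid.mult = (\<lambda>(a, b) (a', b'). (a \<otimes>\<^bsub>R\<^esub> a' \<oplus>\<^bsub>R\<^esub> c \<otimes>\<^bsub>R\<^esub> (b \<otimes>\<^bsub>R\<^esub> b'), a \<otimes>\<^bsub>R\<^esub> b' \<oplus>\<^bsub>R\<^esub> b \<otimes>\<^bsub>R\<^esub> a')),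
     one = (\<one>\<^bsub>R\<^esub>, \<zero>\<^bsub>R\<^esub>), ring.zero = (\<zero>\<^bsub>R\<^esub>, \<zero>\<^bsub>R\<^esub>),
     ring.add = (\<lambda>(a, b) (a', b'). (a \<oplus>\<^bsub>R\<^esub> a', b \<oplus>\<^bsub>R\<^esub> b'))\<rparr>"

lemma sqrt_ext_simps [simp]:
  "carrier (sqrt_ext R c) = carrier R \<times> carrier R"
  "(a, b) \<otimes>\<^bsub>sqrt_ext R c\<^esub> (a', b')
    = (a \<otimes>\<^bsub>R\<^esub> a' \<oplus>\<^bsub>R\<^esub> c \<otimes>\<^bsub>R\<^esub> (b \<otimes>\<^bsub>R\<^esub> b'), a \<otimes>\<^bsub>R\<^esub> b' \<oplus>\<^bsub>R\<^esub> b \<otimes>\<^bsub>R\<^esub> a')"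
  "(a, b) \<oplus>\<^bsub>sqrt_ext R c\<^esub> (a', b') = (a \<oplus>\<^bsub>R\<^esub> a', b \<oplus>\<^bsub>R\<^esub> b')"
  "\<one>\<^bsub>sqrt_ext R c\<^esub> = (\<one>\<^bsub>R\<^esub>, \<zero>\<^bsub>R\<^esub>)" "\<zero>\<^bsub>sqrt_ext R c\<^esub> = (\<zero>\<^bsub>R\<^esub>, \<zero>\<^bsub>R\<^esub>)"
  by (simp_all add: sqrt_ext_def)

text \<open>R may be noncommutative as long as c is central: with c = 1 and a matrix ring this gives
  M_2(P)[z].\<close>

lemma ring_sqrt_ext:
  fixes R (structure)
  assumes "ring R" and c: "c \<in> carrier R" and comm: "\<And>x. x \<in> carrier R \<Longrightarrow> x \<otimes> c = c \<otimes> x"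
  shows "ring (sqrt_ext R c)"
proof -
  interpret ring R by fact
  have cc: "x \<otimes> (c \<otimes> y) = c \<otimes> (x \<otimes> y)" if "x \<in> carrier R" "y \<in> carrier R" for x y
    using that c comm by (simp add: m_assoc[symmetric])
  have "\<exists>y\<in>carrier (sqrt_ext R c). y \<oplus>\<^bsub>sqrt_ext R c\<^esub> x = \<zero>\<^bsub>sqrt_ext R c\<^esub>"
    if "x \<in> carrier (sqrt_ext R c)" for x
    using that by (intro bexI[where x = "(\<ominus> fst x, \<ominus> snd x)"]) (auto simp: l_neg)
  then show ?thesis
    by (intro ringI abelian_groupI monoidI) (use c cc in \<open>auto simp: a_ac l_distr r_distr m_assoc\<close>)
qed

lemma cring_sqrt_ext:
  assumes "cring R" and "c \<in> carrier R"
  shows "cring (sqrt_ext R c)"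
proof -
  interpret cring R by fact
  interpret E: ring "sqrt_ext R c"
    using assms by (intro ring_sqrt_ext ring_axioms) (auto simp: m_comm)
  show ?thesis
    by unfold_locales (use assms in \<open>auto simp: m_ac a_ac\<close>)
qed

section \<open>Products of rings\<close>

definition product_ring :: "'i set \<Rightarrow> ('i \<Rightarrow> ('a, 'm) ring_scheme) \<Rightarrow> ('i \<Rightarrow> 'a) ring" where
  "product_ring I R =
    \<lparr>carrier = (\<Pi>\<^sub>E i\<in>I. carrier (R i)), monoid.mult = (\<lambda>x y. \<lambda>i\<in>I. x i \<otimes>\<^bsub>R i\<^esub> y i),
     one = (\<lambda>i\<in>I. \<one>\<^bsub>R i\<^esub>), ring.zero = (\<lambda>i\<in>I. \<zero>\<^bsub>R i\<^esub>), ring.add = (\<lambda>x y. \<lambda>i\<in>I. x i \<oplus>\<^bsub>R i\<^esub> y i)\<rparr>"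

lemma product_ring_simps [simp]:
  "carrier (product_ring I R) = (\<Pi>\<^sub>E i\<in>I. carrier (R i))"
  "x \<otimes>\<^bsub>product_ring I R\<^esub> y = (\<lambda>i\<in>I. x i \<otimes>\<^bsub>R i\<^esub> y i)"
  "x \<oplus>\<^bsub>product_ring I R\<^esub> y = (\<lambda>i\<in>I. x i \<oplus>\<^bsub>R i\<^esub> y i)"
  "\<one>\<^bsub>product_ring I R\<^esub> = (\<lambda>i\<in>I. \<one>\<^bsub>R i\<^esub>)" "\<zero>\<^bsub>product_ring I R\<^esub> = (\<lambda>i\<in>I. \<zero>\<^bsub>R i\<^esub>)"
  by (simp_all add: product_ring_def)

lemma cring_product_ring:
  assumes R: "\<And>i. i \<in> I \<Longrightarrow> cring (R i)"
  shows "cring (product_ring I R)"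
proof (intro cringI abelian_groupI comm_monoidI)
  fix x assume x: "x \<in> carrier (product_ring I R)"
  have "\<ominus>\<^bsub>R i\<^esub> x i \<in> carrier (R i) \<and> \<ominus>\<^bsub>R i\<^esub> x i \<oplus>\<^bsub>R i\<^esub> x i = \<zero>\<^bsub>R i\<^esub>" if "i \<in> I" for i
  proof -
    interpret cring "R i" using R that .
    show ?thesis using x that by (auto simp: l_neg PiE_iff)
  qed
  then show "\<exists>y\<in>carrier (product_ring I R). y \<oplus>\<^bsub>product_ring I R\<^esub> x = \<zero>\<^bsub>product_ring I R\<^esub>"
    by (intro bexI[where x = "\<lambda>i\<in>I. \<ominus>\<^bsub>R i\<^esub> x i"]) (auto intro!: restrict_ext)
qed (use R in \<open>auto simp: PiE_iff extensional_def fun_eq_iff cring.cring_simprules monoid.r_one[OF ring.is_monoid[OF cring.axioms(1)]] intro!: restrict_ext\<close>)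

lemma RDirProd_simps [simp]:
  "carrier (RDirProd R S) = carrier R \<times> carrier S"
  "(a, b) \<otimes>\<^bsub>RDirProd R S\<^esub> (a', b') = (a \<otimes>\<^bsub>R\<^esub> a', b \<otimes>\<^bsub>S\<^esub> b')"
  "(a, b) \<oplus>\<^bsub>RDirProd R S\<^esub> (a', b') = (a \<oplus>\<^bsub>R\<^esub> a', b \<oplus>\<^bsub>S\<^esub> b')"
  "\<one>\<^bsub>RDirProd R S\<^esub> = (\<one>\<^bsub>R\<^esub>, \<one>\<^bsub>S\<^esub>)" "\<zero>\<^bsub>RDirProd R S\<^esub> = (\<zero>\<^bsub>R\<^esub>, \<zero>\<^bsub>S\<^esub>)"
  by (simp_all add: RDirProd_def DirProd_def monoid.defs)

lemma cring_RDirProd: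
  assumes "cring R" and "cring S"
  shows "cring (RDirProd R S)"
proof -
  interpret R: cring R by fact
  interpret S: cring S by fact
  interpret P: ring "RDirProd R S" by (intro RDirProd_ring R.ring_axioms S.ring_axioms)
  show ?thesis by unfold_locales (auto simp: R.m_comm S.m_comm)
qed

section \<open>Unit groups\<close>

lemma Units_hom:
  assumes "f \<in> hom M N" and "f \<one>\<^bsub>M\<^esub> = \<one>\<^bsub>N\<^esub>" and "x \<in> Units M"
  shows "f x \<in> Units N"
proof -
  obtain y where y: "x \<in> carrier M" "y \<in> carrier M" "y \<otimes>\<^bsub>M\<^esub> x = \<one>\<^bsub>M\<^esub>" "x \<otimes>\<^bsub>M\<^esub> y = \<one>\<^bsub>M\<^esub>"
    using assms(3) by (auto simp: Units_def)
  then have "f y \<otimes>\<^bsub>N\<^esub> f x = \<one>\<^bsub>N\<^esub>" "f x \<otimes>\<^bsub>N\<^esub> f y = \<one>\<^bsub>N\<^esub>"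
    using hom_mult[OF assms(1)] assms(2) by metis+
  then show ?thesis using y(1,2) hom_in_carrier[OF assms(1)] unfolding Units_def by blast
qed

lemma units_of_hom:
  assumes "f \<in> hom M N" and "f \<one>\<^bsub>M\<^esub> = \<one>\<^bsub>N\<^esub>"
  shows "f \<in> hom (units_of M) (units_of N)"
  using assms Units_hom[OF assms]
  by (auto simp: hom_def units_of_def Units_def)

text \<open>Apart from the isomorphism itself, only closure and preservation of the unit are
  assumed, so that the lemma applies to \<open>group_algebra F G\<close> without the monoid laws at
  hand.\<close>

lemma units_of_iso:
  assumes f: "f \<in> iso M N" and one: "f \<one>\<^bsub>M\<^esub> = \<one>\<^bsub>N\<^esub>" and cl: "\<one>\<^bsub>M\<^esub> \<in> carrier M"
    and mult: "\<And>x y. x \<in> carrier M \<Longrightarrow> y \<in> carrier M \<Longrightarrow> x \<otimes>\<^bsub>M\<^esub> y \<in> carrier M"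
  shows "f \<in> iso (units_of M) (units_of N)"
proof (rule isoI)
  have hom: "f \<in> hom M N" and inj: "inj_on f (carrier M)" and im: "f ` carrier M = carrier N"
    using f by (auto simp: iso_def bij_betw_def)
  show "f \<in> hom (units_of M) (units_of N)" by (rule units_of_hom[OF hom one])
  have "y \<in> f ` Units M" if y: "y \<in> Units N" for y
  proof -
    obtain z where z: "y \<in> carrier N" "z \<in> carrier N" "z \<otimes>\<^bsub>N\<^esub> y = \<one>\<^bsub>N\<^esub>" "y \<otimes>\<^bsub>N\<^esub> z = \<one>\<^bsub>N\<^esub>"
      using y by (auto simp: Units_def)
    then obtain u v where uv: "u \<in> carrier M" "v \<in> carrier M" "y = f u" "z = f v"
      using im by blast
    then have "f (v \<otimes>\<^bsub>M\<^esub> u) = f \<one>\<^bsub>M\<^esub>" "f (u \<otimes>\<^bsub>M\<^esub> v) = f \<one>\<^bsub>M\<^esub>"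
      using z by (simp_all add: hom_mult[OF hom] one)
    then have "v \<otimes>\<^bsub>M\<^esub> u = \<one>\<^bsub>M\<^esub>" "u \<otimes>\<^bsub>M\<^esub> v = \<one>\<^bsub>M\<^esub>"
      using uv cl mult inj by (auto dest: inj_onD)
    then show ?thesis using uv by (auto simp: Units_def)
  qed
  moreover have "inj_on f (Units M)" using inj by (rule inj_on_subset) (auto simp: Units_def)
  ultimately show "bij_betw f (carrier (units_of M)) (carrier (units_of N))"
    using Units_hom[OF hom one] by (auto simp: bij_betw_def units_of_carrier)
qed

lemma units_of_DirProd: "units_of (M \<times>\<times> N) = units_of M \<times>\<times> units_of N"
proof -
  have "Units (M \<times>\<times> N) = Units M \<times> Units N"
    by (simp add: Units_def set_eq_iff) blast
  then show ?thesis by (simp add: units_of_def DirProd_def)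
qed

lemma units_of_product_group: "units_of (product_group I M) = product_group I (\<lambda>i. units_of (M i))"
proof -
  have "Units (product_group I M) = (\<Pi>\<^sub>E i\<in>I. Units (M i))"
  proof (intro equalityI subsetI)
    fix x assume "x \<in> Units (product_group I M)"
    then obtain y where y: "x \<in> (\<Pi>\<^sub>E i\<in>I. carrier (M i))" "y \<in> (\<Pi>\<^sub>E i\<in>I. carrier (M i))"
        "(\<lambda>i\<in>I. y i \<otimes>\<^bsub>M i\<^esub> x i) = (\<lambda>i\<in>I. \<one>\<^bsub>M i\<^esub>)" "(\<lambda>i\<in>I. x i \<otimes>\<^bsub>M i\<^esub> y i) = (\<lambda>i\<in>I. \<one>\<^bsub>M i\<^esub>)"
      by (auto simp: Units_def)
    have "y i \<otimes>\<^bsub>M i\<^esub> x i = \<one>\<^bsub>M i\<^esub> \<and> x i \<otimes>\<^bsub>M i\<^esub> y i = \<one>\<^bsub>M i\<^esub>" if "i \<in> I" for i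
      using fun_cong[OF y(3), of i] fun_cong[OF y(4), of i] that by simp
    then show "x \<in> (\<Pi>\<^sub>E i\<in>I. Units (M i))" using y(1,2) unfolding Units_def by (auto simp: PiE_iff)
  next
    fix x assume x: "x \<in> (\<Pi>\<^sub>E i\<in>I. Units (M i))"
    then have "\<forall>i\<in>I. \<exists>y\<in>carrier (M i). y \<otimes>\<^bsub>M i\<^esub> x i = \<one>\<^bsub>M i\<^esub> \<and> x i \<otimes>\<^bsub>M i\<^esub> y = \<one>\<^bsub>M i\<^esub>"
      by (auto simp: Units_def PiE_iff)
    then obtain y where "\<forall>i\<in>I. y i \<in> carrier (M i) \<and> y i \<otimes>\<^bsub>M i\<^esub> x i = \<one>\<^bsub>M i\<^esub> \<and> x i \<otimes>\<^bsub>M i\<^esub> y i = \<one>\<^bsub>M i\<^esub>"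
      by metis
    then show "x \<in> Units (product_group I M)"
      using x unfolding Units_def
      by (auto simp: PiE_iff intro!: bexI[where x = "restrict y I"] restrict_ext)
  qed
  then show ?thesis by (simp add: units_of_def product_group_def cong: restrict_cong)
qed

section \<open>Units and general linear groups of products of rings\<close>

lemma finsum_product_ring:
  assumes R: "\<And>i. i \<in> I \<Longrightarrow> cring (R i)" and f: "f \<in> A \<rightarrow> carrier (product_ring I R)" and "i \<in> I"
  shows "(\<Oplus>\<^bsub>product_ring I R\<^esub>a\<in>A. f a) i = (\<Oplus>\<^bsub>R i\<^esub>a\<in>A. f a i)"
  using assms
  by (intro additive_hom_finsum[where h = "\<lambda>x. x i"])
    (auto intro!: abelian_group.intro cring.axioms ring.is_abelian_group cring_product_ring)

text \<open>A matrix over a product is a tuple of matrices, and passing to units commutes with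
  products; the isomorphism is built on monoids and then restricted to units. Units and
  \<open>GL\<close> are treated jointly because the target pairs them field by field.\<close>

lemma units_GL_product_ring:
  fixes R :: "'i \<Rightarrow> ('a, 'm) ring_scheme"
  assumes R: "\<And>i. i \<in> I \<Longrightarrow> cring (R i)"
  shows "units_of (product_ring I R) \<times>\<times> GL m (product_ring I R)
    \<cong> product_group I (\<lambda>i. units_of (R i) \<times>\<times> GL m (R i))"
proof -
  let ?P = "product_ring I R" and ?J = "{..<m} \<times> {..<m}"
  let ?M = "?P \<times>\<times> matrix_monoid m ?P" and ?N = "product_group I (\<lambda>i. R i \<times>\<times> matrix_monoid m (R i))"
  interpret P: cring ?P by (rule cring_product_ring[OF R])
  interpret MP: ring "matrix_ring m ?P" by (rule ring_matrix_ring[OF P.ring_axioms])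
  define f :: "('i \<Rightarrow> 'a) \<times> (nat \<times> nat \<Rightarrow> 'i \<Rightarrow> 'a) \<Rightarrow> 'i \<Rightarrow> 'a \<times> (nat \<times> nat \<Rightarrow> 'a)"
    where "f = (\<lambda>(u, M). \<lambda>i\<in>I. (u i, \<lambda>p\<in>?J. M p i))"
  have "f \<in> iso ?M ?N"
  proof (rule isoI)
    show "f \<in> hom ?M ?N"
    proof (rule homI)
      fix x y assume "x \<in> carrier ?M" "y \<in> carrier ?M"
      then obtain u M v N where xy: "x = (u, M)" "y = (v, N)"
        and uv: "u \<in> carrier ?P" "v \<in> carrier ?P"
        and MN: "M \<in> ?J \<rightarrow>\<^sub>E carrier ?P" "N \<in> ?J \<rightarrow>\<^sub>E carrier ?P"
        by (auto simp: matrix_monoid_def)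
      let ?s = "\<lambda>r s. \<Oplus>\<^bsub>?P\<^esub>l\<in>{..<m}. M (r, l) \<otimes>\<^bsub>?P\<^esub> N (l, s)"
      let ?t = "\<lambda>i r s. \<Oplus>\<^bsub>R i\<^esub>l\<in>{..<m}. (\<lambda>p\<in>?J. M p i) (r, l) \<otimes>\<^bsub>R i\<^esub> (\<lambda>p\<in>?J. N p i) (l, s)"
      have "(?s r s) i
          = ?t i r s"
        if i: "i \<in> I" and rs: "r < m" "s < m" for i r s
      proof -
        interpret Ri: cring "R i" using R i .
        have cl: "M (a, b) \<in> carrier ?P" "N (a, b) \<in> carrier ?P" if "a < m" "b < m" for a b
          using MN that by (auto simp del: product_ring_simps)
        then have cl': "M (a, b) i \<in> carrier (R i)" "N (a, b) i \<in> carrier (R i)" if "a < m" "b < m" for a b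
          using i that by (auto simp: PiE_iff)
        have "(?s r s) i
            = (\<Oplus>\<^bsub>R i\<^esub>l\<in>{..<m}. (M (r, l) \<otimes>\<^bsub>?P\<^esub> N (l, s)) i)"
          using cl rs by (intro finsum_product_ring R i) (auto simp del: product_ring_simps)
        also have "\<dots> = ?t i r s"
          using i cl' rs by (intro Ri.finsum_cong') auto
        finally show ?thesis .
      qed
      then show "f (x \<otimes>\<^bsub>?M\<^esub> y) = f x \<otimes>\<^bsub>?N\<^esub> f y"
        unfolding xy f_def by (auto simp: matrix_monoid_def intro!: restrict_ext)
    qed (auto simp: f_def matrix_monoid_def PiE_iff extensional_def)
    show "bij_betw f (carrier ?M) (carrier ?N)"
    proof (rule bij_betwI[where g = "\<lambda>h. (\<lambda>i\<in>I. fst (h i), \<lambda>p\<in>?J. \<lambda>i\<in>I. snd (h i) p)"])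
      show "f \<in> carrier ?M \<rightarrow> carrier ?N"
        by (auto simp: f_def matrix_monoid_def PiE_iff extensional_def)
      show "(\<lambda>h. (\<lambda>i\<in>I. fst (h i), \<lambda>p\<in>?J. \<lambda>i\<in>I. snd (h i) p)) \<in> carrier ?N \<rightarrow> carrier ?M"
        by (auto simp: matrix_monoid_def PiE_iff extensional_def mem_Times_iff)
      show "(\<lambda>i\<in>I. fst (f x i), \<lambda>p\<in>?J. \<lambda>i\<in>I. snd (f x i) p) = x" if "x \<in> carrier ?M" for x
        using that by (auto simp: f_def matrix_monoid_def PiE_iff extensional_def fun_eq_iff)
      show "f (\<lambda>i\<in>I. fst (y i), \<lambda>p\<in>?J. \<lambda>i\<in>I. snd (y i) p) = y" if "y \<in> carrier ?N" for y
        using that by (auto simp: f_def matrix_monoid_def PiE_iff extensional_def fun_eq_iff mem_Times_iff prod_eq_iff)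
    qed
  qed
  then have "f \<in> iso (units_of ?M) (units_of ?N)"
  proof (rule units_of_iso)
    show "f \<one>\<^bsub>?M\<^esub> = \<one>\<^bsub>?N\<^esub>" by (auto simp: f_def matrix_monoid_def intro!: restrict_ext)
    show "\<one>\<^bsub>?M\<^esub> \<in> carrier ?M" using P.one_closed MP.one_closed by (simp add: matrix_ring_def)
    show "x \<otimes>\<^bsub>?M\<^esub> y \<in> carrier ?M" if "x \<in> carrier ?M" "y \<in> carrier ?M" for x y
      using that P.m_closed MP.m_closed by (auto simp add: matrix_ring_def mult_DirProd' simp del: product_ring_simps)
  qed
  then show ?thesis
    unfolding units_of_DirProd units_of_product_group GL_def by (auto simp: is_iso_def)
qed

text \<open>The base field and the remaining factors of P have elements of different types, so they
  are joined by a binary product instead of a common family.\<close>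

lemma units_GL_RDirProd:
  fixes R :: "('a, 'm) ring_scheme" and S :: "('b, 'n) ring_scheme"
  assumes R: "cring R" and S: "cring S"
  shows "units_of (RDirProd R S) \<times>\<times> GL m (RDirProd R S)
    \<cong> (units_of R \<times>\<times> GL m R) \<times>\<times> (units_of S \<times>\<times> GL m S)"
proof -
  let ?P = "RDirProd R S" and ?J = "{..<m} \<times> {..<m}"
  let ?M = "?P \<times>\<times> matrix_monoid m ?P"
  let ?N = "(R \<times>\<times> matrix_monoid m R) \<times>\<times> (S \<times>\<times> matrix_monoid m S)"
  interpret R: cring R by (rule R)
  interpret S: cring S by (rule S)
  interpret P: cring ?P by (rule cring_RDirProd[OF R S])
  interpret MP: ring "matrix_ring m ?P" by (rule ring_matrix_ring[OF P.ring_axioms])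
  define f :: "('a \<times> 'b) \<times> (nat \<times> nat \<Rightarrow> 'a \<times> 'b)
      \<Rightarrow> ('a \<times> (nat \<times> nat \<Rightarrow> 'a)) \<times> ('b \<times> (nat \<times> nat \<Rightarrow> 'b))"
    where "f = (\<lambda>(u, M). ((fst u, \<lambda>p\<in>?J. fst (M p)), (snd u, \<lambda>p\<in>?J. snd (M p))))"
  have "f \<in> iso ?M ?N"
  proof (rule isoI)
    show f_hom: "f \<in> hom ?M ?N"
    proof (rule homI)
      fix x y assume "x \<in> carrier ?M" "y \<in> carrier ?M"
      then obtain u M v N where xy: "x = (u, M)" "y = (v, N)"
        and uv: "u \<in> carrier ?P" "v \<in> carrier ?P"
        and MN: "M \<in> ?J \<rightarrow>\<^sub>E carrier ?P" "N \<in> ?J \<rightarrow>\<^sub>E carrier ?P"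
        by (auto simp: matrix_monoid_def)
      let ?s = "\<lambda>r s. \<Oplus>\<^bsub>?P\<^esub>l\<in>{..<m}. M (r, l) \<otimes>\<^bsub>?P\<^esub> N (l, s)"
      let ?t = "\<lambda>r s. \<Oplus>\<^bsub>R\<^esub>l\<in>{..<m}. (\<lambda>p\<in>?J. fst (M p)) (r, l) \<otimes>\<^bsub>R\<^esub> (\<lambda>p\<in>?J. fst (N p)) (l, s)"
      let ?t' = "\<lambda>r s. \<Oplus>\<^bsub>S\<^esub>l\<in>{..<m}. (\<lambda>p\<in>?J. snd (M p)) (r, l) \<otimes>\<^bsub>S\<^esub> (\<lambda>p\<in>?J. snd (N p)) (l, s)"
      have cl: "M (a, b) \<in> carrier ?P" "N (a, b) \<in> carrier ?P" if "a < m" "b < m" for a b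
        using MN that by (auto simp del: RDirProd_simps)
      have "fst (?s r s)
          = ?t r s"
        "snd (?s r s)
          = ?t' r s"
        if rs: "r < m" "s < m" for r s
      proof -
        have m: "M (r, l) \<otimes>\<^bsub>?P\<^esub> N (l, s)
            = (fst (M (r, l)) \<otimes>\<^bsub>R\<^esub> fst (N (l, s)), snd (M (r, l)) \<otimes>\<^bsub>S\<^esub> snd (N (l, s)))" for l
          by (metis RDirProd_simps(2) prod.collapse)
        have cl': "fst (M (a, b)) \<in> carrier R" "fst (N (a, b)) \<in> carrier R"
          "snd (M (a, b)) \<in> carrier S" "snd (N (a, b)) \<in> carrier S" if "a < m" "b < m" for a b
          using cl[OF that] by (auto simp: mem_Times_iff)
        have "fst (?s r s)
            = (\<Oplus>\<^bsub>R\<^esub>l\<in>{..<m}. fst (M (r, l) \<otimes>\<^bsub>?P\<^esub> N (l, s)))"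
          using cl rs by (intro additive_hom_finsum P.abelian_group_axioms R.abelian_group_axioms)
            (auto simp del: RDirProd_simps(1), auto)
        then show "fst (?s r s)
          = ?t r s"
          unfolding m using cl' rs by (auto intro!: R.finsum_cong')
        have "snd (?s r s)
            = (\<Oplus>\<^bsub>S\<^esub>l\<in>{..<m}. snd (M (r, l) \<otimes>\<^bsub>?P\<^esub> N (l, s)))"
          using cl rs by (intro additive_hom_finsum P.abelian_group_axioms S.abelian_group_axioms)
            (auto simp del: RDirProd_simps(1), auto)
        then show "snd (?s r s)
          = ?t' r s"
          unfolding m using cl' rs by (auto intro!: S.finsum_cong')
      qed
      then show "f (x \<otimes>\<^bsub>?M\<^esub> y) = f x \<otimes>\<^bsub>?N\<^esub> f y"
        unfolding xy f_def using uv by (auto simp: matrix_monoid_def intro!: restrict_ext)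
    qed (auto simp: f_def matrix_monoid_def PiE_iff extensional_def mem_Times_iff)
    show "bij_betw f (carrier ?M) (carrier ?N)"
    proof (rule bij_betwI[where g = "\<lambda>w. ((fst (fst w), fst (snd w)), \<lambda>p\<in>?J. (snd (fst w) p, snd (snd w) p))"])
      show "f \<in> carrier ?M \<rightarrow> carrier ?N" using f_hom by (simp add: hom_def)
    next
      show "(\<lambda>w. ((fst (fst w), fst (snd w)), \<lambda>p\<in>?J. (snd (fst w) p, snd (snd w) p))) \<in> carrier ?N \<rightarrow> carrier ?M"
      proof (rule funcsetI)
        fix w assume "w \<in> carrier ?N"
        then have "fst (fst w) \<in> carrier R" "fst (snd w) \<in> carrier S"
          "snd (fst w) \<in> ?J \<rightarrow> carrier R" "snd (snd w) \<in> ?J \<rightarrow> carrier S"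
          by (simp_all add: matrix_monoid_def mem_Times_iff PiE_def)
        then show "((fst (fst w), fst (snd w)), \<lambda>p\<in>?J. (snd (fst w) p, snd (snd w) p)) \<in> carrier ?M"
          by (simp add: matrix_monoid_def Pi_iff)
      qed
    next
      fix x assume "x \<in> carrier ?M"
      then have "snd x \<in> extensional ?J" by (simp add: matrix_monoid_def mem_Times_iff PiE_def)
      then show "((fst (fst (f x)), fst (snd (f x))), \<lambda>p\<in>?J. (snd (fst (f x)) p, snd (snd (f x)) p)) = x"
        by (cases x) (simp add: f_def extensional_restrict cong: restrict_cong)
    next
      fix w assume "w \<in> carrier ?N"
      then have "snd (fst w) \<in> extensional ?J" "snd (snd w) \<in> extensional ?J"
        by (simp_all add: matrix_monoid_def mem_Times_iff PiE_def)
      then show "f ((fst (fst w), fst (snd w)), \<lambda>p\<in>?J. (snd (fst w) p, snd (snd w) p)) = w"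
        by (simp add: f_def extensional_restrict prod_eq_iff cong: restrict_cong)
    qed
  qed
  then have "f \<in> iso (units_of ?M) (units_of ?N)"
  proof (rule units_of_iso)
    show "f \<one>\<^bsub>?M\<^esub> = \<one>\<^bsub>?N\<^esub>" by (auto simp: f_def matrix_monoid_def intro!: restrict_ext)
    show "\<one>\<^bsub>?M\<^esub> \<in> carrier ?M" using P.one_closed MP.one_closed by (simp add: matrix_ring_def)
    show "x \<otimes>\<^bsub>?M\<^esub> y \<in> carrier ?M" if "x \<in> carrier ?M" "y \<in> carrier ?M" for x y
      using that P.m_closed MP.m_closed by (auto simp add: matrix_ring_def mult_DirProd' simp del: RDirProd_simps)
  qed
  then show ?thesis
    unfolding units_of_DirProd GL_def by (auto simp: is_iso_def)
qed

lemma (in field) units_of_finite_field: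
  assumes "finite (carrier R)"
  shows "units_of R \<cong> integer_mod_group (card (carrier R) - 1)"
proof -
  let ?U = "Multiplicative_Group.mult_of R"
  interpret G: group ?U by (rule field_mult_group)
  obtain a where a: "a \<in> carrier ?U" "carrier ?U = {a [^] i | i::nat. i \<in> UNIV}"
    using finite_field_mult_group_has_gen[OF assms] by auto
  let ?m = "card (carrier R) - 1"
  have ord: "order ?U = ?m" using order_mult_of[OF assms] by (simp add: order_def)
  have fin: "finite (carrier ?U)" using assms by simp
  \<comment> \<open>\<open>integer_mod_group 0\<close> would be the infinite group of
    integers.\<close>
  have pos: "?m > 0" using fin a(1) unfolding ord[symmetric] order_def card_gt_0_iff by blast
  define f where "f = (\<lambda>i::int. a [^]\<^bsub>?U\<^esub> i)"
  have per: "a [^]\<^bsub>?U\<^esub> (i mod int ?m) = f i" for i :: int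
  proof -
    have "int (G.ord a) dvd int ?m" using G.ord_dvd_group_order[OF a(1)] ord by simp
    moreover have "int ?m dvd i - i mod int ?m" by (rule dvd_minus_mod)
    ultimately have "int (G.ord a) dvd i - i mod int ?m" by (rule dvd_trans)
    then show ?thesis unfolding f_def G.int_pow_eq[OF a(1)] .
  qed
  have "f \<in> iso (integer_mod_group ?m) ?U"
  proof (rule isoI)
    show hom: "f \<in> hom (integer_mod_group ?m) ?U"
    proof (rule homI)
      fix i j :: int
      have "f ((i + j) mod int ?m) = f (i + j)" using per[of "i + j"] by (simp add: f_def)
      also have "\<dots> = f i \<otimes>\<^bsub>?U\<^esub> f j" using a(1) by (simp add: f_def G.int_pow_mult)
      finally show "f (i \<otimes>\<^bsub>integer_mod_group ?m\<^esub> j) = f i \<otimes>\<^bsub>?U\<^esub> f j" by simp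
    qed (use G.int_pow_closed[OF a(1)] in \<open>simp add: f_def\<close>)
    have "carrier ?U \<subseteq> f ` carrier (integer_mod_group ?m)"
    proof
      fix y assume "y \<in> carrier ?U"
      then obtain i :: nat where "y = a [^] i" using a(2) by auto
      then have "y = f (int i)" by (simp add: f_def int_pow_int Multiplicative_Group.nat_pow_mult_of)
      also have "\<dots> = f (int i mod int ?m)" using per[of "int i"] by (simp add: f_def)
      finally show "y \<in> f ` carrier (integer_mod_group ?m)"
        using pos by (auto simp: carrier_integer_mod_group)
    qed
    then have im: "f ` carrier (integer_mod_group ?m) = carrier ?U"
      using hom_carrier[OF hom] by blast
    moreover have "card (carrier (integer_mod_group ?m)) = card (carrier ?U)"
      using ord pos by (simp add: carrier_integer_mod_group order_def)
    ultimately have "inj_on f (carrier (integer_mod_group ?m))"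
      using pos by (intro eq_card_imp_inj_on) (auto simp: carrier_integer_mod_group)
    with im show "bij_betw f (carrier (integer_mod_group ?m)) (carrier ?U)"
      by (simp add: bij_betw_def)
  qed
  then have "integer_mod_group ?m \<cong> units_of R"
    unfolding mult_of_is_Units by (auto simp: is_iso_def)
  then show ?thesis by (rule group.iso_sym[OF group_integer_mod_group])
qed

section \<open>Unit groups of split extensions of monoids\<close>

text \<open>A split surjection of monoids induces a split surjection of unit groups. No element of
  the fibre \<open>N\<close> over one is lost in passing to units: x^4 = 1 makes x^3 an inverse of
  x. The numbers \<open>a\<close> and \<open>b\<close> are then read off by
  \<open>exponent_four_iso\<close>.\<close>

lemma units_iso_semidirect_product:
  fixes W (structure)
  assumes W: "monoid W" and Q: "monoid Q"
    and \<pi>: "\<pi> \<in> hom W Q" "\<pi> \<one> = \<one>\<^bsub>Q\<^esub>" and \<sigma>: "\<sigma> \<in> hom Q W" "\<sigma> \<one>\<^bsub>Q\<^esub> = \<one>"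
    and \<pi>\<sigma>: "\<And>x. x \<in> carrier Q \<Longrightarrow> \<pi> (\<sigma> x) = x"
    and N: "N = {w \<in> carrier W. \<pi> w = \<one>\<^bsub>Q\<^esub>}" and fin: "finite N"
    and comm: "\<And>x y. x \<in> N \<Longrightarrow> y \<in> N \<Longrightarrow> x \<otimes> y = y \<otimes> x"
    and exp: "\<And>x. x \<in> N \<Longrightarrow> (x \<otimes> x) \<otimes> (x \<otimes> x) = \<one>"
    and cards: "card N = 2 ^ (a + 2 * b)" "card ((\<lambda>x. x \<otimes> x) ` N) = 2 ^ b"
    and B: "group B" and iso: "units_of Q \<cong> B"
  defines "A \<equiv> direct_power (integer_mod_group 2) a \<times>\<times> direct_power (integer_mod_group 4) b"
  shows "\<exists>\<theta> \<in> hom B (AutoGroup A). units_of W \<cong> semidirect_product A B \<theta>"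
proof -
  interpret W: monoid W by (rule W)
  interpret Q: monoid Q by (rule Q)
  interpret U: group "units_of W" by (rule W.units_group)
  interpret V: group "units_of Q" by (rule Q.units_group)
  obtain j where j: "j \<in> iso (units_of Q) B" using iso by (auto simp: is_iso_def)
  obtain j' where j': "j' \<in> iso B (units_of Q)" and jj: "\<And>b. b \<in> carrier B \<Longrightarrow> j (j' b) = b"
    using V.iso_set_sym[OF j] j by (auto simp: iso_def bij_betw_def f_inv_into_f)
  have \<pi>U: "\<pi> \<in> hom (units_of W) (units_of Q)" and \<sigma>U: "\<sigma> \<in> hom (units_of Q) (units_of W)"
    using \<pi> \<sigma> by (simp_all add: units_of_hom)
  have jh: "j \<in> hom (units_of Q) B" "j' \<in> hom B (units_of Q)" using j j' by (simp_all add: iso_def)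
  have p: "j \<circ> \<pi> \<in> hom (units_of W) B" and s: "\<sigma> \<circ> j' \<in> hom B (units_of W)"
    using hom_compose[OF \<pi>U jh(1)] hom_compose[OF jh(2) \<sigma>U] .
  have N_unit: "x \<in> Units W" if "x \<in> N" for x
  proof -
    have x: "x \<in> carrier W" using that N by auto
    then have "(x \<otimes> (x \<otimes> x)) \<otimes> x = \<one>" "x \<otimes> (x \<otimes> (x \<otimes> x)) = \<one>"
      using exp[OF that] by (simp_all add: W.m_assoc)
    then show ?thesis using x unfolding Units_def by blast
  qed
  have j1: "j x = \<one>\<^bsub>B\<^esub> \<longleftrightarrow> x = \<one>\<^bsub>Q\<^esub>" if "x \<in> Units Q" for x
  proof -
    have "j \<one>\<^bsub>Q\<^esub> = \<one>\<^bsub>B\<^esub>" using hom_one[OF jh(1) V.is_group B] by (simp add: units_of_one)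
    moreover have "inj_on j (Units Q)" using j by (simp add: iso_def bij_betw_def units_of_carrier)
    ultimately show ?thesis using that Q.Units_one_closed by (metis inj_onD)
  qed
  have ker: "kernel (units_of W) B (j \<circ> \<pi>) = N"
    using N_unit j1 Units_hom[OF \<pi>] unfolding kernel_def units_of_carrier N
    by (auto simp: Units_def[of W])
  let ?N = "(units_of W)\<lparr>carrier := N\<rparr>"
  interpret p: group_hom "units_of W" B "j \<circ> \<pi>"
    using p B by (simp add: group_hom_def group_hom_axioms_def)
  have "comm_group ?N"
    using U.subgroup_imp_group[OF p.subgroup_kernel, unfolded ker] comm
    by (intro group.group_comm_groupI) (auto simp: units_of_mult)
  then have "direct_power (integer_mod_group 2) a \<times>\<times> direct_power (integer_mod_group 4) b \<cong> ?N"
    by (rule comm_group.exponent_four_iso)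
      (use fin exp cards in \<open>auto simp: units_of_mult units_of_one\<close>)
  then obtain \<alpha> where \<alpha>: "\<alpha> \<in> iso A ?N" unfolding A_def by (auto simp: is_iso_def)
  have A: "group A" unfolding A_def by (simp add: direct_power_def DirProd_group)
  show ?thesis
  proof (rule split_extension_iso_semidirect_product[OF U.is_group A B p s])
    show "(j \<circ> \<pi>) ((\<sigma> \<circ> j') b) = b" if "b \<in> carrier B" for b
    proof -
      have "j' b \<in> carrier Q"
        using hom_in_carrier[OF jh(2) that] by (simp add: units_of_carrier Units_def)
      then show ?thesis using that by (simp add: \<pi>\<sigma> jj)
    qed
  qed (use \<alpha> ker in simp)
qed

section \<open>The block algebra in characteristic two and its augmentation kernel\<close>

section \<open>Characteristic two\<close>

context ring
begin

lemma char_two_simps: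
  assumes "\<one> \<oplus> \<one> = \<zero>"
  shows "x \<in> carrier R \<Longrightarrow> x \<oplus> x = \<zero>"
    and "x \<in> carrier R \<Longrightarrow> y \<in> carrier R \<Longrightarrow> x \<oplus> (x \<oplus> y) = y"
proof -
  show *: "x \<oplus> x = \<zero>" if "x \<in> carrier R" for x
  proof -
    have "x \<oplus> x = x \<otimes> (\<one> \<oplus> \<one>)" using that by (simp add: r_distr)
    then show ?thesis using that assms by simp
  qed
  show "x \<oplus> (x \<oplus> y) = y" if "x \<in> carrier R" "y \<in> carrier R"
    using that * by (simp add: a_assoc[symmetric])
qed

lemma char_two_eq_iff:
  assumes "\<one> \<oplus> \<one> = \<zero>" "x \<in> carrier R" "y \<in> carrier R" "z \<in> carrier R"
  shows "x \<oplus> y = z \<longleftrightarrow> x = z \<oplus> y"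
  using assms(2-) char_two_simps[OF assms(1)] by (auto simp: a_assoc)

end

lemma matrix_ring_char_two:
  assumes "\<one>\<^bsub>R\<^esub> \<oplus>\<^bsub>R\<^esub> \<one>\<^bsub>R\<^esub> = \<zero>\<^bsub>R\<^esub>" and "ring R"
  shows "\<one>\<^bsub>matrix_ring m R\<^esub> \<oplus>\<^bsub>matrix_ring m R\<^esub> \<one>\<^bsub>matrix_ring m R\<^esub> = \<zero>\<^bsub>matrix_ring m R\<^esub>"
proof -
  interpret ring R by fact
  show ?thesis using assms(1) by (auto simp: matrix_ring_simps intro!: restrict_ext)
qed

text \<open>In R[z] with z^2 = 1 these elements have the form 1 + b (1 + z). Since (1 + z)^2 = 0,
  two of them multiply to 1 + (b + d)(1 + z): they commute even if b and d do not, and each squares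
  to one.\<close>

lemma one_coset_involution:
  fixes R (structure)
  assumes "ring R" and two: "\<one> \<oplus> \<one> = \<zero>" and ab: "a \<in> carrier R" "b \<in> carrier R" "a \<oplus> b = \<one>"
    and cd: "c \<in> carrier R" "d \<in> carrier R" "c \<oplus> d = \<one>"
  shows "(a, b) \<otimes>\<^bsub>sqrt_ext R \<one>\<^esub> (a, b) = \<one>\<^bsub>sqrt_ext R \<one>\<^esub>"
    and "(a, b) \<otimes>\<^bsub>sqrt_ext R \<one>\<^esub> (c, d) = (c, d) \<otimes>\<^bsub>sqrt_ext R \<one>\<^esub> (a, b)"
proof -
  interpret ring R by fact
  have a: "a = \<one> \<oplus> b" and c: "c = \<one> \<oplus> d"
    using ab cd char_two_eq_iff[OF two] by auto
  show "(a, b) \<otimes>\<^bsub>sqrt_ext R \<one>\<^esub> (a, b) = \<one>\<^bsub>sqrt_ext R \<one>\<^esub>"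
    using ab(2) by (simp add: a l_distr r_distr a_ac char_two_simps[OF two])
  show "(a, b) \<otimes>\<^bsub>sqrt_ext R \<one>\<^esub> (c, d) = (c, d) \<otimes>\<^bsub>sqrt_ext R \<one>\<^esub> (a, b)"
    using ab(2) cd(2) by (simp add: a c l_distr r_distr a_ac char_two_simps[OF two])
qed

section \<open>The target algebra\<close>

type_synonym 'a block = "(('a \<times> 'a) \<times> ('a \<times> 'a)) \<times> ((nat \<times> nat \<Rightarrow> 'a) \<times> (nat \<times> nat \<Rightarrow> 'a))"

text \<open>In characteristic two, the group algebra of \<open>C\<^sub>4\<close> over \<open>P\<close> is \<open>P[z][y]\<close> with \<open>z\<^sup>2 = 1\<close> and
  \<open>y\<^sup>2 = z\<close>, and the remaining block of the group algebra of \<open>Q\<^sub>1\<^sub>2\<close> is the ring of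
  \<open>2 \<times> 2\<close> matrices over \<open>P[z]\<close>.\<close>

definition block_ring :: "('a, 'm) ring_scheme \<Rightarrow> 'a block ring" where
  "block_ring P = RDirProd (sqrt_ext (sqrt_ext P \<one>\<^bsub>P\<^esub>) (\<zero>\<^bsub>P\<^esub>, \<one>\<^bsub>P\<^esub>))
     (sqrt_ext (matrix_ring 2 P) \<one>\<^bsub>matrix_ring 2 P\<^esub>)"

locale char_two_cring = cring P for P :: "('a, 'm) ring_scheme" (structure) +
  assumes one_add_one: "\<one> \<oplus> \<one> = \<zero>"
begin

abbreviation MR :: "(nat \<times> nat \<Rightarrow> 'a) ring" where "MR \<equiv> matrix_ring 2 P"

abbreviation BR :: "'a block ring" where "BR \<equiv> block_ring P"

abbreviation block_mult (infixl "\<star>" 70) where "v \<star> w \<equiv> v \<otimes>\<^bsub>BR\<^esub> w"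

sublocale MP: ring "MR" by (rule ring_matrix_ring[OF ring_axioms])

lemmas two_simps = char_two_simps[OF one_add_one]
lemmas MP_two_simps = MP.char_two_simps[OF matrix_ring_char_two[OF one_add_one ring_axioms]]

lemma ring_block_ring: "ring BR"
  unfolding block_ring_def
  by (intro RDirProd_ring cring.axioms(1)[OF cring_sqrt_ext] cring_sqrt_ext ring_sqrt_ext
      cring_axioms MP.ring_axioms) auto

lemma carrier_block_ring [simp]: "carrier BR = ((carrier P \<times> carrier P) \<times> (carrier P \<times> carrier P)) \<times>
   (carrier MR \<times> carrier MR)"
  by (simp add: block_ring_def)

text \<open>The map z, y -> 1 on both blocks, where ((a, b), (c, d)) stands for a + b z + (c + d z)
  y. With \<open>aug_target\<close> as codomain, the units on the right are U(P) x GL(2, P).\<close>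

definition aug :: "'a block \<Rightarrow> 'a \<times> (nat \<times> nat \<Rightarrow> 'a)" where
  "aug = (\<lambda>(((a, b), (c, d)), (M, N)). (a \<oplus> b \<oplus> (c \<oplus> d), M \<oplus>\<^bsub>MR\<^esub> N))"

definition aug_section :: "'a \<times> (nat \<times> nat \<Rightarrow> 'a) \<Rightarrow> 'a block" where
  "aug_section = (\<lambda>(u, M). (((u, \<zero>), (\<zero>, \<zero>)), (M, \<zero>\<^bsub>MR\<^esub>)))"

abbreviation aug_target :: "('a \<times> (nat \<times> nat \<Rightarrow> 'a)) monoid" where
  "aug_target \<equiv> P \<times>\<times> matrix_monoid 2 P"

lemma aug_hom: "aug \<in> hom BR aug_target" "aug \<one>\<^bsub>BR\<^esub> = \<one>\<^bsub>aug_target\<^esub>"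
  by (auto simp: hom_def aug_def block_ring_def matrix_monoid_eq l_distr r_distr a_ac
      MP.l_distr MP.r_distr MP.a_ac)

lemma aug_section_hom:
  "aug_section \<in> hom aug_target BR" "aug_section \<one>\<^bsub>aug_target\<^esub> = \<one>\<^bsub>BR\<^esub>"
  by (auto simp: hom_def aug_section_def block_ring_def matrix_monoid_eq)

lemma aug_aug_section: "x \<in> carrier aug_target \<Longrightarrow> aug (aug_section x) = x"
  by (auto simp: aug_def aug_section_def matrix_monoid_eq)

lemma square_add: "x \<in> carrier P \<Longrightarrow> y \<in> carrier P \<Longrightarrow> (x \<oplus> y) \<otimes> (x \<oplus> y) = x \<otimes> x \<oplus> y \<otimes> y"
  by (simp add: l_distr r_distr m_comm a_ac two_simps)

text \<open>Squaring is additive on the commutative block, so a + b z + (c + d z) y squares to (a +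
  b)^2 + (c + d)^2 z, because y^2 = z and z^2 = 1. As a + b = 1 + (c + d), this is 1 + u (1 + z),
  whose square is 1. The matrix block squares to one at once by
  \<open>one_coset_involution\<close>.\<close>

lemma aug_kernel_square:
  assumes abcd: "a \<in> carrier P" "b \<in> carrier P" "c \<in> carrier P" "d \<in> carrier P" "a \<oplus> b \<oplus> (c \<oplus> d) = \<one>"
    and MN: "M \<in> carrier MR" "N \<in> carrier MR" "M \<oplus>\<^bsub>MR\<^esub> N = \<one>\<^bsub>MR\<^esub>"
  defines "x \<equiv> (((a, b), (c, d)), (M, N))" and "u \<equiv> (c \<oplus> d) \<otimes> (c \<oplus> d)"
  shows "x \<star> x = (((\<one> \<oplus> u, u), (\<zero>, \<zero>)), (\<one>\<^bsub>MR\<^esub>, \<zero>\<^bsub>MR\<^esub>))"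
    and "(x \<star> x) \<star> (x \<star> x) = \<one>\<^bsub>BR\<^esub>"
proof -
  have u: "u \<in> carrier P" using abcd by (simp add: u_def)
  have "a \<oplus> b = \<one> \<oplus> (c \<oplus> d)" using abcd by (simp add: char_two_eq_iff[OF one_add_one])
  then have "(a \<oplus> b) \<otimes> (a \<oplus> b) = (\<one> \<oplus> (c \<oplus> d)) \<otimes> (\<one> \<oplus> (c \<oplus> d))" by simp
  also have "\<dots> = \<one> \<oplus> u" using abcd by (subst square_add) (simp_all add: u_def)
  finally have u1: "a \<otimes> a \<oplus> b \<otimes> b = \<one> \<oplus> u" using abcd by (simp add: square_add)
  have u2: "c \<otimes> c \<oplus> d \<otimes> d = u" using abcd by (simp add: u_def square_add)
  have "a \<otimes> b \<oplus> b \<otimes> a = \<zero>" "c \<otimes> d \<oplus> d \<otimes> c = \<zero>"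
    "a \<otimes> c \<oplus> b \<otimes> d \<oplus> (c \<otimes> a \<oplus> d \<otimes> b) = \<zero>" "a \<otimes> d \<oplus> b \<otimes> c \<oplus> (c \<otimes> b \<oplus> d \<otimes> a) = \<zero>"
    using abcd by (simp_all add: m_comm a_ac two_simps)
  then show *: "x \<star> x = (((\<one> \<oplus> u, u), (\<zero>, \<zero>)), (\<one>\<^bsub>MR\<^esub>, \<zero>\<^bsub>MR\<^esub>))"
    using abcd u u1 u2
      one_coset_involution(1)[OF MP.ring_axioms matrix_ring_char_two[OF one_add_one ring_axioms] MN MN]
    by (simp add: x_def block_ring_def)
  show "(x \<star> x) \<star> (x \<star> x) = \<one>\<^bsub>BR\<^esub>"
    unfolding * using u by (simp add: block_ring_def square_add a_ac l_distr r_distr two_simps)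
qed

lemma aug_kernel_comm:
  assumes "x \<in> carrier BR" "aug x = \<one>\<^bsub>aug_target\<^esub>" "y \<in> carrier BR" "aug y = \<one>\<^bsub>aug_target\<^esub>"
  shows "x \<star> y = y \<star> x"
proof -
  interpret T: cring "sqrt_ext (sqrt_ext P \<one>) (\<zero>, \<one>)"
    by (intro cring_sqrt_ext cring_axioms) auto
  obtain s M N t M' N' where xy: "x = (s, (M, N))" "y = (t, (M', N'))"
    by (metis surj_pair)
  have "M \<oplus>\<^bsub>MR\<^esub> N = \<one>\<^bsub>MR\<^esub>" "M' \<oplus>\<^bsub>MR\<^esub> N' = \<one>\<^bsub>MR\<^esub>"
    using assms(2,4) by (auto simp: xy aug_def matrix_monoid_eq split: prod.splits)
  moreover have "s \<in> carrier (sqrt_ext (sqrt_ext P \<one>) (\<zero>, \<one>))" "t \<in> carrier (sqrt_ext (sqrt_ext P \<one>) (\<zero>, \<one>))"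
    "M \<in> carrier MR" "N \<in> carrier MR"
    "M' \<in> carrier MR" "N' \<in> carrier MR"
    using assms(1,3) by (auto simp: xy)
  ultimately show ?thesis
    using one_coset_involution(2)[OF MP.ring_axioms matrix_ring_char_two[OF one_add_one ring_axioms], of M N M' N']
      T.m_comm[of s t]
    by (simp add: xy block_ring_def del: sqrt_ext_simps)
qed

lemma card_matrix_ring: "card (carrier MR) = card (carrier P) ^ 4"
  by (simp add: matrix_ring_simps card_PiE card_cartesian_product)

text \<open>The augmentation conditions determine a and M, which leaves b, c, d and the four entries
  of N: hence the exponent 7.\<close>

lemma card_aug_kernel:
  "card {w \<in> carrier BR. aug w = \<one>\<^bsub>aug_target\<^esub>} = card (carrier P) ^ 7"
proof -
  let ?f = "\<lambda>((b, c, d), M). (((\<one> \<oplus> b \<oplus> (c \<oplus> d), b), (c, d)), (\<one>\<^bsub>MR\<^esub> \<oplus>\<^bsub>MR\<^esub> M, M))"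
  let ?D = "(carrier P \<times> carrier P \<times> carrier P) \<times> carrier MR"
  have "bij_betw ?f ?D {w \<in> carrier BR. aug w = \<one>\<^bsub>aug_target\<^esub>}"
  proof (rule bij_betwI[where g = "\<lambda>(((a, b), (c, d)), (M, N)). ((b, c, d), N)"])
    show "?f \<in> ?D \<rightarrow> {w \<in> carrier BR. aug w = \<one>\<^bsub>aug_target\<^esub>}"
      by (auto simp: aug_def matrix_monoid_eq a_ac two_simps MP.a_ac MP_two_simps)
    show "?f ((\<lambda>(((a, b), (c, d)), (M, N)). ((b, c, d), N)) w) = w"
      if "w \<in> {w \<in> carrier BR. aug w = \<one>\<^bsub>aug_target\<^esub>}" for w
    proof -
      obtain a b c d M N where w: "w = (((a, b), (c, d)), (M, N))" by (metis surj_pair)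
      have m: "a \<in> carrier P" "b \<in> carrier P" "c \<in> carrier P" "d \<in> carrier P"
        "M \<in> carrier MR" "N \<in> carrier MR" using that by (auto simp: w)
      have "a \<oplus> b \<oplus> (c \<oplus> d) = \<one>" "M \<oplus>\<^bsub>MR\<^esub> N = \<one>\<^bsub>MR\<^esub>"
        using that by (auto simp: w aug_def matrix_monoid_eq)
      then have "\<one> \<oplus> b \<oplus> (c \<oplus> d) = a" "\<one>\<^bsub>MR\<^esub> \<oplus>\<^bsub>MR\<^esub> N = M"
        using m char_two_eq_iff[OF one_add_one, of a "b \<oplus> (c \<oplus> d)" \<one>]
          MP.char_two_eq_iff[OF matrix_ring_char_two[OF one_add_one ring_axioms], of M N "\<one>\<^bsub>MR\<^esub>"]
        by (simp_all add: a_assoc)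
      then show ?thesis by (simp add: w)
    qed
  qed auto
  then have "card {w \<in> carrier BR. aug w = \<one>\<^bsub>aug_target\<^esub>} = card ?D"
    by (simp add: bij_betw_same_card)
  also have "\<dots> = card (carrier P) ^ 7"
    by (simp add: card_cartesian_product card_matrix_ring power_numeral_reduce)
  finally show ?thesis .
qed

text \<open>The squares are parametrised by v -> v^2, an additive map in characteristic two, which
  is injective because P has no nonzero element of square zero.\<close>

lemma card_aug_kernel_squares:
  assumes reduced: "\<And>x. x \<in> carrier P \<Longrightarrow> x \<otimes> x = \<zero> \<Longrightarrow> x = \<zero>"
  shows "card ((\<lambda>x. x \<star> x) ` {w \<in> carrier BR. aug w = \<one>\<^bsub>aug_target\<^esub>}) = card (carrier P)"
proof -
  let ?f = "\<lambda>v. (((\<one> \<oplus> v \<otimes> v, v \<otimes> v), (\<zero>, \<zero>)), (\<one>\<^bsub>MR\<^esub>, \<zero>\<^bsub>MR\<^esub>))"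
  let ?N = "{w \<in> carrier BR. aug w = \<one>\<^bsub>aug_target\<^esub>}"
  have "(\<lambda>x. x \<star> x) ` ?N = ?f ` carrier P"
  proof (intro equalityI subsetI)
    fix y assume "y \<in> (\<lambda>x. x \<star> x) ` ?N"
    then obtain w where w: "w \<in> ?N" "y = w \<star> w" by auto
    obtain a b c d M N where w': "w = (((a, b), (c, d)), (M, N))" by (metis surj_pair)
    have m: "a \<in> carrier P" "b \<in> carrier P" "c \<in> carrier P" "d \<in> carrier P" "a \<oplus> b \<oplus> (c \<oplus> d) = \<one>"
      "M \<in> carrier MR" "N \<in> carrier MR"
      "M \<oplus>\<^bsub>MR\<^esub> N = \<one>\<^bsub>MR\<^esub>"
      using w(1) by (auto simp: w' aug_def matrix_monoid_eq)
    show "y \<in> ?f ` carrier P"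
      unfolding w(2) w' aug_kernel_square(1)[OF m] using m by auto
  next
    fix y assume "y \<in> ?f ` carrier P"
    then obtain v where v: "v \<in> carrier P" "y = ?f v" by auto
    \<comment> \<open>The element 1 + v + v y of the first block: its square is 1 + v^2 + v^2
      z.\<close>
    let ?w = "(((\<one> \<oplus> v, \<zero>), (v, \<zero>)), (\<one>\<^bsub>MR\<^esub>, \<zero>\<^bsub>MR\<^esub>))"
    have "?w \<in> ?N" using v by (simp add: aug_def matrix_monoid_eq a_ac two_simps)
    moreover have "y = ?w \<star> ?w"
      by (subst aug_kernel_square(1)) (use v in \<open>simp_all add: a_ac two_simps\<close>)
    ultimately show "y \<in> (\<lambda>x. x \<star> x) ` ?N" by blast
  qed
  moreover have "inj_on ?f (carrier P)"
  proof (rule inj_onI)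
    fix u v assume uv: "u \<in> carrier P" "v \<in> carrier P" "?f u = ?f v"
    then have "(u \<oplus> v) \<otimes> (u \<oplus> v) = \<zero>" by (simp add: square_add two_simps)
    then have "u \<oplus> v = \<zero>" using reduced[OF a_closed[OF uv(1,2)]] by blast
    then show "u = v" using uv(1,2) char_two_eq_iff[OF one_add_one, of u v \<zero>] by simp
  qed
  ultimately show ?thesis by (simp add: card_image)
qed

text \<open>The kernel has order 2^(7m) with 2^m squares, so there are m factors C_4 and 7m - 2m =
  5m factors C_2.\<close>

lemma units_block_ring:
  assumes card: "card (carrier P) = 2 ^ m"
    and reduced: "\<And>x. x \<in> carrier P \<Longrightarrow> x \<otimes> x = \<zero> \<Longrightarrow> x = \<zero>"
    and B: "group B" and iso: "units_of P \<times>\<times> GL 2 P \<cong> B"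
  defines "A \<equiv> direct_power (integer_mod_group 2) (5 * m) \<times>\<times> direct_power (integer_mod_group 4) m"
  shows "\<exists>\<theta> \<in> hom B (AutoGroup A). units_of BR \<cong> semidirect_product A B \<theta>"
  unfolding A_def
proof (rule units_iso_semidirect_product[OF _ _ aug_hom aug_section_hom aug_aug_section HOL.refl])
  interpret W: ring "BR" by (rule ring_block_ring)
  let ?N = "{w \<in> carrier BR. aug w = \<one>\<^bsub>aug_target\<^esub>}"
  show "monoid BR" by (rule W.monoid_axioms)
  show "monoid aug_target" by (intro DirProd_monoid monoid_axioms monoid_matrix_monoid ring_axioms)
  show cN: "card ?N = 2 ^ (5 * m + 2 * m)"
    unfolding card_aug_kernel card by (simp add: power_mult[symmetric] mult.commute)
  show "finite ?N" by (rule card_ge_0_finite) (unfold cN, simp)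
  show "card ((\<lambda>x. x \<star> x) ` ?N) = 2 ^ m"
    using card_aug_kernel_squares[OF reduced] card by simp
  show "x \<star> y = y \<star> x" if "x \<in> ?N" "y \<in> ?N" for x y
    using that aug_kernel_comm by blast
  show "(x \<star> x) \<star> (x \<star> x) = \<one>\<^bsub>BR\<^esub>" if "x \<in> ?N" for x
  proof -
    obtain a b c d M N where x: "x = (((a, b), (c, d)), (M, N))" by (metis surj_pair)
    show ?thesis unfolding x
      by (rule aug_kernel_square(2)) (use that in \<open>auto simp: x aug_def matrix_monoid_eq\<close>)
  qed
  show "units_of aug_target \<cong> B" using iso by (simp add: units_of_DirProd GL_def)
qed (use B in simp_all)

end

section \<open>The quaternion group of order 12, its group algebra and its matrix
  representation\<close>

section \<open>Presented groups\<close>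

lemma word_eq_context: "word_eq R u v \<Longrightarrow> word_eq R (a @ u @ b) (a @ v @ b)"
proof (induction rule: word_eq.induct)
  case (cancel u g s v)
  show ?case using word_eq.cancel[of R "a @ u" g s "v @ b"] by simp
next
  case (relation r r' u v)
  show ?case using word_eq.relation[OF relation, of "a @ u" "v @ b"] by simp
qed (blast intro: word_eq.refl word_eq.sym word_eq.trans)+

lemma word_eq_append:
  assumes "word_eq R u u'" and "word_eq R v v'"
  shows "word_eq R (u @ v) (u' @ v')"
  using word_eq_context[OF assms(1), of "[]" v] word_eq_context[OF assms(2), of u' "[]"]
  by (auto intro: word_eq.trans)

definition word_class :: "('g word \<times> 'g word) set \<Rightarrow> 'g word \<Rightarrow> 'g word set" where
  "word_class R u = {w. word_eq R u w}"

lemma word_class_eq_iff: "word_class R u = word_class R v \<longleftrightarrow> word_eq R u v"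
  unfolding word_class_def by (blast intro: word_eq.refl word_eq.sym word_eq.trans)

lemma carrier_presented_group: "carrier (presented_group R) = range (word_class R)"
  by (auto simp: presented_group_def quotient_def word_class_def)

lemma one_presented_group: "\<one>\<^bsub>presented_group R\<^esub> = word_class R []"
  by (simp add: presented_group_def word_class_def)

lemma mult_presented_group:
  "word_class R u \<otimes>\<^bsub>presented_group R\<^esub> word_class R v = word_class R (u @ v)"
  unfolding presented_group_def word_class_def
  by (auto intro: word_eq.refl word_eq.trans word_eq_append)

lemma word_eq_inverse: "word_eq R (rev (map (\<lambda>(g, s). (g, \<not> s)) w) @ w) []"
proof (induction w)
  case (Cons p w)
  obtain g s where p: "p = (g, s)" by fastforce
  have "word_eq R (rev (map (\<lambda>(g, s). (g, \<not> s)) w) @ [(g, \<not> s), (g, \<not> \<not> s)] @ w)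
      (rev (map (\<lambda>(g, s). (g, \<not> s)) w) @ w)"
    by (rule word_eq.cancel)
  then show ?case using Cons by (auto simp: p intro: word_eq.trans)
qed (simp add: word_eq.refl)

lemma group_presented_group: "group (presented_group R)"
proof (rule groupI)
  fix x assume "x \<in> carrier (presented_group R)"
  then obtain w where "x = word_class R w" by (auto simp: carrier_presented_group)
  then show "\<exists>y\<in>carrier (presented_group R). y \<otimes>\<^bsub>presented_group R\<^esub> x = \<one>\<^bsub>presented_group R\<^esub>"
    using word_eq_inverse[of R w]
    by (auto simp: carrier_presented_group mult_presented_group one_presented_group word_class_eq_iff)
qed (auto simp: carrier_presented_group mult_presented_group one_presented_group)

context monoid
begin

text \<open>The values of the inverse letters are a separate argument \<open>f'\<close>, so that
  words can be evaluated in the multiplicative monoid of a ring, where not every element is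
  invertible.\<close>

definition eval_word :: "('g \<Rightarrow> 'a) \<Rightarrow> ('g \<Rightarrow> 'a) \<Rightarrow> 'g word \<Rightarrow> 'a" where
  "eval_word f f' w = foldr (\<lambda>(g, s) x. (if s then f g else f' g) \<otimes> x) w \<one>"

context
  fixes f f' :: "'g \<Rightarrow> 'a"
  assumes f: "\<And>g. f g \<in> carrier G" "\<And>g. f' g \<in> carrier G"
    and inverse: "\<And>g. f g \<otimes> f' g = \<one>" "\<And>g. f' g \<otimes> f g = \<one>"
begin

lemma eval_word_closed: "eval_word f f' w \<in> carrier G"
  by (induction w) (auto simp: eval_word_def f)

lemma eval_word_append: "eval_word f f' (u @ v) = eval_word f f' u \<otimes> eval_word f f' v"
proof (induction u)
  case Nil
  then show ?case using eval_word_closed[of v] by (simp add: eval_word_def)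
next
  case (Cons p u)
  then show ?case
    using eval_word_closed[of v] eval_word_closed[of u] f
    by (auto simp: eval_word_def m_assoc split: prod.splits)
qed

lemma eval_word_eq:
  assumes "word_eq R u v" and rel: "\<And>r r'. (r, r') \<in> R \<Longrightarrow> eval_word f f' r = eval_word f f' r'"
  shows "eval_word f f' u = eval_word f f' v"
  using assms(1)
proof (induction rule: word_eq.induct)
  case (cancel u g s v)
  have "eval_word f f' [(g, s), (g, \<not> s)] = \<one>"
    using f inverse by (auto simp: eval_word_def)
  then show ?case using eval_word_closed by (simp only: eval_word_append l_one)
next
  case (relation r r' u v)
  then show ?case by (simp only: eval_word_append rel)
qed auto

lemma presented_group_hom:
  assumes rel: "\<And>r r'. (r, r') \<in> R \<Longrightarrow> eval_word f f' r = eval_word f f' r'"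
  shows "\<exists>\<rho> \<in> hom (presented_group R) G. \<forall>w. \<rho> (word_class R w) = eval_word f f' w"
proof -
  define \<rho> where "\<rho> = (\<lambda>C. eval_word f f' (SOME w. w \<in> C))"
  have \<rho>: "\<rho> (word_class R w) = eval_word f f' w" for w
  proof -
    have "w \<in> word_class R w" by (simp add: word_class_def word_eq.refl)
    then have "(SOME u. u \<in> word_class R w) \<in> word_class R w" by (rule someI)
    then have "word_eq R w (SOME u. u \<in> word_class R w)" by (simp add: word_class_def)
    then show ?thesis unfolding \<rho>_def by (metis eval_word_eq rel)
  qed
  have "\<rho> \<in> hom (presented_group R) G"
    by (rule homI) (auto simp: carrier_presented_group mult_presented_group \<rho> eval_word_append eval_word_closed)
  then show ?thesis using \<rho> by blast
qed

end

end

section \<open>The group \<open>Q\<^sub>1\<^sub>2\<close>\<close>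

definition Q12_relations :: "(xy_generator word \<times> xy_generator word) set" where
  "Q12_relations = (let x = (Gen_x, True); y = (Gen_y, True) in
     {([x, x, x], []), ([y, y, y, y], []), ([x, y], [y, x, x])})"

lemma Q12_eq: "Q12 = presented_group Q12_relations"
  by (simp add: Q12_def Q12_relations_def Let_def)

definition Q12_x :: "xy_generator word set" where "Q12_x = word_class Q12_relations [(Gen_x, True)]"
definition Q12_y :: "xy_generator word set" where "Q12_y = word_class Q12_relations [(Gen_y, True)]"

lemma group_Q12: "group Q12"
  unfolding Q12_eq by (rule group_presented_group)

interpretation Q12: group Q12 by (rule group_Q12)

lemma Q12_gens [simp]: "Q12_x \<in> carrier Q12" "Q12_y \<in> carrier Q12"
  by (simp_all add: Q12_x_def Q12_y_def Q12_eq carrier_presented_group)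

lemma Q12_rels:
  "Q12_x [^]\<^bsub>Q12\<^esub> (3::nat) = \<one>\<^bsub>Q12\<^esub>" "Q12_y [^]\<^bsub>Q12\<^esub> (4::nat) = \<one>\<^bsub>Q12\<^esub>"
  "Q12_x \<otimes>\<^bsub>Q12\<^esub> Q12_y = Q12_y \<otimes>\<^bsub>Q12\<^esub> (Q12_x \<otimes>\<^bsub>Q12\<^esub> Q12_x)"
proof -
  have rel: "word_class Q12_relations r = word_class Q12_relations r'" if "(r, r') \<in> Q12_relations" for r r'
    using word_eq.relation[OF that, of "[]" "[]"] by (simp add: word_class_eq_iff)
  have 1: "\<one>\<^bsub>Q12\<^esub> = word_class Q12_relations []" by (simp add: Q12_eq one_presented_group)
  have m: "word_class Q12_relations u \<otimes>\<^bsub>Q12\<^esub> word_class Q12_relations v = word_class Q12_relations (u @ v)" for u v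
    by (simp add: Q12_eq mult_presented_group)
  show "Q12_x [^]\<^bsub>Q12\<^esub> (3::nat) = \<one>\<^bsub>Q12\<^esub>" "Q12_y [^]\<^bsub>Q12\<^esub> (4::nat) = \<one>\<^bsub>Q12\<^esub>"
    "Q12_x \<otimes>\<^bsub>Q12\<^esub> Q12_y = Q12_y \<otimes>\<^bsub>Q12\<^esub> (Q12_x \<otimes>\<^bsub>Q12\<^esub> Q12_x)"
    by (simp_all add: numeral_eq_Suc Q12_x_def Q12_y_def 1 m) (rule rel, simp add: Q12_relations_def Let_def)+
qed

context group
begin

context
  fixes x y
  assumes x: "x \<in> carrier G" and y: "y \<in> carrier G"
    and rels: "x [^] (3::nat) = \<one>" "y [^] (4::nat) = \<one>" "x \<otimes> y = y \<otimes> (x \<otimes> x)"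
begin

text \<open>The relation moves x past y from left to right; x^3 = 1 reverses it: x^2 y = x y x^2 = y
  x^4 = y x.\<close>

lemma dicyclic_commute: "y \<otimes> x [^] (r::nat) = x [^] (2 * r) \<otimes> y"
proof (induction r)
  case (Suc r)
  have xxx: "x \<otimes> (x \<otimes> x) = \<one>" using rels(1) x by (simp add: numeral_eq_Suc m_assoc)
  have "x \<otimes> (x \<otimes> y) = x \<otimes> (y \<otimes> (x \<otimes> x))" by (simp only: rels(3))
  also have "\<dots> = (x \<otimes> y) \<otimes> (x \<otimes> x)" using x y by (simp add: m_assoc)
  also have "\<dots> = (y \<otimes> (x \<otimes> x)) \<otimes> (x \<otimes> x)" by (simp only: rels(3))
  also have "\<dots> = y \<otimes> (x \<otimes> (x \<otimes> (x \<otimes> x)))" using x y by (simp add: m_assoc)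
  finally have yx: "y \<otimes> x = x \<otimes> (x \<otimes> y)" using x by (simp add: xxx)
  have "y \<otimes> x [^] Suc r = (y \<otimes> x [^] r) \<otimes> x" using x y by (simp add: m_assoc)
  also have "\<dots> = x [^] (2 * r) \<otimes> (x \<otimes> (x \<otimes> y))" using x y by (simp add: Suc m_assoc yx)
  also have "\<dots> = x [^] (2 * Suc r) \<otimes> y" using x y by (simp add: m_assoc)
  finally show ?case .
qed (use y in simp)

lemma dicyclic_words:
  defines "H \<equiv> (\<lambda>(r, s). x [^] r \<otimes> y [^] s) ` ({..<3::nat} \<times> {..<4::nat})"
  shows "x [^] (r::nat) \<otimes> y [^] (s::nat) \<in> H"
    and "h \<in> H \<Longrightarrow> x \<otimes> h \<in> H" and "h \<in> H \<Longrightarrow> y \<otimes> h \<in> H"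
proof -
  have pow_mod: "z [^] (m mod k) = z [^] m" if "z \<in> carrier G" "z [^] k = \<one>" for z and m k :: nat
  proof -
    have "z [^] m = z [^] (k * (m div k) + m mod k)" by simp
    also have "\<dots> = (z [^] k) [^] (m div k) \<otimes> z [^] (m mod k)"
      using that(1) by (simp only: nat_pow_mult nat_pow_pow)
    finally show ?thesis using that by simp
  qed
  show mem: "x [^] (r::nat) \<otimes> y [^] (s::nat) \<in> H" for r s
    unfolding H_def by (rule image_eqI[where x = "(r mod 3, s mod 4)"]) (simp_all add: pow_mod rels x y)
  show "x \<otimes> h \<in> H" if "h \<in> H"
  proof -
    from that obtain r s :: nat where "h = x [^] r \<otimes> y [^] s" unfolding H_def by auto
    then have "x \<otimes> h = x [^] Suc r \<otimes> y [^] s" using x y by (simp only: nat_pow_Suc2 m_assoc nat_pow_closed)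
    then show ?thesis by (simp only: mem)
  qed
  show "y \<otimes> h \<in> H" if "h \<in> H"
  proof -
    from that obtain r s :: nat where h: "h = x [^] r \<otimes> y [^] s" unfolding H_def by auto
    have "y \<otimes> h = (y \<otimes> x [^] r) \<otimes> y [^] s" using x y by (simp add: h m_assoc)
    also have "\<dots> = x [^] (2 * r) \<otimes> y [^] Suc s"
      using x y by (simp only: dicyclic_commute nat_pow_Suc2 m_assoc nat_pow_closed)
    finally show ?thesis by (simp only: mem)
  qed
qed

end

end

text \<open>The words x^r y^s contain the identity and are stable under left multiplication by x and
  y, so they exhaust the group. That the twelve words are distinct is seen only later, from their
  images in the block algebra.\<close>

lemma carrier_Q12:
  "carrier Q12 = (\<lambda>(r, s). Q12_x [^]\<^bsub>Q12\<^esub> r \<otimes>\<^bsub>Q12\<^esub> Q12_y [^]\<^bsub>Q12\<^esub> s) ` ({..<3::nat} \<times> {..<4::nat})"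
    (is "_ = ?H")
proof
  show "?H \<subseteq> carrier Q12" by auto
  let ?x = Q12_x and ?y = Q12_y
  note words = Q12.dicyclic_words[OF Q12_gens Q12_rels]
  note x_mem = words(2) and y_mem = words(3)
  have "word_class Q12_relations w \<in> ?H" for w
  proof (induction w)
    case Nil
    have "word_class Q12_relations [] = \<one>\<^bsub>Q12\<^esub>" by (simp add: Q12_eq one_presented_group)
    then show ?case using words(1)[of 0 0] by simp
  next
    case (Cons p w)
    obtain g s where p: "p = (g, s)" by fastforce
    have c: "word_class Q12_relations w \<in> carrier Q12" by (simp add: Q12_eq carrier_presented_group)
    have cons: "word_class Q12_relations (p # w) = word_class Q12_relations [(g, s)] \<otimes>\<^bsub>Q12\<^esub> word_class Q12_relations w"
      by (simp add: p Q12_eq mult_presented_group)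
    have inv: "word_class Q12_relations [(g, False)] \<otimes>\<^bsub>Q12\<^esub> word_class Q12_relations [(g, True)] = \<one>\<^bsub>Q12\<^esub>" for g
      using word_eq.cancel[of Q12_relations "[]" g False "[]"]
      by (simp add: Q12_eq mult_presented_group one_presented_group word_class_eq_iff)
    have i: "word_class Q12_relations [(g, False)] = inv\<^bsub>Q12\<^esub> word_class Q12_relations [(g, True)]" for g
      by (rule Q12.inv_equality[OF inv, symmetric]) (simp_all add: Q12_eq carrier_presented_group)
    \<comment> \<open>Inverse letters are rewritten as the positive words x^2 and y^3, so that
      stability under left multiplication by x and y covers them too.\<close>
    have ix: "inv\<^bsub>Q12\<^esub> ?x = ?x \<otimes>\<^bsub>Q12\<^esub> ?x"
      by (rule Q12.inv_equality) (use Q12_rels(1) in \<open>simp_all add: numeral_eq_Suc\<close>)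
    have iy: "inv\<^bsub>Q12\<^esub> ?y = ?y \<otimes>\<^bsub>Q12\<^esub> ?y \<otimes>\<^bsub>Q12\<^esub> ?y"
      by (rule Q12.inv_equality) (use Q12_rels(2) in \<open>simp_all add: numeral_eq_Suc\<close>)
    show ?case
    proof (cases g)
      case Gen_x
      have "word_class Q12_relations [(g, s)] = (if s then ?x else ?x \<otimes>\<^bsub>Q12\<^esub> ?x)"
        using i[of Gen_x] ix by (auto simp: Gen_x Q12_x_def)
      then show ?thesis using cons Cons x_mem c by (auto simp: Q12.m_assoc)
    next
      case Gen_y
      have "word_class Q12_relations [(g, s)] = (if s then ?y else ?y \<otimes>\<^bsub>Q12\<^esub> ?y \<otimes>\<^bsub>Q12\<^esub> ?y)"
        using i[of Gen_y] iy by (auto simp: Gen_y Q12_y_def)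
      then show ?thesis using cons Cons y_mem c by (auto simp: Q12.m_assoc)
    qed
  qed
  then show "carrier Q12 \<subseteq> ?H" by (auto simp: Q12_eq carrier_presented_group)
qed

text \<open>The relations themselves supply the inverses x^2 and y^3. Hence any monoid can serve as
  target, in particular the multiplicative monoid of the block algebra.\<close>

lemma (in monoid) Q12_hom:
  assumes x: "x \<in> carrier G" and y: "y \<in> carrier G"
    and rels: "x [^] (3::nat) = \<one>" "y [^] (4::nat) = \<one>" "x \<otimes> y = y \<otimes> (x \<otimes> x)"
  shows "\<exists>\<rho> \<in> hom Q12 G. \<forall>(r::nat) (s::nat). \<rho> (Q12_x [^]\<^bsub>Q12\<^esub> r \<otimes>\<^bsub>Q12\<^esub> Q12_y [^]\<^bsub>Q12\<^esub> s) = x [^] r \<otimes> y [^] s"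
proof -
  define f where "f = (\<lambda>g. case g of Gen_x \<Rightarrow> x | Gen_y \<Rightarrow> y)"
  define f' where "f' = (\<lambda>g. case g of Gen_x \<Rightarrow> x \<otimes> x | Gen_y \<Rightarrow> y \<otimes> (y \<otimes> y))"
  have xy: "x \<otimes> (x \<otimes> x) = \<one>" "y \<otimes> (y \<otimes> (y \<otimes> y)) = \<one>"
    using x y rels(1,2) by (simp_all add: numeral_eq_Suc m_assoc)
  have f: "f g \<in> carrier G" "f' g \<in> carrier G" "f g \<otimes> f' g = \<one>" "f' g \<otimes> f g = \<one>" for g
    using x y xy by (auto simp: f_def f'_def m_assoc split: xy_generator.splits)
  have rel: "eval_word f f' r = eval_word f f' r'" if "(r, r') \<in> Q12_relations" for r r'
    using that x y xy rels(3) by (auto simp: Q12_relations_def Let_def eval_word_def f_def)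
  obtain \<rho> where \<rho>: "\<rho> \<in> hom Q12 G" "\<And>w. \<rho> (word_class Q12_relations w) = eval_word f f' w"
    using presented_group_hom[of f f' Q12_relations, OF f rel] unfolding Q12_eq by blast
  have gens: "\<rho> Q12_x = x" "\<rho> Q12_y = y" "\<rho> \<one>\<^bsub>Q12\<^esub> = \<one>"
    using x y by (simp_all add: Q12_x_def Q12_y_def Q12_eq one_presented_group \<rho>(2) eval_word_def f_def)
  have pow: "\<rho> (z [^]\<^bsub>Q12\<^esub> r) = \<rho> z [^] r" if "z \<in> carrier Q12" for z and r :: nat
    by (induction r) (simp_all add: gens that hom_mult[OF \<rho>(1)])
  show ?thesis
    by (intro bexI[OF _ \<rho>(1)] allI) (simp add: hom_mult[OF \<rho>(1)] pow gens)
qed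

section \<open>Homomorphisms out of group algebras\<close>

text \<open>The universal property of the group algebra, in its multiplicative part. Centrality of
  the scalars allows h (b v) to be moved past \<open>\<rho> u\<close> when the convolution is
  expanded.\<close>

lemma group_algebra_hom:
  fixes S (structure)
  assumes F: "ring F" and G: "group G" and S: "ring S" and fin: "finite (carrier G)"
    and h: "h \<in> ring_hom F S" and central: "\<And>c x. c \<in> carrier F \<Longrightarrow> x \<in> carrier S \<Longrightarrow> x \<otimes> h c = h c \<otimes> x"
    and \<rho>: "\<rho> \<in> hom G S" "\<rho> \<one>\<^bsub>G\<^esub> = \<one>"
  defines "\<Theta> \<equiv> \<lambda>a. \<Oplus>g\<in>carrier G. h (a g) \<otimes> \<rho> g"
  shows "\<Theta> \<in> hom (group_algebra F G) S" and "\<Theta> \<one>\<^bsub>group_algebra F G\<^esub> = \<one>"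
proof -
  interpret F: ring F by fact
  interpret G: group G by fact
  interpret S: ring S by fact
  interpret h: ring_hom_ring F S h by (intro ring_hom_ringI2 F.ring_axioms S.ring_axioms h)
  have \<rho>c: "\<rho> g \<in> carrier S" if "g \<in> carrier G" for g using hom_in_carrier[OF \<rho>(1) that] .
  have cl: "a \<in> carrier G \<rightarrow> carrier F" if "a \<in> carrier (group_algebra F G)" for a
    using that by (auto simp: group_algebra_def)
  have \<Theta>c: "\<Theta> a \<in> carrier S" if "a \<in> carrier (group_algebra F G)" for a
    using cl[OF that] \<rho>c unfolding \<Theta>_def by (auto intro!: S.finsum_closed simp: Pi_iff)
  have "\<Theta> (a \<otimes>\<^bsub>group_algebra F G\<^esub> b) = \<Theta> a \<otimes> \<Theta> b"
    if a: "a \<in> carrier (group_algebra F G)" and b: "b \<in> carrier (group_algebra F G)" for a b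
  proof -
    let ?d = "\<lambda>u g. inv\<^bsub>G\<^esub> u \<otimes>\<^bsub>G\<^esub> g"
    let ?t = "\<lambda>u g. h (a u) \<otimes> \<rho> u \<otimes> (h (b (?d u g)) \<otimes> \<rho> (?d u g))"
    have ac: "a u \<in> carrier F" and bc: "b u \<in> carrier F" if "u \<in> carrier G" for u
      using cl[OF a] cl[OF b] that by auto
    have "h ((a \<otimes>\<^bsub>group_algebra F G\<^esub> b) g) \<otimes> \<rho> g
        = (\<Oplus>u\<in>carrier G. ?t u g)"
      if g: "g \<in> carrier G" for g
    proof -
      have "(a \<otimes>\<^bsub>group_algebra F G\<^esub> b) g
          = (\<Oplus>\<^bsub>F\<^esub>u\<in>{u \<in> carrier G. a u \<noteq> \<zero>\<^bsub>F\<^esub>}. a u \<otimes>\<^bsub>F\<^esub> b (?d u g))"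
        using g by (simp add: group_algebra_def)
      \<comment> \<open>The terms outside the support of \<open>a\<close> vanish; summing over all
        of G makes the index set independent of \<open>a\<close>, so that the two sums can be
        exchanged.\<close>
      also have "\<dots> = (\<Oplus>\<^bsub>F\<^esub>u\<in>carrier G. a u \<otimes>\<^bsub>F\<^esub> b (?d u g))"
        using g ac bc fin by (intro F.add.finprod_mono_neutral_cong_left) auto
      finally have "h ((a \<otimes>\<^bsub>group_algebra F G\<^esub> b) g)
          = (\<Oplus>u\<in>carrier G. h (a u \<otimes>\<^bsub>F\<^esub> b (?d u g)))"
        using g ac bc by (simp add: additive_hom_finsum[OF F.abelian_group_axioms S.abelian_group_axioms])
      then have "h ((a \<otimes>\<^bsub>group_algebra F G\<^esub> b) g) \<otimes> \<rho> g
          = (\<Oplus>u\<in>carrier G. h (a u \<otimes>\<^bsub>F\<^esub> b (?d u g)) \<otimes> \<rho> g)"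
        using g ac bc \<rho>c fin by (simp add: S.finsum_ldistr)
      also have "\<dots> = (\<Oplus>u\<in>carrier G. ?t u g)"
      proof (rule S.finsum_cong')
        fix u assume u: "u \<in> carrier G"
        have "\<rho> g = \<rho> (u \<otimes>\<^bsub>G\<^esub> (?d u g))" using u g by (simp add: G.m_assoc[symmetric])
        also have "\<dots> = \<rho> u \<otimes> \<rho> (?d u g)" using u g by (intro hom_mult[OF \<rho>(1)]) auto
        finally have \<rho>g: "\<rho> g = \<rho> u \<otimes> \<rho> (?d u g)" .
        have "h (b (?d u g)) \<otimes> (\<rho> u \<otimes> \<rho> (?d u g))
            = \<rho> u \<otimes> (h (b (?d u g)) \<otimes> \<rho> (?d u g))"
          using u g bc \<rho>c by (simp add: S.m_assoc[symmetric] central)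
        then show "h (a u \<otimes>\<^bsub>F\<^esub> b (?d u g)) \<otimes> \<rho> g
            = ?t u g"
          unfolding \<rho>g using u g ac bc \<rho>c by (simp add: S.m_assoc)
      qed (use g ac bc \<rho>c in auto)
      finally show ?thesis .
    qed
    then have "\<Theta> (a \<otimes>\<^bsub>group_algebra F G\<^esub> b) = (\<Oplus>g\<in>carrier G. \<Oplus>u\<in>carrier G.
        ?t u g)"
      unfolding \<Theta>_def using ac bc \<rho>c by (intro S.finsum_cong') (auto intro!: S.finsum_closed)
    also have "\<dots> = (\<Oplus>u\<in>carrier G. \<Oplus>g\<in>carrier G.
        ?t u g)"
      using ac bc \<rho>c fin by (intro S.finsum_swap) auto
    also have "\<dots> = (\<Oplus>u\<in>carrier G. h (a u) \<otimes> \<rho> u \<otimes> \<Theta> b)"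
    proof (rule S.finsum_cong')
      fix u assume u: "u \<in> carrier G"
      \<comment> \<open>For fixed u, left translation by the inverse of u permutes G, and the inner
        sum becomes \<open>\<Theta> b\<close>.\<close>
      have bij: "?d u ` carrier G = carrier G" "inj_on (?d u) (carrier G)"
        using u by (auto simp: G.surj_const_mult inj_on_def)
      have "(\<Oplus>g\<in>carrier G. ?t u g)
          = h (a u) \<otimes> \<rho> u \<otimes> (\<Oplus>g\<in>carrier G. h (b (?d u g)) \<otimes> \<rho> (?d u g))"
        using u ac bc \<rho>c fin by (intro S.finsum_rdistr[symmetric]) auto
      also have "(\<Oplus>g\<in>carrier G. h (b (?d u g)) \<otimes> \<rho> (?d u g)) = \<Theta> b"
        using S.finsum_reindex[of "\<lambda>g. h (b g) \<otimes> \<rho> g" "?d u" "carrier G"] bij bc \<rho>c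
        by (simp add: \<Theta>_def)
      finally show "(\<Oplus>g\<in>carrier G. ?t u g)
          = h (a u) \<otimes> \<rho> u \<otimes> \<Theta> b" .
    qed (use ac \<rho>c \<Theta>c[OF b] in auto)
    also have "\<dots> = (\<Oplus>u\<in>carrier G. h (a u) \<otimes> \<rho> u) \<otimes> \<Theta> b"
      using ac \<rho>c \<Theta>c[OF b] fin by (intro S.finsum_ldistr[symmetric]) auto
    also have "(\<Oplus>u\<in>carrier G. h (a u) \<otimes> \<rho> u) = \<Theta> a" by (simp add: \<Theta>_def)
    finally show ?thesis .
  qed
  then show "\<Theta> \<in> hom (group_algebra F G) S" using \<Theta>c by (auto simp: hom_def)
  have "\<Theta> \<one>\<^bsub>group_algebra F G\<^esub> = (\<Oplus>g\<in>carrier G. if \<one>\<^bsub>G\<^esub> = g then \<one> else \<zero>)"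
    unfolding \<Theta>_def by (intro S.finsum_cong') (auto simp: group_algebra_def \<rho> \<rho>c)
  then show "\<Theta> \<one>\<^bsub>group_algebra F G\<^esub> = \<one>" using fin by (simp add: S.finsum_singleton)
qed

section \<open>The representation of \<open>Q\<^sub>1\<^sub>2\<close>\<close>

definition mat2 :: "'a \<Rightarrow> 'a \<Rightarrow> 'a \<Rightarrow> 'a \<Rightarrow> nat \<times> nat \<Rightarrow> 'a" where
  "mat2 a b c d = (\<lambda>(i, j)\<in>{..<2} \<times> {..<2}. if i = 0 then (if j = 0 then a else b) else (if j = 0 then c else d))"

lemma mat2_eq_iff [simp]: "mat2 a b c d = mat2 a' b' c' d' \<longleftrightarrow> a = a' \<and> b = b' \<and> c = c' \<and> d = d'"
proof
  assume eq: "mat2 a b c d = mat2 a' b' c' d'"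
  show "a = a' \<and> b = b' \<and> c = c' \<and> d = d'"
    using fun_cong[OF eq, of "(0, 0)"] fun_cong[OF eq, of "(0, 1)"] fun_cong[OF eq, of "(1, 0)"]
      fun_cong[OF eq, of "(1, 1)"] by (simp add: mat2_def)
qed simp

lemma less_two_iff: "i < (2::nat) \<longleftrightarrow> i = 0 \<or> i = 1"
  by auto

lemma two_times_two: "{..<2} \<times> {..<2} = {(0::nat, 0::nat), (0, 1), (1, 0), (1, 1)}"
  by (auto simp: less_two_iff)

context ring
begin

lemma mat2_closed [simp]:
  "mat2 a b c d \<in> carrier (matrix_ring 2 R) \<longleftrightarrow> a \<in> carrier R \<and> b \<in> carrier R \<and> c \<in> carrier R \<and> d \<in> carrier R"
  by (auto simp: mat2_def matrix_ring_simps restrict_PiE_iff two_times_two)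

lemma mat2_one: "\<one>\<^bsub>matrix_ring 2 R\<^esub> = mat2 \<one> \<zero> \<zero> \<one>"
  by (auto simp: mat2_def matrix_ring_simps less_two_iff intro!: restrict_ext)

lemma mat2_zero: "\<zero>\<^bsub>matrix_ring 2 R\<^esub> = mat2 \<zero> \<zero> \<zero> \<zero>"
  by (auto simp: mat2_def matrix_ring_simps less_two_iff intro!: restrict_ext)

lemma mat2_add:
  "mat2 a b c d \<oplus>\<^bsub>matrix_ring 2 R\<^esub> mat2 a' b' c' d' = mat2 (a \<oplus> a') (b \<oplus> b') (c \<oplus> c') (d \<oplus> d')"
  by (auto simp: mat2_def matrix_ring_simps less_two_iff intro!: restrict_ext)

lemma mat2_mult:
  assumes "a \<in> carrier R" "b \<in> carrier R" "c \<in> carrier R" "d \<in> carrier R"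
    "a' \<in> carrier R" "b' \<in> carrier R" "c' \<in> carrier R" "d' \<in> carrier R"
  shows "mat2 a b c d \<otimes>\<^bsub>matrix_ring 2 R\<^esub> mat2 a' b' c' d'
    = mat2 (a \<otimes> a' \<oplus> b \<otimes> c') (a \<otimes> b' \<oplus> b \<otimes> d') (c \<otimes> a' \<oplus> d \<otimes> c') (c \<otimes> b' \<oplus> d \<otimes> d')"
proof -
  have sum: "(\<Oplus>l\<in>{..<2}. f l) = f 0 \<oplus> f 1" if "f 0 \<in> carrier R" "f 1 \<in> carrier R" for f :: "nat \<Rightarrow> 'a"
  proof -
    have "{..<2} = {0, 1 :: nat}" by auto
    then show ?thesis using that by (simp add: finsum_insert)
  qed
  show ?thesis
    unfolding matrix_ring_mult mat2_def[of "_ \<oplus> _"] using assms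
    by (auto intro!: restrict_ext simp: less_two_iff sum) (auto simp: mat2_def sum)
qed

end

lemma (in monoid) nat_pow_small:
  assumes "x \<in> carrier G"
  shows "x [^] (1::nat) = x" "x [^] (2::nat) = x \<otimes> x" "x [^] (3::nat) = x \<otimes> (x \<otimes> x)"
    "x [^] (4::nat) = (x \<otimes> x) \<otimes> (x \<otimes> x)"
  using assms by (simp_all add: numeral_eq_Suc m_assoc)

context char_two_cring
begin

sublocale W: ring "BR" by (rule ring_block_ring)

definition scalar :: "'a \<Rightarrow> 'a block" where
  "scalar c = (((c, \<zero>), (\<zero>, \<zero>)), (mat2 c \<zero> \<zero> c, mat2 \<zero> \<zero> \<zero> \<zero>))"

lemmas block_simps = block_ring_def scalar_def mat2_one mat2_zero mat2_add mat2_mult a_ac two_simps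

lemma scalar_hom: "scalar \<in> ring_hom P BR"
  by (rule ring_hom_memI) (auto simp: block_simps)

lemma mat2_cases:
  assumes "M \<in> carrier MR"
  obtains a b c d where "M = mat2 a b c d" "a \<in> carrier P" "b \<in> carrier P" "c \<in> carrier P" "d \<in> carrier P"
proof (rule that)
  have M: "M \<in> {..<2} \<times> {..<2} \<rightarrow>\<^sub>E carrier P" using assms by (simp add: matrix_ring_simps)
  then show "M = mat2 (M (0, 0)) (M (0, 1)) (M (1, 0)) (M (1, 1))"
    unfolding mat2_def by (intro extensionalityI[of _ "{..<2} \<times> {..<2}"]) (auto simp: PiE_iff less_two_iff)
  show "M (0, 0) \<in> carrier P" "M (0, 1) \<in> carrier P" "M (1, 0) \<in> carrier P" "M (1, 1) \<in> carrier P"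
    using M by (auto simp: PiE_iff)
qed

lemma scalar_central:
  assumes "c \<in> carrier P" and "w \<in> carrier BR"
  shows "w \<star> scalar c = scalar c \<star> w"
proof -
  obtain s M N where w: "w = (s, (M, N))" by (metis surj_pair)
  have M: "M \<in> carrier MR" and N: "N \<in> carrier MR"
    using assms(2) by (auto simp: w)
  show ?thesis
    using assms by (rule_tac mat2_cases[OF M], rule_tac mat2_cases[OF N])
      (auto simp: w block_simps m_comm)
qed

text \<open>Killing x leaves C_4, so x is 1 in the first block. In the second it is \<omega>, a
  matrix over the prime field with characteristic polynomial t^2 + t + 1, hence of order 3.\<close>

definition gen_x :: "'a block" where
  "gen_x = (((\<one>, \<zero>), (\<zero>, \<zero>)), (mat2 \<zero> \<one> \<one> \<one>, mat2 \<zero> \<zero> \<zero> \<zero>))"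

text \<open>The matrix part of \<open>gen_y\<close> is \<open>s (1 + (1 + z) \<omega>) = s \<omega>\<^sup>2 + s \<omega> z\<close>, where \<open>s\<close> swaps the basis
  vectors and \<open>\<omega>\<close> is the matrix of \<open>gen_x\<close>: the element \<open>1 + (1 + z) \<omega>\<close> has norm \<open>z\<close>.\<close>

definition gen_y :: "'a block" where
  "gen_y = (((\<zero>, \<zero>), (\<one>, \<zero>)), (mat2 \<one> \<zero> \<one> \<one>, mat2 \<one> \<one> \<zero> \<one>))"

lemma gen_closed [simp]: "gen_x \<in> carrier BR" "gen_y \<in> carrier BR"
  by (simp_all add: gen_x_def gen_y_def)

lemma gen_x_powers:
  "gen_x [^]\<^bsub>BR\<^esub> (0::nat) = \<one>\<^bsub>BR\<^esub>"
  "gen_x [^]\<^bsub>BR\<^esub> (1::nat) = gen_x"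
  "gen_x [^]\<^bsub>BR\<^esub> (2::nat) = (((\<one>, \<zero>), (\<zero>, \<zero>)), (mat2 \<one> \<one> \<one> \<zero>, mat2 \<zero> \<zero> \<zero> \<zero>))"
  "gen_x [^]\<^bsub>BR\<^esub> (3::nat) = \<one>\<^bsub>BR\<^esub>"
  unfolding W.nat_pow_small[OF gen_closed(1)] by (simp_all add: gen_x_def block_simps)

lemma gen_y_powers:
  "gen_y [^]\<^bsub>BR\<^esub> (0::nat) = \<one>\<^bsub>BR\<^esub>"
  "gen_y [^]\<^bsub>BR\<^esub> (1::nat) = gen_y"
  "gen_y [^]\<^bsub>BR\<^esub> (2::nat) = (((\<zero>, \<one>), (\<zero>, \<zero>)), (mat2 \<zero> \<zero> \<zero> \<zero>, mat2 \<one> \<zero> \<zero> \<one>))"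
  "gen_y [^]\<^bsub>BR\<^esub> (3::nat) = (((\<zero>, \<zero>), (\<zero>, \<one>)), (mat2 \<one> \<one> \<zero> \<one>, mat2 \<one> \<zero> \<one> \<one>))"
  "gen_y [^]\<^bsub>BR\<^esub> (4::nat) = \<one>\<^bsub>BR\<^esub>"
  unfolding W.nat_pow_small[OF gen_closed(2)] by (simp_all add: gen_y_def block_simps)

lemma gen_x_gen_y: "gen_x \<star> gen_y = gen_y \<star> (gen_x \<star> gen_x)"
  by (simp add: gen_x_def gen_y_def block_simps)

text \<open>The six elements of GL(2, 2) span the matrix ring of dimension four, so they satisfy two
  independent relations: the powers of \<omega> sum to zero, and so do the three involutions. Here
  e, f, g are the coefficients of 1, \<omega>, \<omega>^2, and u, v, w those of the involutions, u
  belonging to the swap; the four equations are the matrix entries.\<close>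

lemma matrix_basis_relation:
  assumes "e \<in> carrier P" "f \<in> carrier P" "g \<in> carrier P" "u \<in> carrier P" "v \<in> carrier P" "w \<in> carrier P"
    and "e \<oplus> g \<oplus> v \<oplus> w = \<zero>" "f \<oplus> g \<oplus> u \<oplus> v = \<zero>" "f \<oplus> g \<oplus> u \<oplus> w = \<zero>" "e \<oplus> f \<oplus> v \<oplus> w = \<zero>"
  shows "e = f" "f = g" "u = v" "v = w"
proof -
  note eq = char_two_eq_iff[OF one_add_one]
  have "v = f \<oplus> g \<oplus> u" "w = f \<oplus> g \<oplus> u"
    using assms eq[of v "f \<oplus> g \<oplus> u" \<zero>] eq[of w "f \<oplus> g \<oplus> u" \<zero>] by (simp_all add: a_ac)
  then show vw: "v = w" by simp
  have "e \<oplus> g = \<zero>" "e \<oplus> f = \<zero>" using assms by (simp_all add: vw a_assoc two_simps)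
  then have eg: "e = g" and ef: "e = f" using assms eq[of e g \<zero>] eq[of e f \<zero>] by simp_all
  show "e = f" "f = g" using eg ef by simp_all
  have "u \<oplus> v = \<zero>" using assms eg ef by (simp add: two_simps a_assoc)
  then show "u = v" using assms eq[of u v \<zero>] by simp
qed

lemma three_eq_zero:
  assumes "a \<in> carrier P" "a \<oplus> a \<oplus> a = \<zero>" shows "a = \<zero>"
  using assms by (simp add: two_simps)

text \<open>In the first block x becomes 1, so for each power of y the three coefficients sum to
  zero. In the matrix block, \<open>matrix_basis_relation\<close> makes coefficients, or sums of two
  of them, equal in threes. Three equal elements with sum zero vanish, because 3 = 1 in P.\<close>

lemma gens_independent:
  assumes A: "\<And>r s. r < 3 \<Longrightarrow> s < 4 \<Longrightarrow> A r s \<in> carrier P"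
    and sum: "(\<Oplus>\<^bsub>BR\<^esub>r\<in>{..<3::nat}. \<Oplus>\<^bsub>BR\<^esub>s\<in>{..<4::nat}. scalar (A r s)
        \<star> (gen_x [^]\<^bsub>BR\<^esub> r \<star> gen_y [^]\<^bsub>BR\<^esub> s))
      = \<zero>\<^bsub>BR\<^esub>"
    and rs: "r < 3" "s < 4"
  shows "A r s = \<zero>"
proof -
  let ?f = "\<lambda>r s. scalar (A r s) \<star>
    (gen_x [^]\<^bsub>BR\<^esub> r \<star> gen_y [^]\<^bsub>BR\<^esub> s)"
  have sc: "scalar (A r s) \<in> carrier BR" if "r < 3" "s < 4" for r s
    using A[OF that] ring_hom_closed[OF scalar_hom] by blast
  have f: "?f r s \<in> carrier BR" if "r < 3" "s < 4" for r s
    using sc[OF that] gen_closed W.nat_pow_closed W.m_closed by blast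
  have s3: "(\<Oplus>\<^bsub>BR\<^esub>r\<in>{..<3::nat}. h r) = h 0 \<oplus>\<^bsub>BR\<^esub> h 1 \<oplus>\<^bsub>BR\<^esub> h 2"
    if "\<And>r. r < 3 \<Longrightarrow> h r \<in> carrier BR" for h
  proof -
    have "{..<3} = {0, 1, 2 :: nat}" by auto
    moreover have "h 0 \<in> carrier BR" "h 1 \<in> carrier BR" "h 2 \<in> carrier BR"
      using that by (simp_all del: carrier_block_ring)
    ultimately show ?thesis by (simp add: W.finsum_insert W.a_assoc del: carrier_block_ring)
  qed
  have s4: "(\<Oplus>\<^bsub>BR\<^esub>r\<in>{..<4::nat}. h r)
      = h 0 \<oplus>\<^bsub>BR\<^esub> h 1 \<oplus>\<^bsub>BR\<^esub> h 2 \<oplus>\<^bsub>BR\<^esub> h 3"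
    if "\<And>r. r < 4 \<Longrightarrow> h r \<in> carrier BR" for h
  proof -
    have "{..<4} = {0, 1, 2, 3 :: nat}" by auto
    moreover have "h 0 \<in> carrier BR" "h 1 \<in> carrier BR" "h 2 \<in> carrier BR"
      "h 3 \<in> carrier BR" using that by (simp_all del: carrier_block_ring)
    ultimately show ?thesis by (simp add: W.finsum_insert W.a_assoc del: carrier_block_ring)
  qed
  let ?S = "\<lambda>r. ?f r 0 \<oplus>\<^bsub>BR\<^esub> ?f r 1 \<oplus>\<^bsub>BR\<^esub> ?f r 2 \<oplus>\<^bsub>BR\<^esub> ?f r 3"
  have in4: "(\<Oplus>\<^bsub>BR\<^esub>s\<in>{..<4}. ?f r s) = ?S r" if "r < 3" for r
    by (rule s4) (use f that in blast)
  have in4': "(\<Oplus>\<^bsub>BR\<^esub>s\<in>{..<4}. ?f 0 s) = ?S 0" "(\<Oplus>\<^bsub>BR\<^esub>s\<in>{..<4}. ?f 1 s) = ?S 1"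
    "(\<Oplus>\<^bsub>BR\<^esub>s\<in>{..<4}. ?f 2 s) = ?S 2"
    by (rule in4, simp)+
  have "(\<Oplus>\<^bsub>BR\<^esub>r\<in>{..<3}. \<Oplus>\<^bsub>BR\<^esub>s\<in>{..<4}. ?f r s) =
      (\<Oplus>\<^bsub>BR\<^esub>s\<in>{..<4}. ?f 0 s) \<oplus>\<^bsub>BR\<^esub> (\<Oplus>\<^bsub>BR\<^esub>s\<in>{..<4}. ?f 1 s)
      \<oplus>\<^bsub>BR\<^esub> (\<Oplus>\<^bsub>BR\<^esub>s\<in>{..<4}. ?f 2 s)"
    by (rule s3, rule W.finsum_closed) (use f in blast)
  also have "\<dots> = ?S 0 \<oplus>\<^bsub>BR\<^esub> ?S 1 \<oplus>\<^bsub>BR\<^esub> ?S 2" by (simp only: in4')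
  finally have sum0: "?S 0 \<oplus>\<^bsub>BR\<^esub> ?S 1 \<oplus>\<^bsub>BR\<^esub> ?S 2 = \<zero>\<^bsub>BR\<^esub>" using sum by simp
  \<comment> \<open>The letter records the power of x, the digit the power of y.\<close>
  define a0 b0 c0 where "a0 = A 0 0" "b0 = A 1 0" "c0 = A 2 0"
  define a1 b1 c1 where "a1 = A 0 1" "b1 = A 1 1" "c1 = A 2 1"
  define a2 b2 c2 where "a2 = A 0 2" "b2 = A 1 2" "c2 = A 2 2"
  define a3 b3 c3 where "a3 = A 0 3" "b3 = A 1 3" "c3 = A 2 3"
  note defs = a0_b0_c0_def a1_b1_c1_def a2_b2_c2_def a3_b3_c3_def
  have m: "a0 \<in> carrier P" "a1 \<in> carrier P" "a2 \<in> carrier P" "a3 \<in> carrier P"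
    "b0 \<in> carrier P" "b1 \<in> carrier P" "b2 \<in> carrier P" "b3 \<in> carrier P"
    "c0 \<in> carrier P" "c1 \<in> carrier P" "c2 \<in> carrier P" "c3 \<in> carrier P"
    unfolding defs by (rule A; simp)+
  have "?S 0 = (((a0, a2), (a1, a3)), (mat2 (a0 \<oplus> a1 \<oplus> a3) a3 a1 (a0 \<oplus> a1 \<oplus> a3), mat2 (a2 \<oplus> a1 \<oplus> a3) a1 a3 (a2 \<oplus> a1 \<oplus> a3)))"
    using m unfolding gen_x_powers gen_y_powers defs[symmetric]
    by (simp add: gen_x_def gen_y_def block_simps)
  moreover have "?S 1 = (((b0, b2), (b1, b3)), (mat2 b1 (b0 \<oplus> b1 \<oplus> b3) (b0 \<oplus> b3) (b0 \<oplus> b1), mat2 b3 (b2 \<oplus> b1 \<oplus> b3) (b2 \<oplus> b1) (b2 \<oplus> b3)))"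
    using m unfolding gen_x_powers gen_y_powers defs[symmetric]
    by (simp add: gen_x_def gen_y_def block_simps)
  moreover have "?S 2 = (((c0, c2), (c1, c3)), (mat2 (c0 \<oplus> c3) (c0 \<oplus> c1) (c0 \<oplus> c1 \<oplus> c3) c3, mat2 (c2 \<oplus> c1) (c2 \<oplus> c3) (c2 \<oplus> c1 \<oplus> c3) c1))"
    using m unfolding gen_x_powers gen_y_powers defs[symmetric]
    by (simp add: gen_x_def gen_y_def block_simps)
  \<comment> \<open>\<open>T\<close> comes from the first block, \<open>M0\<close> and
    \<open>M1\<close> from the coefficients of 1 and z in the second. Odd powers of y contribute to
    both, since y = s \<omega>^2 + s \<omega> z; hence the paired sums such as
    \<open>b1 \<oplus> a3\<close>.\<close>
  ultimately have T: "a0 \<oplus> b0 \<oplus> c0 = \<zero>" "a1 \<oplus> b1 \<oplus> c1 = \<zero>" "a2 \<oplus> b2 \<oplus> c2 = \<zero>" "a3 \<oplus> b3 \<oplus> c3 = \<zero>"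
    and M0: "a0 \<oplus> c0 \<oplus> (b1 \<oplus> a3) \<oplus> (a1 \<oplus> c3) = \<zero>" "b0 \<oplus> c0 \<oplus> (c1 \<oplus> b3) \<oplus> (b1 \<oplus> a3) = \<zero>"
      "b0 \<oplus> c0 \<oplus> (c1 \<oplus> b3) \<oplus> (a1 \<oplus> c3) = \<zero>" "a0 \<oplus> b0 \<oplus> (b1 \<oplus> a3) \<oplus> (a1 \<oplus> c3) = \<zero>"
    and M1: "a2 \<oplus> c2 \<oplus> (a1 \<oplus> b3) \<oplus> (c1 \<oplus> a3) = \<zero>" "b2 \<oplus> c2 \<oplus> (b1 \<oplus> c3) \<oplus> (a1 \<oplus> b3) = \<zero>"
      "b2 \<oplus> c2 \<oplus> (b1 \<oplus> c3) \<oplus> (c1 \<oplus> a3) = \<zero>" "a2 \<oplus> b2 \<oplus> (a1 \<oplus> b3) \<oplus> (c1 \<oplus> a3) = \<zero>"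
    using sum0 m by (simp_all add: block_simps)
  have e0: "a0 = b0" "b0 = c0" "c1 \<oplus> b3 = b1 \<oplus> a3" "b1 \<oplus> a3 = a1 \<oplus> c3"
    using matrix_basis_relation[OF _ _ _ _ _ _ M0] m by simp_all
  have e2: "a2 = b2" "b2 = c2" "b1 \<oplus> c3 = a1 \<oplus> b3" "a1 \<oplus> b3 = c1 \<oplus> a3"
    using matrix_basis_relation[OF _ _ _ _ _ _ M1] m by simp_all
  have z0: "a0 = \<zero>" "b0 = \<zero>" "c0 = \<zero>" and z2: "a2 = \<zero>" "b2 = \<zero>" "c2 = \<zero>"
    using three_eq_zero[of c0] three_eq_zero[of c2] T m by (simp_all add: e0(1,2) e2(1,2))
  \<comment> \<open>The six unknowns at odd powers of y are regrouped into three pair sums, in two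
    ways; within each way the sums are equal by \<open>e0\<close> or \<open>e2\<close>, so all of
    them vanish.\<close>
  have tot: "(a1 \<oplus> b1 \<oplus> c1) \<oplus> (a3 \<oplus> b3 \<oplus> c3) = \<zero>" using T by simp
  have "(a1 \<oplus> c3) \<oplus> (b1 \<oplus> a3) \<oplus> (c1 \<oplus> b3) = \<zero>" "(b1 \<oplus> c3) \<oplus> (c1 \<oplus> a3) \<oplus> (a1 \<oplus> b3) = \<zero>"
    using tot m by (simp_all add: a_ac)
  then have "a1 \<oplus> c3 = \<zero>" "c1 \<oplus> a3 = \<zero>"
    using three_eq_zero[of "a1 \<oplus> c3"] three_eq_zero[of "c1 \<oplus> a3"] m by (simp_all only: e0(3,4) e2(3,4) a_closed)
  moreover from this have "b1 \<oplus> a3 = \<zero>" "c1 \<oplus> b3 = \<zero>" "b1 \<oplus> c3 = \<zero>" "a1 \<oplus> b3 = \<zero>"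
    by (simp_all only: e0(3,4) e2(3,4))
  moreover have "x = y" if "x \<oplus> y = \<zero>" "x \<in> carrier P" "y \<in> carrier P" for x y
    using that char_two_eq_iff[OF one_add_one, of x y \<zero>] by simp
  \<comment> \<open>These equalities link all six unknowns into one value, which \<open>T\<close>
    then forces to be zero.\<close>
  ultimately have "a1 = c3" "b1 = a3" "c1 = b3" "b1 = c3" "c1 = a3" "a1 = b3"
    using m by blast+
  then have eqs: "a1 = b1" "b1 = c1" "a3 = a1" "b3 = a1" "c3 = a1" by simp_all
  have z1: "a1 = \<zero>" using three_eq_zero[of a1] T(2) m by (simp add: eqs(1,2)[symmetric])
  have "r = 0 \<or> r = 1 \<or> r = 2" "s = 0 \<or> s = 1 \<or> s = 2 \<or> s = 3" using rs by auto
  then show ?thesis using z0 z1 z2 eqs unfolding defs by (elim disjE) simp_all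
qed

end

section \<open>Arithmetic of roots of unity, Frobenius orbits and finite fields\<close>

section \<open>Ramanujan sums modulo two\<close>

text \<open>For odd \<open>l\<close>, \<open>ramanujan l m\<close> is congruent modulo 2 to the Ramanujan sum \<open>c\<^sub>l(m)\<close>: the sum of
  \<open>c\<^sub>d(m)\<close> over the divisors \<open>d\<close> of \<open>l\<close> is \<open>l\<close> if \<open>l\<close> divides \<open>m\<close>, and \<open>0\<close> otherwise. Signs do
  not matter modulo 2.\<close>

function ramanujan :: "nat \<Rightarrow> nat \<Rightarrow> nat" where
  "ramanujan l m = of_bool (l dvd m) + (\<Sum>d\<in>{d. d dvd l \<and> d < l}. ramanujan d m)"
  by auto
termination by (relation "measure fst") auto

declare ramanujan.simps [simp del]

text \<open>The defining recursion read modulo 2: the sum over the proper divisors occurs twice and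
  cancels.\<close>

lemma sum_ramanujan:
  assumes "n > 0"
  shows "even (\<Sum>d\<in>{d. d dvd n}. ramanujan d m) \<longleftrightarrow> \<not> n dvd m"
proof -
  have "{d. d dvd n} = insert n {d. d dvd n \<and> d < n}" using assms by (auto dest: dvd_imp_le)
  then have "(\<Sum>d\<in>{d. d dvd n}. ramanujan d m) = ramanujan n m + (\<Sum>d\<in>{d. d dvd n \<and> d < n}. ramanujan d m)"
    by simp
  then show ?thesis by (subst (asm) ramanujan.simps) simp
qed

locale char_two_field = field K + char_two_cring K for K :: "('k, 'r) ring_scheme" (structure)
begin

text \<open>The image of an integer in the prime field. It lets one and the same integer act as a
  scalar in fields with different carriers.\<close>

definition parity :: "nat \<Rightarrow> 'k" where "parity m = (if odd m then \<one> else \<zero>)"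

lemma parity_closed [simp]: "parity m \<in> carrier K"
  by (simp add: parity_def)

lemma parity_add: "parity (a + b) = parity a \<oplus> parity b"
  by (simp add: parity_def two_simps)

lemma parity_sum: "finite A \<Longrightarrow> parity (\<Sum>a\<in>A. f a) = (\<Oplus>a\<in>A. parity (f a))"
proof (induction A rule: finite_induct)
  case empty
  then show ?case by (simp add: parity_def)
qed (simp add: parity_add finsum_insert)

lemma finsum_one: "finite A \<Longrightarrow> (\<Oplus>a\<in>A. \<one>) = parity (card A)"
proof -
  assume "finite A"
  then show ?thesis using parity_sum[of A "\<lambda>_. 1"] by (simp add: parity_def)
qed

definition has_order :: "'k \<Rightarrow> nat \<Rightarrow> bool" where
  "has_order \<zeta> l \<longleftrightarrow> \<zeta> \<in> carrier K \<and> (\<forall>m::nat. \<zeta> [^] m = \<one> \<longleftrightarrow> l dvd m)"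

text \<open>Orthogonality of characters. The range runs from 1 to l, as \<open>totatives\<close>
  does, so that it can be split by gcd with l. Oddness of l makes the number of terms equal to 1 in
  K.\<close>

lemma sum_powers_root_of_unity:
  assumes \<zeta>: "has_order \<zeta> l" and "odd l"
  shows "(\<Oplus>k\<in>{0<..l}. \<zeta> [^] (k * m)) = parity (of_bool (l dvd m))"
proof (cases "l dvd m")
  case True
  then have "(\<Oplus>k\<in>{0<..l}. \<zeta> [^] (k * m)) = (\<Oplus>k\<in>{0<..l}. \<one>)"
    using \<zeta> by (intro finsum_cong') (auto simp: has_order_def)
  also have "\<dots> = \<one>" using \<open>odd l\<close> by (simp add: finsum_one parity_def)
  finally show ?thesis using True by (simp add: parity_def)
next
  case False
  define \<eta> where "\<eta> = \<zeta> [^] m"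
  have \<zeta>c: "\<zeta> \<in> carrier K" using \<zeta> by (simp add: has_order_def)
  have \<eta>: "\<eta> \<in> carrier K" "\<eta> \<noteq> \<one>" "\<eta> [^] l = \<one>"
    using \<zeta> False by (auto simp: \<eta>_def has_order_def nat_pow_pow)
  define S where "S = (\<Oplus>k\<in>{0<..l}. \<eta> [^] k)"
  have Sc: "S \<in> carrier K" using \<eta> by (auto simp: S_def intro!: finsum_closed)
  have l: "l > 0" using \<open>odd l\<close> by (cases l) auto
  \<comment> \<open>Multiplication by \<open>\<eta>\<close> permutes the l summands cyclically,
    because its l-th power is 1; so S is fixed by a scalar other than 1.\<close>
  have "\<eta> \<otimes> S = (\<Oplus>k\<in>{0<..l}. \<eta> [^] Suc k)"
    unfolding S_def using \<eta> by (subst finsum_rdistr) (auto simp: m_comm)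
  also have "\<dots> = (\<Oplus>k\<in>Suc ` {0<..l}. \<eta> [^] k)"
    using \<eta> by (subst finsum_reindex) auto
  also have "Suc ` {0<..l} = insert (Suc l) {1<..l}"
  proof -
    have "k \<in> Suc ` {0<..l}" if "k \<in> insert (Suc l) {1<..l}" for k
      using that l by (intro image_eqI[where x = "k - 1"]) auto
    then show ?thesis by auto
  qed
  also have "(\<Oplus>k\<in>insert (Suc l) {1<..l}. \<eta> [^] k) = \<eta> [^] Suc l \<oplus> (\<Oplus>k\<in>{1<..l}. \<eta> [^] k)"
    using \<eta> by (subst finsum_insert) auto
  also have "\<eta> [^] Suc l = \<eta> [^] (1::nat)" using \<eta> by simp
  also have "\<eta> [^] (1::nat) \<oplus> (\<Oplus>k\<in>{1<..l}. \<eta> [^] k) = (\<Oplus>k\<in>insert 1 {1<..l}. \<eta> [^] k)"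
    using \<eta> by (subst finsum_insert) auto
  also have "insert 1 {1<..l} = {0<..l}" using l by auto
  finally have "\<eta> \<otimes> S = S" by (simp add: S_def)
  then have "(\<eta> \<oplus> \<one>) \<otimes> S = \<zero>" using \<eta> Sc by (simp add: l_distr two_simps)
  moreover have "\<eta> \<oplus> \<one> \<noteq> \<zero>"
    using \<eta> char_two_eq_iff[OF one_add_one, of \<eta> \<one> \<zero>] by simp
  ultimately have "S = \<zero>" using \<eta> Sc integral by blast
  moreover have "\<zeta> [^] (k * m) = \<eta> [^] k" for k using \<zeta>c by (simp add: \<eta>_def nat_pow_pow mult.commute)
  ultimately show ?thesis using False by (simp add: S_def parity_def)
qed

lemma has_order_power:
  assumes "has_order \<zeta> l" and "d dvd l" and "l > 0"
  shows "has_order (\<zeta> [^] (l div d)) d"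
proof -
  obtain c where l: "l = d * c" using assms(2) by (elim dvdE)
  then show ?thesis
    using assms by (auto simp: has_order_def nat_pow_pow mult.commute[of d])
qed

text \<open>The exponents from 1 to l are sorted by their gcd with l. Those with gcd l/d are the a
  (l/d) with a a totative of d, and \<open>\<zeta> [^] (l div d)\<close> has order d; the induction
  hypothesis thus evaluates all classes with d < l, and what remains is the recursion of
  \<open>ramanujan\<close>.\<close>

lemma ramanujan_sum:
  assumes "has_order \<zeta> l" and "odd l"
  shows "(\<Oplus>a\<in>totatives l. \<zeta> [^] (a * m)) = parity (ramanujan l m)"
  using assms
proof (induction l arbitrary: \<zeta> rule: less_induct)
  case (less l)
  have \<zeta>: "\<zeta> \<in> carrier K" using less.prems by (simp add: has_order_def)
  have l: "l > 0" using less.prems by (cases l) auto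
  let ?D = "{d. d dvd l \<and> d < l}"
  let ?A = "\<lambda>d. (\<lambda>a. a * (l div d)) ` totatives d"
  have D: "{d. d dvd l} = insert l ?D" using l by (auto dest: dvd_imp_le)
  have div_div: "l div (l div d) = d" if "d dvd l" for d using that l by auto
  have A: "?A d = {k \<in> {0<..l}. gcd k l = l div d}" and inj: "inj_on (\<lambda>a. a * (l div d)) (totatives d)"
    if "d dvd l" for d
  proof -
    have "l div (l div d) = d" using that by (rule div_div)
    moreover have "l div d dvd l" using that by (metis dvd_div_mult_self dvd_triv_left)
    ultimately show "?A d = {k \<in> {0<..l}. gcd k l = l div d}" "inj_on (\<lambda>a. a * (l div d)) (totatives d)"
      using bij_betw_totatives_gcd_eq[of "l div d" l] l by (simp_all add: bij_betw_def)
  qed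
  have "{0<..l} = (\<Union>d\<in>{d. d dvd l}. ?A d)"
  proof (intro equalityI subsetI)
    fix k assume k: "k \<in> {0<..l}"
    have "l div (l div gcd k l) = gcd k l" by (rule div_div[OF gcd_dvd2])
    moreover have dvd: "l div gcd k l dvd l" by (metis dvd_div_mult_self dvd_triv_left gcd_dvd2)
    ultimately have "k \<in> ?A (l div gcd k l)" using k unfolding A[OF dvd] by auto
    moreover note dvd
    ultimately show "k \<in> (\<Union>d\<in>{d. d dvd l}. ?A d)" by blast
  next
    fix k assume "k \<in> (\<Union>d\<in>{d. d dvd l}. ?A d)"
    then obtain d where "d dvd l" "k \<in> ?A d" by blast
    then show "k \<in> {0<..l}" using A by auto
  qed
  then have "(\<Oplus>k\<in>{0<..l}. \<zeta> [^] (k * m)) = (\<Oplus>d\<in>{d. d dvd l}. \<Oplus>k\<in>?A d. \<zeta> [^] (k * m))"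
  proof (simp only:, intro add.finprod_UN_disjoint)
    show "pairwise (\<lambda>i j. disjnt (?A i) (?A j)) {d. d dvd l}"
    proof (rule pairwiseI)
      fix d d' assume d: "d \<in> {d. d dvd l}" "d' \<in> {d. d dvd l}" "d \<noteq> d'"
      then have "l div d \<noteq> l div d'" using l by (metis dvd_div_eq_mult mem_Collect_eq mult.commute mult_cancel_left nat_neq_iff dvd_mult_div_cancel mult_0_right)
      then show "disjnt (?A d) (?A d')" using A d by (auto simp: disjnt_def)
    qed
  qed (use \<zeta> l in auto)
  also have "\<dots> = (\<Oplus>k\<in>?A l. \<zeta> [^] (k * m)) \<oplus> (\<Oplus>d\<in>?D. \<Oplus>k\<in>?A d. \<zeta> [^] (k * m))"
    unfolding D using \<zeta> by (subst finsum_insert) (auto intro!: finsum_closed)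
  also have "?A l = totatives l" using l by simp
  also have "(\<Oplus>d\<in>?D. \<Oplus>k\<in>?A d. \<zeta> [^] (k * m)) = (\<Oplus>d\<in>?D. parity (ramanujan d m))"
  proof (rule finsum_cong')
    fix d assume d: "d \<in> ?D"
    have "(\<Oplus>k\<in>?A d. \<zeta> [^] (k * m)) = (\<Oplus>a\<in>totatives d. \<zeta> [^] (a * (l div d) * m))"
      using \<zeta> d inj by (subst finsum_reindex) auto
    also have "\<dots> = (\<Oplus>a\<in>totatives d. (\<zeta> [^] (l div d)) [^] (a * m))"
      using \<zeta> by (intro finsum_cong') (auto simp: nat_pow_pow mult_ac)
    also have "\<dots> = parity (ramanujan d m)"
      using d less.prems l by (intro less.IH has_order_power) (auto elim: dvdE)
    finally show "(\<Oplus>k\<in>?A d. \<zeta> [^] (k * m)) = parity (ramanujan d m)" .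
  qed auto
  also have "\<dots> = parity (\<Sum>d\<in>?D. ramanujan d m)" by (simp add: parity_sum)
  finally have "parity (of_bool (l dvd m)) = (\<Oplus>k\<in>totatives l. \<zeta> [^] (k * m)) \<oplus> parity (\<Sum>d\<in>?D. ramanujan d m)"
    using sum_powers_root_of_unity[OF less.prems] by simp
  then have "(\<Oplus>k\<in>totatives l. \<zeta> [^] (k * m)) = parity (of_bool (l dvd m)) \<oplus> parity (\<Sum>d\<in>?D. ramanujan d m)"
    using \<zeta> char_two_eq_iff[OF one_add_one] by (metis (no_types, lifting) Pi_I finsum_closed nat_pow_closed parity_closed)
  also have "\<dots> = parity (ramanujan l m)"
    by (subst ramanujan.simps) (simp add: parity_add)
  finally show ?case .
qed

lemma power_frobenius:
  "x \<in> carrier K \<Longrightarrow> y \<in> carrier K \<Longrightarrow> (x \<oplus> y) [^] (2 ^ k :: nat) = x [^] (2 ^ k :: nat) \<oplus> y [^] (2 ^ k :: nat)"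
proof (induction k arbitrary: x y)
  case (Suc k)
  have sq: "z [^] (2 ^ Suc k :: nat) = (z \<otimes> z) [^] (2 ^ k :: nat)" if "z \<in> carrier K" for z
    using that by (simp add: nat_pow_distrib nat_pow_mult mult_2)
  show ?case using Suc by (simp only: sq a_closed square_add m_closed)
qed simp

lemma finsum_frobenius:
  "f \<in> A \<rightarrow> carrier K \<Longrightarrow> (\<Oplus>a\<in>A. f a) [^] (2 ^ k :: nat) = (\<Oplus>a\<in>A. f a [^] (2 ^ k :: nat))"
  by (rule additive_hom_finsum[OF abelian_group_axioms abelian_group_axioms]) (auto simp: power_frobenius)

lemma zero_power_two: "\<zero> [^] (2 ^ k :: nat) = \<zero>"
  by (simp add: nat_pow_zero)

end

text \<open>Summing the vanishing values over all primitive \<open>l\<close>-th roots of unity, twisted by \<open>\<zeta>\<^sup>-\<^sup>j\<close>, gives a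
  relation over the ground field that no longer depends on the choice of \<open>K\<close>.\<close>

lemma ramanujan_relation:
  fixes K (structure)
  assumes F: "char_two_field F" and K: "char_two_field K" and h: "h \<in> ring_hom F K"
    and \<zeta>: "char_two_field.has_order K \<zeta> l" and "odd l"
    and c: "\<And>i. i < n \<Longrightarrow> c i \<in> carrier F"
    and zero: "\<And>a. a \<in> totatives l \<Longrightarrow> (\<Oplus>i\<in>{..<n}. h (c i) \<otimes> \<zeta> [^] (a * i)) = \<zero>"
  shows "(\<Oplus>\<^bsub>F\<^esub>i\<in>{..<n}. c i \<otimes>\<^bsub>F\<^esub> char_two_field.parity F (ramanujan l (i + (n - j)))) = \<zero>\<^bsub>F\<^esub>"
proof -
  interpret F: char_two_field F by fact
  interpret K: char_two_field K by fact
  interpret h: ring_hom_ring F K h by (intro ring_hom_ringI2 F.ring_axioms K.ring_axioms h)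
  have \<zeta>c: "\<zeta> \<in> carrier K" using \<zeta> by (simp add: K.has_order_def)
  have hc: "h (c i) \<in> carrier K" if "i < n" for i using c[OF that] by simp
  have parity: "h (F.parity m) = K.parity m" for m by (simp add: F.parity_def K.parity_def)
  \<comment> \<open>The twist by the power -j is written with exponent \<open>n - j\<close> to stay
    among natural numbers; it is applied for divisors l of n.\<close>
  let ?s = "\<lambda>a. \<Oplus>i\<in>{..<n}. h (c i) \<otimes> \<zeta> [^] (a * i)" and ?z = "\<lambda>a. \<zeta> [^] (a * (n - j))"
  let ?y = "\<lambda>a i. \<zeta> [^] (a * (i + (n - j)))" and ?r = "\<lambda>i. F.parity (ramanujan l (i + (n - j)))"
  have "(\<Oplus>a\<in>totatives l. ?z a \<otimes> ?s a)
      = (\<Oplus>a\<in>totatives l. \<zero>)"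
    using \<zeta>c by (intro K.finsum_cong') (auto simp: zero)
  then have "\<zero> = (\<Oplus>a\<in>totatives l. ?z a \<otimes> ?s a)"
    by simp
  also have "\<dots> = (\<Oplus>a\<in>totatives l. \<Oplus>i\<in>{..<n}. h (c i) \<otimes> ?y a i)"
  proof (rule K.finsum_cong')
    fix a assume "a \<in> totatives l"
    have "?z a \<otimes> ?s a
      = (\<Oplus>i\<in>{..<n}. ?z a \<otimes> (h (c i) \<otimes> \<zeta> [^] (a * i)))"
      using \<zeta>c hc by (intro K.finsum_rdistr) auto
    also have "\<dots> = (\<Oplus>i\<in>{..<n}. h (c i) \<otimes> ?y a i)"
    proof (rule K.finsum_cong')
      fix i assume "i \<in> {..<n}"
      then have "h (c i) \<in> carrier K" using hc by simp
      then show "?z a \<otimes> (h (c i) \<otimes> \<zeta> [^] (a * i))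
          = h (c i) \<otimes> ?y a i"
        using \<zeta>c by (simp add: add_mult_distrib2 K.nat_pow_mult[symmetric] K.m_ac)
    qed (use \<zeta>c hc in auto)
    finally show "?z a \<otimes> ?s a
      = (\<Oplus>i\<in>{..<n}. h (c i) \<otimes> ?y a i)" .
  qed (use \<zeta>c hc in \<open>auto intro!: K.finsum_closed\<close>)
  also have "\<dots> = (\<Oplus>i\<in>{..<n}. \<Oplus>a\<in>totatives l. h (c i) \<otimes> ?y a i)"
    using \<zeta>c hc by (intro K.finsum_swap) auto
  also have "\<dots> = (\<Oplus>i\<in>{..<n}. h (c i \<otimes>\<^bsub>F\<^esub> ?r i))"
  proof (rule K.finsum_cong')
    fix i assume i: "i \<in> {..<n}"
    then have "(\<Oplus>a\<in>totatives l. h (c i) \<otimes> ?y a i)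
        = h (c i) \<otimes> (\<Oplus>a\<in>totatives l. ?y a i)"
      using \<zeta>c hc by (intro K.finsum_rdistr[symmetric]) auto
    then show "(\<Oplus>a\<in>totatives l. h (c i) \<otimes> ?y a i)
        = h (c i \<otimes>\<^bsub>F\<^esub> ?r i)"
      using c i by (simp add: K.ramanujan_sum[OF \<zeta> \<open>odd l\<close>] parity)
  qed (use c in auto)
  also have "\<dots> = h (\<Oplus>\<^bsub>F\<^esub>i\<in>{..<n}. c i \<otimes>\<^bsub>F\<^esub> ?r i)"
    using c by (intro additive_hom_finsum[OF F.abelian_group_axioms K.abelian_group_axioms, symmetric]) auto
  finally have "h (\<Oplus>\<^bsub>F\<^esub>i\<in>{..<n}. c i \<otimes>\<^bsub>F\<^esub> ?r i) = h \<zero>\<^bsub>F\<^esub>" by simp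
  moreover have "inj_on h (carrier F)"
    by (rule non_trivial_field_hom_is_inj[OF h F.field_axioms K.field_axioms])
  ultimately show ?thesis using c by (elim inj_onD) (auto intro!: F.finsum_closed)
qed

text \<open>Adding the relations over all divisors l of n gives c i the weight \<open>\<Sum>\<close>
  over l of \<open>ramanujan l (i + (n - j))\<close>, which is odd exactly when n divides i + (n -
  j), that is, when i = j.\<close>

lemma ramanujan_relations_imp_zero:
  fixes F (structure)
  assumes F: "char_two_field F" and "odd n" and c: "\<And>i. i < n \<Longrightarrow> c i \<in> carrier F" and "j < n"
    and rel: "\<And>l. l dvd n \<Longrightarrow> (\<Oplus>i\<in>{..<n}. c i \<otimes> char_two_field.parity F (ramanujan l (i + (n - j)))) = \<zero>"
  shows "c j = \<zero>"
proof -
  interpret char_two_field F by fact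
  have n: "n > 0" using \<open>j < n\<close> by simp
  have "\<zero> = (\<Oplus>l\<in>{l. l dvd n}. \<Oplus>i\<in>{..<n}. c i \<otimes> parity (ramanujan l (i + (n - j))))"
    by (rule add.finprod_one_eqI[symmetric]) (use rel in auto)
  also have "\<dots> = (\<Oplus>i\<in>{..<n}. \<Oplus>l\<in>{l. l dvd n}. c i \<otimes> parity (ramanujan l (i + (n - j))))"
    using c n by (intro finsum_swap) auto
  also have "\<dots> = (\<Oplus>i\<in>{..<n}. if j = i then c i else \<zero>)"
  proof (rule finsum_cong')
    fix i assume i: "i \<in> {..<n}"
    have "(\<Oplus>l\<in>{l. l dvd n}. c i \<otimes> parity (ramanujan l (i + (n - j))))
        = c i \<otimes> (\<Oplus>l\<in>{l. l dvd n}. parity (ramanujan l (i + (n - j))))"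
      using c i n by (intro finsum_rdistr[symmetric]) auto
    also have "(\<Oplus>l\<in>{l. l dvd n}. parity (ramanujan l (i + (n - j)))) = (if n dvd i + (n - j) then \<one> else \<zero>)"
      using n sum_ramanujan[OF n, of "i + (n - j)"]
      by (subst parity_sum[symmetric]) (auto simp: parity_def)
    also have "n dvd i + (n - j) \<longleftrightarrow> j = i"
    proof
      assume "n dvd i + (n - j)"
      then obtain t where t: "i + (n - j) = n * t" by (elim dvdE)
      \<comment> \<open>The sum lies strictly between 0 and 2n, so the only multiple of n it can be
        is n itself.\<close>
      moreover have "0 < i + (n - j)" "i + (n - j) < n * 2" using i \<open>j < n\<close> by auto
      ultimately have "0 < t" "t < 2" by (auto simp del: mult_2_right intro: ccontr)
      then have "t = 1" by simp
      then show "j = i" using t \<open>j < n\<close> by simp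
    qed (use \<open>j < n\<close> in simp)
    finally show "(\<Oplus>l\<in>{l. l dvd n}. c i \<otimes> parity (ramanujan l (i + (n - j)))) = (if j = i then c i else \<zero>)"
      using c i by auto
  qed (use c in auto)
  also have "\<dots> = c j" using c \<open>j < n\<close> by (intro finsum_singleton) auto
  finally show ?thesis by simp
qed

section \<open>Frobenius orbits\<close>

text \<open>Residues prime to l can be cancelled, so all orbits of multiplication by q on them have
  size \<open>ord l q\<close>. Their number is therefore the exponent e_l of the theorem, and T
  lists one representative of each.\<close>

lemma orbit_representatives:
  fixes l q :: nat
  assumes "l > 1" and cop: "coprime l q"
  shows "\<exists>T. \<forall>a\<in>totatives l. \<exists>j<totient l div ord l q. \<exists>s. [T j * q ^ s = a] (mod l)"
proof -
  define orbit where "orbit a = (\<lambda>s. a * q ^ s mod l) ` {..<ord l q}" for a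
  have ord: "ord l q > 0" using cop by simp
  have mem: "b \<in> orbit a \<longleftrightarrow> b < l \<and> (\<exists>s. [a * q ^ s = b] (mod l))" for a b
  proof
    assume "b < l \<and> (\<exists>s. [a * q ^ s = b] (mod l))"
    then obtain s where s: "b < l" "[a * q ^ s = b] (mod l)" by blast
    have "[q ^ (s mod ord l q) = q ^ s] (mod l)"
      using cop by (subst order_divides_expdiff) (auto simp: cong_def)
    then have "[a * q ^ (s mod ord l q) = b] (mod l)" using s(2) by (metis cong_scalar_left cong_trans)
    then show "b \<in> orbit a"
      unfolding orbit_def using s(1) ord by (intro image_eqI[where x = "s mod ord l q"]) (auto simp: cong_def)
  qed (use \<open>l > 1\<close> in \<open>auto simp: orbit_def cong_def\<close>)
  have tot: "a < l" if "a \<in> totatives l" for a using that \<open>l > 1\<close> by (rule totatives_less)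
  have refl: "a \<in> orbit a" if "a \<in> totatives l" for a
    unfolding mem using tot[OF that] by (auto intro: exI[of _ 0])
  have sub: "orbit a \<subseteq> totatives l" if "a \<in> totatives l" for a
  proof
    fix b assume "b \<in> orbit a"
    then obtain s where b: "b = a * q ^ s mod l" by (auto simp: orbit_def)
    have "coprime (a * q ^ s) l" using that cop by (simp add: totatives_def coprime_commute)
    then have "coprime b l" unfolding b using \<open>l > 1\<close> by (subst coprime_mod_left_iff) auto
    moreover from this have "b \<noteq> 0" using \<open>l > 1\<close> by (cases "b = 0") auto
    ultimately show "b \<in> totatives l" using \<open>l > 1\<close> by (simp add: b totatives_def less_imp_le)
  qed
  have card: "card (orbit a) = ord l q" if a: "a \<in> totatives l" for a
  proof -
    have "inj_on (\<lambda>s. a * q ^ s mod l) {..<ord l q}"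
    proof (rule inj_onI)
      fix s t assume st: "s \<in> {..<ord l q}" "t \<in> {..<ord l q}" "a * q ^ s mod l = a * q ^ t mod l"
      then have "[a * q ^ s = a * q ^ t] (mod l)" by (simp add: cong_def)
      then have "[q ^ s = q ^ t] (mod l)"
        using a by (subst (asm) cong_mult_lcancel_nat) (auto simp: totatives_def)
      then have "[s = t] (mod ord l q)" using cop by (simp add: order_divides_expdiff)
      then show "s = t" using st by (simp add: cong_def)
    qed
    then show ?thesis by (simp add: orbit_def card_image)
  qed
  have eq: "orbit b = orbit a" if a: "a \<in> totatives l" and b: "b \<in> orbit a" for a b
  proof (rule card_subset_eq)
    obtain s where s: "[a * q ^ s = b] (mod l)" using b mem by auto
    show "orbit b \<subseteq> orbit a"
    proof
      fix x assume "x \<in> orbit b"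
      then obtain t where t: "x < l" "[b * q ^ t = x] (mod l)" using mem by auto
      have "[a * q ^ s * q ^ t = b * q ^ t] (mod l)" using s by (rule cong_scalar_right)
      then have "[a * q ^ (s + t) = x] (mod l)" using t(2) by (metis cong_trans mult.assoc power_add)
      then show "x \<in> orbit a" using t(1) mem by blast
    qed
    show "card (orbit b) = card (orbit a)" using card a b sub by (metis subsetD)
  qed (simp add: orbit_def)
  let ?C = "orbit ` totatives l"
  have UC: "\<Union>?C = totatives l" using sub refl by blast
  have "ord l q * card ?C = card (\<Union>?C)"
  proof (rule card_partition)
    show "c \<inter> c' = {}" if cc: "c \<in> ?C" "c' \<in> ?C" "c \<noteq> c'" for c c'
    proof (rule ccontr)
      assume "c \<inter> c' \<noteq> {}"
      then obtain x where "x \<in> c" "x \<in> c'" by blast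
      then show False using cc eq by (metis imageE)
    qed
  qed (use card UC in auto)
  then have "totient l = ord l q * card ?C" unfolding UC totient_def by simp
  then have "card ?C = totient l div ord l q" using ord by simp
  then obtain g where g: "bij_betw g {..<totient l div ord l q} ?C"
    using ex_bij_betw_nat_finite[of ?C] by (auto simp: atLeast0LessThan)
  define T where "T j = (SOME a. a \<in> totatives l \<and> orbit a = g j)" for j
  show ?thesis
  proof (intro exI[of _ T] ballI)
    fix a assume a: "a \<in> totatives l"
    then obtain j where j: "j < totient l div ord l q" "g j = orbit a"
      using g by (metis bij_betw_iff_bijections imageI lessThan_iff)
    have "T j \<in> totatives l \<and> orbit (T j) = g j"
      unfolding T_def by (rule someI[of _ a]) (use a j in auto)
    then have "a \<in> orbit (T j)" using j refl[OF a] by simp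
    then show "\<exists>j<totient l div ord l q. \<exists>s. [T j * q ^ s = a] (mod l)" using j(1) mem by blast
  qed
qed

section \<open>Finite extension fields\<close>

text \<open>Coordinates with respect to a basis are unique, so V is in bijection with the lists of
  length d over E.\<close>

lemma (in ring) card_dimension:
  assumes E: "subfield E R" and "finite E" and "dimension d E V"
  shows "card V = card E ^ d"
proof -
  obtain Us where Us: "set Us \<subseteq> carrier R" "independent E Us" "length Us = d" "Span E Us = V"
    using exists_base[OF E assms(3)] by blast
  let ?L = "{Ks. set Ks \<subseteq> E \<and> length Ks = d}"
  have "V = (\<lambda>Ks. combine Ks Us) ` ?L"
    using Span_eq_combine_set_length_version[OF E Us(1)] Us by auto
  moreover have "inj_on (\<lambda>Ks. combine Ks Us) ?L"
  proof (rule inj_onI)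
    fix Ks Ls assume KL: "Ks \<in> ?L" "Ls \<in> ?L" "combine Ks Us = combine Ls Us"
    then have "combine Ks Us \<in> Span E Us" using calculation Us(4) by blast
    from unique_decomposition[OF E Us(2) this] obtain Ms
      where "\<And>Ns. set Ns \<subseteq> E \<Longrightarrow> length Ns = length Us \<Longrightarrow> combine Ks Us = combine Ns Us \<Longrightarrow> Ns = Ms"
      by metis
    from this[of Ks] this[of Ls] show "Ks = Ls" using KL Us(3) by simp
  qed
  ultimately have "card V = card ?L" by (simp add: card_image)
  then show ?thesis using \<open>finite E\<close> by (simp add: card_lists_length_eq)
qed

lemma (in field) subfield_carrier: "subfield (carrier R) R"
  by (rule subfieldI') (auto intro!: subringI simp: field_Units)

lemma card_extension_field:
  assumes F: "field F" and fin: "finite (carrier F)" and ext: "extension_field_of_degree F d K"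
  shows "card (carrier K) = card (carrier F) ^ d"
proof -
  obtain h where K: "field K" and h: "h \<in> ring_hom F K" and dim: "ring.dimension K d (h ` carrier F) (carrier K)"
    using ext by (auto simp: extension_field_of_degree_def)
  interpret F: field F by fact
  interpret K: field K by fact
  interpret h: ring_hom_ring F K h by (intro ring_hom_ringI2 F.ring_axioms K.ring_axioms h)
  have "inj_on h (carrier F)" and "subfield (h ` carrier F) K"
    using h.img_is_subfield[OF F.subfield_carrier] by simp_all
  then show ?thesis using K.card_dimension[OF _ _ dim] fin by (simp add: card_image)
qed

text \<open>If a generates the multiplicative group, of order l c, then a^c has order l.\<close>

lemma (in char_two_field) exists_has_order:
  assumes fin: "finite (carrier K)" and l: "l dvd card (carrier K) - 1"
  shows "\<exists>\<zeta>. has_order \<zeta> l"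
proof -
  interpret G: group "Multiplicative_Group.mult_of K" by (rule field_mult_group)
  let ?N = "card (carrier K) - 1"
  have ord: "order (Multiplicative_Group.mult_of K) = ?N"
    using order_mult_of[OF fin] by (simp add: order_def)
  obtain a where a: "a \<in> carrier (Multiplicative_Group.mult_of K)"
      "carrier (Multiplicative_Group.mult_of K) = {a [^] i | i::nat. i \<in> UNIV}"
    using finite_field_mult_group_has_gen[OF fin] by auto
  have "generate (Multiplicative_Group.mult_of K) {a} = carrier (Multiplicative_Group.mult_of K)"
    using G.generate_pow_on_finite_carrier[OF _ a(1)] a(2) fin by (simp add: Multiplicative_Group.nat_pow_mult_of)
  then have "G.ord a = ?N"
    using G.generate_pow_card[OF a(1)] ord by (simp add: order_def)
  then have aN: "a [^] m = \<one> \<longleftrightarrow> ?N dvd m" for m :: nat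
    using G.pow_eq_id[OF a(1), of m] by (simp add: Multiplicative_Group.nat_pow_mult_of)
  obtain c where c: "?N = l * c" using l by (elim dvdE)
  \<comment> \<open>Positivity of c is what allows c to be cancelled in l c | c m.\<close>
  have "card {\<zero>, \<one>} \<le> card (carrier K)" using fin by (intro card_mono) auto
  then have "c > 0" using c by (cases c) auto
  then have "has_order (a [^] c) l"
    using a(1) aN c by (auto simp: has_order_def nat_pow_pow mult.commute[of l])
  then show ?thesis by blast
qed

lemma (in field) power_card:
  assumes fin: "finite (carrier R)" and x: "x \<in> carrier R"
  shows "x [^] card (carrier R) = x"
proof (cases "x = \<zero>")
  case True
  have "card (carrier R) > 0" using fin x by (auto simp: card_gt_0_iff)
  then show ?thesis using True by (simp add: nat_pow_zero)
next
  case False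
  interpret G: group "Multiplicative_Group.mult_of R" by (rule field_mult_group)
  have "x [^] (card (carrier R) - 1) = \<one>"
    using G.pow_order_eq_1[of x] False x order_mult_of[OF fin]
    by (simp add: Multiplicative_Group.nat_pow_mult_of order_def)
  moreover have "card (carrier R) > 0" using fin x by (auto simp: card_gt_0_iff)
  then have "card (carrier R) = Suc (card (carrier R) - 1)" by simp
  ultimately show ?thesis using x by (metis l_one nat_pow_Suc)
qed

section \<open>From the group algebra to the block algebra, and the final assembly\<close>

section \<open>The isomorphism with the target algebra\<close>

lemma card_group_algebra:
  assumes "finite (carrier G)"
  shows "card (carrier (group_algebra F G)) = card (carrier F) ^ card (carrier G)"
    and "carrier (group_algebra F G) = carrier G \<rightarrow>\<^sub>E carrier F"
  using assms by (simp_all add: group_algebra_def card_PiE)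

context char_two_cring
begin

lemma block_ring_add_self: "w \<in> carrier BR \<Longrightarrow> w \<oplus>\<^bsub>BR\<^esub> w = \<zero>\<^bsub>BR\<^esub>"
  by (rule W.char_two_simps(1)) (auto simp: block_simps)

lemma card_block_ring: "card (carrier BR) = card (carrier P) ^ 12"
  unfolding carrier_block_ring card_cartesian_product card_matrix_ring
  by (simp add: eval_nat_numeral mult_ac)

text \<open>The first block sees only y and determines s; after cancelling y^s, the powers of x are
  told apart by the matrix block. This also shows that Q12 has exactly twelve elements.\<close>

lemma gen_words_inj:
  assumes "\<one> \<noteq> \<zero>"
  shows "inj_on (\<lambda>(r, s). gen_x [^]\<^bsub>BR\<^esub> r \<star> gen_y [^]\<^bsub>BR\<^esub> s)
    ({..<3::nat} \<times> {..<4::nat})"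
proof (rule inj_onI)
  fix p p' assume p: "p \<in> {..<3::nat} \<times> {..<4::nat}" "p' \<in> {..<3::nat} \<times> {..<4::nat}"
    and eq: "(\<lambda>(r, s). gen_x [^]\<^bsub>BR\<^esub> r \<star> gen_y [^]\<^bsub>BR\<^esub> s) p
      = (\<lambda>(r, s). gen_x [^]\<^bsub>BR\<^esub> r \<star> gen_y [^]\<^bsub>BR\<^esub> s) p'"
  obtain r s r' s' where rs: "p = (r, s)" "p' = (r', s')" by fastforce
  have cases: "r = 0 \<or> r = 1 \<or> r = 2" "s = 0 \<or> s = 1 \<or> s = 2 \<or> s = 3"
    "r' = 0 \<or> r' = 1 \<or> r' = 2" "s' = 0 \<or> s' = 1 \<or> s' = 2 \<or> s' = 3"
    using p by (auto simp: rs)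
  have x: "fst (gen_x [^]\<^bsub>BR\<^esub> i \<star> gen_y [^]\<^bsub>BR\<^esub> j) = fst (gen_y [^]\<^bsub>BR\<^esub> j)"
    if "i = 0 \<or> i = 1 \<or> i = 2" "j = 0 \<or> j = 1 \<or> j = 2 \<or> j = 3" for i j :: nat
    using that by (elim disjE) (simp_all only: gen_x_powers gen_y_powers, simp_all add: gen_x_def gen_y_def block_simps)
  have "fst (gen_y [^]\<^bsub>BR\<^esub> s) = fst (gen_y [^]\<^bsub>BR\<^esub> s')"
    unfolding x[OF cases(1,2), symmetric] x[OF cases(3,4), symmetric]
    using eq by (simp only: rs prod.case)
  then have s: "s = s'"
    using cases(2,4) assms assms[symmetric]
    by (elim disjE) (simp_all only: gen_y_powers, simp_all add: gen_y_def block_simps)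
  have "gen_y [^]\<^bsub>BR\<^esub> s \<star> gen_y [^]\<^bsub>BR\<^esub> (4 - s) = \<one>\<^bsub>BR\<^esub>"
    using p by (subst W.nat_pow_mult[OF gen_closed(2)]) (auto simp: rs gen_y_powers)
  then have "gen_x [^]\<^bsub>BR\<^esub> i \<star> gen_y [^]\<^bsub>BR\<^esub> s \<star> gen_y [^]\<^bsub>BR\<^esub> (4 - s)
      = gen_x [^]\<^bsub>BR\<^esub> i" for i :: nat
    using W.nat_pow_closed[OF gen_closed(1), of i] W.nat_pow_closed[OF gen_closed(2)]
    by (simp only: W.m_assoc W.r_one)
  then have "gen_x [^]\<^bsub>BR\<^esub> r = gen_x [^]\<^bsub>BR\<^esub> r'"
    using eq unfolding rs s prod.case by metis
  then have "r = r'"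
    using cases(1,3) assms assms[symmetric]
    by (elim disjE) (simp_all only: gen_x_powers, simp_all add: gen_x_def block_simps)
  with s show "p = p'" by (simp add: rs)
qed

text \<open>The hypothesis \<open>inj\<close> states that F C_n embeds in P. Collecting a general
  element by its Q12 part turns coefficients over F C_n into coefficients over P, and these are
  recovered by \<open>gens_independent\<close>. Bijectivity then follows since |F|^(12 n) =
  |P|^12.\<close>

lemma units_group_algebra_iso:
  fixes F :: "('f, 'r) ring_scheme"
  assumes F: "char_two_cring F" and h: "h \<in> ring_hom F P" and \<zeta>: "\<zeta> \<in> carrier P" "\<zeta> [^] n = \<one>"
    and n: "n > 0" and nontriv: "\<one> \<noteq> \<zero>" and fin: "finite (carrier P)" and finF: "finite (carrier F)"
    and inj: "\<And>c i. (\<And>i. i < n \<Longrightarrow> c i \<in> carrier F) \<Longrightarrow> (\<Oplus>i\<in>{..<n}. h (c i) \<otimes> \<zeta> [^] i) = \<zero> \<Longrightarrow> i < n \<Longrightarrow> c i = \<zero>\<^bsub>F\<^esub>"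
    and card: "card (carrier P) = card (carrier F) ^ n"
  shows "units_of (group_algebra F (integer_mod_group n \<times>\<times> Q12)) \<cong> units_of BR"
proof -
  interpret F: char_two_cring F by fact
  let ?W = "BR" and ?G = "integer_mod_group n \<times>\<times> Q12"
  let ?E = "\<lambda>(r::nat, s::nat). Q12_x [^]\<^bsub>Q12\<^esub> r \<otimes>\<^bsub>Q12\<^esub> Q12_y [^]\<^bsub>Q12\<^esub> s"
  let ?I = "{..<3::nat} \<times> {..<4::nat}"
  note [simp del] = carrier_block_ring
  have hc: "h x \<in> carrier P" if "x \<in> carrier F" for x using ring_hom_closed[OF h that] .
  have sc: "scalar x \<in> carrier ?W" if "x \<in> carrier P" for x using ring_hom_closed[OF scalar_hom that] .
  obtain \<rho> where \<rho>: "\<rho> \<in> hom Q12 ?W" and \<rho>_word: "\<And>(r::nat) (s::nat). \<rho> (Q12_x [^]\<^bsub>Q12\<^esub> r \<otimes>\<^bsub>Q12\<^esub> Q12_y [^]\<^bsub>Q12\<^esub> s)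
      = gen_x [^]\<^bsub>?W\<^esub> r \<star> gen_y [^]\<^bsub>?W\<^esub> s"
    using W.Q12_hom[OF gen_closed gen_x_powers(4) gen_y_powers(5) gen_x_gen_y] by blast
  have \<rho>c: "\<rho> g \<in> carrier ?W" if "g \<in> carrier Q12" for g using hom_in_carrier[OF \<rho> that] .
  have \<rho>1: "\<rho> \<one>\<^bsub>Q12\<^esub> = \<one>\<^bsub>?W\<^esub>" using \<rho>_word[of 0 0] by simp
  have E_inj: "inj_on ?E ?I"
    using gen_words_inj[OF nontriv] unfolding inj_on_def by (auto simp: \<rho>_word[symmetric])
  have cardQ: "card (carrier Q12) = 12" and finQ: "finite (carrier Q12)"
    unfolding carrier_Q12 using E_inj by (simp_all add: card_image)
  have finG: "finite (carrier ?G)" and cardG: "card (carrier ?G) = 12 * n"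
    using n finQ by (simp_all add: carrier_integer_mod_group card_cartesian_product cardQ)
  interpret G: group ?G by (simp add: DirProd_group group_Q12)
  \<comment> \<open>The generator of C_n acts by the central scalar \<open>\<zeta>\<close>, so it
    commutes with the image of Q12.\<close>
  define \<rho>' where "\<rho>' = (\<lambda>(i, g). scalar (\<zeta> [^] nat i) \<star> \<rho> g)"
  have mod: "\<zeta> [^] (m mod n) = \<zeta> [^] m" for m
  proof -
    have "\<zeta> [^] m = \<zeta> [^] (n * (m div n) + m mod n)" by simp
    also have "\<dots> = (\<zeta> [^] n) [^] (m div n) \<otimes> \<zeta> [^] (m mod n)"
      using \<zeta>(1) by (simp only: nat_pow_mult nat_pow_pow)
    finally show ?thesis using \<zeta> by simp
  qed
  have \<rho>'_hom: "\<rho>' \<in> hom ?G ?W"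
  proof (rule homI)
    fix x assume "x \<in> carrier ?G"
    then show "\<rho>' x \<in> carrier ?W" using \<zeta> \<rho>c sc by (auto simp: \<rho>'_def)
  next
    fix x y assume "x \<in> carrier ?G" "y \<in> carrier ?G"
    then obtain i g j g' where xy: "x = (i, g)" "y = (j, g')" and ij: "0 \<le> i" "0 \<le> j"
      and g: "g \<in> carrier Q12" "g' \<in> carrier Q12"
      using n by (auto simp: carrier_integer_mod_group)
    have "nat ((i + j) mod int n) = (nat i + nat j) mod n"
      using ij by (simp add: nat_mod_distrib nat_add_distrib)
    then have "scalar (\<zeta> [^] nat ((i + j) mod int n)) = scalar (\<zeta> [^] nat i) \<star> scalar (\<zeta> [^] nat j)"
      using \<zeta>(1) by (simp add: mod ring_hom_mult[OF scalar_hom, symmetric] nat_pow_mult)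
    moreover have "\<rho> (g \<otimes>\<^bsub>Q12\<^esub> g') = \<rho> g \<star> \<rho> g'" using hom_mult[OF \<rho> g] .
    moreover have "a \<star> scalar b \<star> (c \<star> d) = (a \<star> c) \<star> (scalar b \<star> d)"
      if "a \<in> carrier ?W" "b \<in> carrier P" "c \<in> carrier ?W" "d \<in> carrier ?W" for a b c d
    proof -
      have "c \<star> (scalar b \<star> d) = scalar b \<star> (c \<star> d)"
        using that sc by (simp add: W.m_assoc[symmetric] scalar_central)
      then show ?thesis using that sc by (simp add: W.m_assoc)
    qed
    ultimately show "\<rho>' (x \<otimes>\<^bsub>?G\<^esub> y) = \<rho>' x \<star> \<rho>' y"
      using \<zeta> sc \<rho>c g by (simp add: xy \<rho>'_def)
  qed
  have \<rho>'_one: "\<rho>' \<one>\<^bsub>?G\<^esub> = \<one>\<^bsub>?W\<^esub>"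
    using ring_hom_one[OF scalar_hom] by (simp add: \<rho>'_def \<rho>1)
  define \<Theta> where "\<Theta> = (\<lambda>a. \<Oplus>\<^bsub>?W\<^esub>x\<in>carrier ?G. (scalar \<circ> h) (a x) \<star> \<rho>' x)"
  have \<Theta>: "\<Theta> \<in> hom (group_algebra F ?G) ?W" "\<Theta> \<one>\<^bsub>group_algebra F ?G\<^esub> = \<one>\<^bsub>?W\<^esub>"
    unfolding \<Theta>_def
    by (rule group_algebra_hom[OF F.ring_axioms G.is_group W.ring_axioms finG
          ring_hom_trans[OF h scalar_hom] _ \<rho>'_hom \<rho>'_one]; simp add: scalar_central hc)+
  have ga: "carrier (group_algebra F ?G) = carrier ?G \<rightarrow>\<^sub>E carrier F"
    by (rule card_group_algebra(2)[OF finG])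
  have kernel: "c x = \<zero>\<^bsub>F\<^esub>" if c: "\<And>x. x \<in> carrier ?G \<Longrightarrow> c x \<in> carrier F" and zero: "\<Theta> c = \<zero>\<^bsub>?W\<^esub>"
    and x: "x \<in> carrier ?G" for c x
  proof -
    \<comment> \<open>\<open>\<psi> g\<close> is the image in P of the F C_n coefficient at
      \<open>g\<close>.\<close>
    define \<psi> where "\<psi> g = (\<Oplus>i\<in>{..<n}. h (c (int i, g)) \<otimes> \<zeta> [^] i)" for g
    have c': "c (int i, g) \<in> carrier F" if "i < n" "g \<in> carrier Q12" for i g
      using c that n by (simp add: carrier_integer_mod_group)
    have \<psi>c: "\<psi> g \<in> carrier P" if "g \<in> carrier Q12" for g
      unfolding \<psi>_def using c' that hc \<zeta> by (auto intro!: finsum_closed)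
    have EQ: "?E p \<in> carrier Q12" if "p \<in> ?I" for p using that carrier_Q12 by blast
    let ?f = "\<lambda>i g. scalar (h (c (int i, g))) \<star> (scalar (\<zeta> [^] i) \<star> \<rho> g)"
    have fc: "?f i g \<in> carrier ?W" if "i < n" "g \<in> carrier Q12" for i g
      using c'[OF that] hc sc \<zeta> \<rho>c that by simp
    have "\<Theta> c = (\<Oplus>\<^bsub>?W\<^esub>x\<in>(\<lambda>(i, g). (int i, g)) ` ({..<n} \<times> carrier Q12). (scalar \<circ> h) (c x) \<star> \<rho>' x)"
    proof -
      have "carrier ?G = (\<lambda>(i, g). (int i, g)) ` ({..<n} \<times> carrier Q12)"
      proof (intro equalityI subsetI)
        fix x assume "x \<in> carrier ?G"
        then have "x = (\<lambda>(i, g). (int i, g)) (nat (fst x), snd x)" "(nat (fst x), snd x) \<in> {..<n} \<times> carrier Q12"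
          using n by (auto simp: carrier_integer_mod_group)
        then show "x \<in> (\<lambda>(i, g). (int i, g)) ` ({..<n} \<times> carrier Q12)" by (rule image_eqI)
      qed (use n in \<open>auto simp: carrier_integer_mod_group\<close>)
      then show ?thesis unfolding \<Theta>_def by simp
    qed
    also have "\<dots> = (\<Oplus>\<^bsub>?W\<^esub>p\<in>{..<n} \<times> carrier Q12. case p of (i, g) \<Rightarrow> ?f i g)"
    proof (subst W.finsum_reindex)
      show "(\<Oplus>\<^bsub>?W\<^esub>p\<in>{..<n} \<times> carrier Q12. (scalar \<circ> h) (c (case p of (i, g) \<Rightarrow> (int i, g)))
          \<star> \<rho>' (case p of (i, g) \<Rightarrow> (int i, g)))
        = (\<Oplus>\<^bsub>?W\<^esub>p\<in>{..<n} \<times> carrier Q12. case p of (i, g) \<Rightarrow> ?f i g)"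
        by (rule W.finsum_cong') (auto simp: \<rho>'_def fc)
    qed (auto simp: \<rho>'_def fc inj_on_def)
    also have "\<dots> = (\<Oplus>\<^bsub>?W\<^esub>i\<in>{..<n}. \<Oplus>\<^bsub>?W\<^esub>g\<in>carrier Q12. ?f i g)"
      using finQ fc by (subst W.finsum_Sigma) auto
    also have "\<dots> = (\<Oplus>\<^bsub>?W\<^esub>g\<in>carrier Q12. \<Oplus>\<^bsub>?W\<^esub>i\<in>{..<n}. ?f i g)"
      using finQ fc by (intro W.finsum_swap) auto
    also have "\<dots> = (\<Oplus>\<^bsub>?W\<^esub>g\<in>carrier Q12. scalar (\<psi> g) \<star> \<rho> g)"
    proof (rule W.finsum_cong')
      fix g assume g: "g \<in> carrier Q12"
      have "(\<Oplus>\<^bsub>?W\<^esub>i\<in>{..<n}. ?f i g) = (\<Oplus>\<^bsub>?W\<^esub>i\<in>{..<n}. scalar (h (c (int i, g)) \<otimes> \<zeta> [^] i) \<star> \<rho> g)"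
      proof (rule W.finsum_cong')
        fix i assume "i \<in> {..<n}"
        then have "h (c (int i, g)) \<in> carrier P" using c' g hc by simp
        then show "?f i g = scalar (h (c (int i, g)) \<otimes> \<zeta> [^] i) \<star> \<rho> g"
          using \<zeta> sc \<rho>c[OF g] by (simp add: ring_hom_mult[OF scalar_hom] W.m_assoc)
      qed (use c' g hc sc \<zeta> \<rho>c in auto)
      also have "\<dots> = (\<Oplus>\<^bsub>?W\<^esub>i\<in>{..<n}. scalar (h (c (int i, g)) \<otimes> \<zeta> [^] i)) \<star> \<rho> g"
        using c' g hc sc \<zeta> \<rho>c by (intro W.finsum_ldistr[symmetric]) auto
      also have "(\<Oplus>\<^bsub>?W\<^esub>i\<in>{..<n}. scalar (h (c (int i, g)) \<otimes> \<zeta> [^] i)) = scalar (\<psi> g)"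
        unfolding \<psi>_def using c' g hc \<zeta>
        by (intro additive_hom_finsum[OF abelian_group_axioms W.abelian_group_axioms, symmetric])
          (auto simp: sc ring_hom_add[OF scalar_hom])
      finally show "(\<Oplus>\<^bsub>?W\<^esub>i\<in>{..<n}. ?f i g) = scalar (\<psi> g) \<star> \<rho> g" .
    qed (use sc \<psi>c \<rho>c in auto)
    also have "\<dots> = (\<Oplus>\<^bsub>?W\<^esub>p\<in>?I. scalar (\<psi> (?E p)) \<star> \<rho> (?E p))"
      unfolding carrier_Q12 using EQ sc \<psi>c \<rho>c by (intro W.finsum_reindex E_inj) auto
    also have "\<dots> = (\<Oplus>\<^bsub>?W\<^esub>r\<in>{..<3::nat}. \<Oplus>\<^bsub>?W\<^esub>s\<in>{..<4::nat}. scalar (\<psi> (?E (r, s))) \<star>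
        (gen_x [^]\<^bsub>?W\<^esub> r \<star> gen_y [^]\<^bsub>?W\<^esub> s))"
      using EQ sc \<psi>c \<rho>c by (subst W.finsum_Sigma) (auto simp: \<rho>_word)
    finally have sum: "(\<Oplus>\<^bsub>?W\<^esub>r\<in>{..<3::nat}. \<Oplus>\<^bsub>?W\<^esub>s\<in>{..<4::nat}. scalar (\<psi> (?E (r, s))) \<star>
        (gen_x [^]\<^bsub>?W\<^esub> r \<star> gen_y [^]\<^bsub>?W\<^esub> s)) = \<zero>\<^bsub>?W\<^esub>" using zero by simp
    obtain i g where ig: "x = (int i, g)" "i < n" "g \<in> carrier Q12"
    proof (rule that)
      show "x = (int (nat (fst x)), snd x)" "nat (fst x) < n" "snd x \<in> carrier Q12"
        using x n by (auto simp: carrier_integer_mod_group)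
    qed
    obtain r s where rs: "r < 3" "s < 4" "g = ?E (r, s)" using ig(3) unfolding carrier_Q12 by auto
    have "\<psi> (?E (r, s)) = \<zero>"
      by (rule gens_independent[OF _ sum rs(1,2)]) (use \<psi>c in auto)
    then have "(\<Oplus>i\<in>{..<n}. h (c (int i, g)) \<otimes> \<zeta> [^] i) = \<zero>" by (simp only: \<psi>_def rs(3))
    then show "c x = \<zero>\<^bsub>F\<^esub>" unfolding ig(1)
      using inj[of "\<lambda>i. c (int i, g)" i] c' ig by simp
  qed
  have "inj_on \<Theta> (carrier (group_algebra F ?G))"
  proof (rule inj_onI)
    fix a b assume ab: "a \<in> carrier (group_algebra F ?G)" "b \<in> carrier (group_algebra F ?G)" "\<Theta> a = \<Theta> b"
    have ac: "a x \<in> carrier F" and bc: "b x \<in> carrier F" if "x \<in> carrier ?G" for x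
      using ab(1,2) that unfolding ga by (auto simp del: carrier_DirProd)
    have \<rho>'c: "\<rho>' x \<in> carrier ?W" if "x \<in> carrier ?G" for x using hom_in_carrier[OF \<rho>'_hom that] .
    \<comment> \<open>In characteristic two the pointwise sum is also the difference, so it suffices
      that \<open>\<Theta>\<close> kills the sum of a and b.\<close>
    have "\<Theta> (\<lambda>x. a x \<oplus>\<^bsub>F\<^esub> b x) = (\<Oplus>\<^bsub>?W\<^esub>x\<in>carrier ?G. (scalar \<circ> h) (a x) \<star> \<rho>' x \<oplus>\<^bsub>?W\<^esub> (scalar \<circ> h) (b x) \<star> \<rho>' x)"
      unfolding \<Theta>_def
    proof (rule W.finsum_cong')
      fix x assume x: "x \<in> carrier ?G"
      show "(scalar \<circ> h) (a x \<oplus>\<^bsub>F\<^esub> b x) \<star> \<rho>' x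
          = (scalar \<circ> h) (a x) \<star> \<rho>' x \<oplus>\<^bsub>?W\<^esub> (scalar \<circ> h) (b x) \<star> \<rho>' x"
        using ac[OF x] bc[OF x] \<rho>'c[OF x] hc sc
        by (simp add: ring_hom_add[OF h] ring_hom_add[OF scalar_hom] W.l_distr)
    qed (use ac bc \<rho>'c hc sc in \<open>auto simp del: carrier_DirProd\<close>)
    also have "\<dots> = \<Theta> a \<oplus>\<^bsub>?W\<^esub> \<Theta> b"
      unfolding \<Theta>_def using ac bc \<rho>'c hc sc by (intro W.finsum_addf) (auto simp del: carrier_DirProd)
    also have "\<dots> = \<zero>\<^bsub>?W\<^esub>"
      using ab(3) block_ring_add_self[OF hom_in_carrier[OF \<Theta>(1) ab(2)]] by simp
    finally have "a x \<oplus>\<^bsub>F\<^esub> b x = \<zero>\<^bsub>F\<^esub>" if "x \<in> carrier ?G" for x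
      using kernel[of "\<lambda>x. a x \<oplus>\<^bsub>F\<^esub> b x" x] ac bc that by (auto simp del: carrier_DirProd)
    then have "a x = b x" if "x \<in> carrier ?G" for x
      using ac[OF that] bc[OF that] F.char_two_eq_iff[OF F.one_add_one, of "a x" "b x" "\<zero>\<^bsub>F\<^esub>"] that by simp
    then show "a = b" using ab(1,2) unfolding ga by (intro PiE_ext) auto
  qed
  moreover have "\<Theta> ` carrier (group_algebra F ?G) = carrier ?W"
  proof (rule card_subset_eq)
    have "card (carrier ?W) = card (carrier (group_algebra F ?G))"
      unfolding card_block_ring card_group_algebra(1)[OF finG] cardG card
      by (simp add: power_mult[symmetric] mult.commute)
    then show "card (\<Theta> ` carrier (group_algebra F ?G)) = card (carrier ?W)"
      using calculation by (simp add: card_image)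
    show "finite (carrier ?W)" using fin by (auto simp: carrier_block_ring matrix_ring_simps intro!: finite_PiE)
    show "\<Theta> ` carrier (group_algebra F ?G) \<subseteq> carrier ?W" by (rule hom_carrier[OF \<Theta>(1)])
  qed
  ultimately have "\<Theta> \<in> iso (group_algebra F ?G) ?W"
    using \<Theta>(1) by (simp add: iso_def bij_betw_def)
  then have "\<Theta> \<in> iso (units_of (group_algebra F ?G)) (units_of ?W)"
  proof (rule units_of_iso)
    show "\<Theta> \<one>\<^bsub>group_algebra F ?G\<^esub> = \<one>\<^bsub>?W\<^esub>" by (rule \<Theta>(2))
    show "\<one>\<^bsub>group_algebra F ?G\<^esub> \<in> carrier (group_algebra F ?G)"
      unfolding ga by (auto simp: group_algebra_def)
    show "a \<otimes>\<^bsub>group_algebra F ?G\<^esub> b \<in> carrier (group_algebra F ?G)"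
      if "a \<in> carrier (group_algebra F ?G)" "b \<in> carrier (group_algebra F ?G)" for a b
    proof -
      have ac: "a x \<in> carrier F" and bc: "b x \<in> carrier F" if "x \<in> carrier ?G" for x
        using \<open>a \<in> _\<close> \<open>b \<in> _\<close> that unfolding ga by (auto simp del: carrier_DirProd)
      have "a u \<otimes>\<^bsub>F\<^esub> b (inv\<^bsub>?G\<^esub> u \<otimes>\<^bsub>?G\<^esub> x) \<in> carrier F" if "u \<in> carrier ?G" "x \<in> carrier ?G" for u x
        using that by (intro F.m_closed ac bc G.m_closed G.inv_closed)
      then show ?thesis
        unfolding ga by (auto simp: group_algebra_def intro!: F.finsum_closed simp del: carrier_DirProd)
    qed
  qed
  then show ?thesis by (auto simp: is_iso_def)
qed

end

section \<open>The decomposition of the coefficient ring\<close>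

lemma nat_pow_product_ring:
  "i \<in> I \<Longrightarrow> (x [^]\<^bsub>product_ring I R\<^esub> (m::nat)) i = x i [^]\<^bsub>R i\<^esub> m"
  by (induction m) simp_all

lemma nat_pow_RDirProd:
  "x [^]\<^bsub>RDirProd R S\<^esub> (m::nat) = (fst x [^]\<^bsub>R\<^esub> m, snd x [^]\<^bsub>S\<^esub> m)"
  by (induction m) (simp_all add: RDirProd_def DirProd_def monoid.defs case_prod_beta)

lemma group_units_GL: "ring R \<Longrightarrow> group (units_of R \<times>\<times> GL m R)"
  by (intro DirProd_group group_GL monoid.units_group ring.is_monoid)

lemma char_two_fieldI:
  assumes "char_two_cring F" and "field K" and h: "h \<in> ring_hom F K"
  shows "char_two_field K"
proof -
  interpret F: char_two_cring F by fact
  interpret K: field K by fact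
  interpret h: ring_hom_ring F K h by (intro ring_hom_ringI2 F.ring_axioms K.ring_axioms h)
  have "\<one>\<^bsub>K\<^esub> \<oplus>\<^bsub>K\<^esub> \<one>\<^bsub>K\<^esub> = h (\<one>\<^bsub>F\<^esub> \<oplus>\<^bsub>F\<^esub> \<one>\<^bsub>F\<^esub>)" by simp
  then have "\<one>\<^bsub>K\<^esub> \<oplus>\<^bsub>K\<^esub> \<one>\<^bsub>K\<^esub> = \<zero>\<^bsub>K\<^esub>" by (simp only: F.one_add_one h.hom_zero)
  then show ?thesis by unfold_locales
qed

lemma (in field) ring_char_two:
  assumes "ring_char R = 2" shows "\<one> \<oplus> \<one> = \<zero>"
proof -
  have ex: "\<exists>m::nat. m > 0 \<and> add_pow R m \<one> = \<zero>" using assms unfolding ring_char_def by (auto split: if_splits)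
  then have "ring_char R = (LEAST m::nat. m > 0 \<and> add_pow R m \<one> = \<zero>)" by (simp add: ring_char_def)
  then have "add_pow R (2::nat) \<one> = \<zero>" using LeastI_ex[OF ex] assms by simp
  then show ?thesis by (simp add: numeral_2_eq_2 add.nat_pow_Suc)
qed

text \<open>The coefficient ring is \<open>F\<close> times copies of the fields \<open>K l\<close>; the element \<open>\<zeta>\<close> has one
  representative of each Frobenius orbit of primitive \<open>l\<close>-th roots of unity as its components.\<close>

locale root_family = F: char_two_field F for F :: "('a, 'm) ring_scheme" (structure) +
  fixes n k :: nat and K :: "nat \<Rightarrow> ('k, 'r) ring_scheme"
    and h :: "nat \<Rightarrow> 'a \<Rightarrow> 'k" and \<zeta> :: "nat \<Rightarrow> 'k" and T :: "nat \<Rightarrow> nat \<Rightarrow> nat"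
    and L :: "nat set" and d e :: "nat \<Rightarrow> nat"
  assumes L_def: "L = {l. l > 1 \<and> l dvd n}"
    and d_def: "\<And>l. d l = ord l (2 ^ k)" and e_def: "\<And>l. e l = totient l div d l"
    and fin: "finite (carrier F)" and card_F: "card (carrier F) = 2 ^ k" and odd_n: "odd n"
    and K: "\<And>l. l \<in> L \<Longrightarrow> field (K l)" and h: "\<And>l. l \<in> L \<Longrightarrow> h l \<in> ring_hom F (K l)"
    and card_K: "\<And>l. l \<in> L \<Longrightarrow> card (carrier (K l)) = (2 ^ k) ^ d l"
    and \<zeta>: "\<And>l. l \<in> L \<Longrightarrow> char_two_field.has_order (K l) (\<zeta> l) l"
    and T: "\<And>l a. l \<in> L \<Longrightarrow> a \<in> totatives l \<Longrightarrow> \<exists>j<e l. \<exists>s. [T l j * (2 ^ k) ^ s = a] (mod l)"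
begin

definition Q :: "(nat \<Rightarrow> nat \<Rightarrow> 'k) ring" where
  "Q = product_ring L (\<lambda>l. product_ring {..<e l} (\<lambda>_. K l))"

definition P :: "('a \<times> (nat \<Rightarrow> nat \<Rightarrow> 'k)) ring" where
  "P = RDirProd F Q"

definition hP :: "'a \<Rightarrow> 'a \<times> (nat \<Rightarrow> nat \<Rightarrow> 'k)" where
  "hP c = (c, \<lambda>l\<in>L. \<lambda>j\<in>{..<e l}. h l c)"

definition \<zeta>P :: "'a \<times> (nat \<Rightarrow> nat \<Rightarrow> 'k)" where
  "\<zeta>P = (\<one>, \<lambda>l\<in>L. \<lambda>j\<in>{..<e l}. \<zeta> l [^]\<^bsub>K l\<^esub> T l j)"

lemma n_pos: "n > 0"
  using odd_n by (cases n) auto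

lemma finite_L: "finite L"
  using n_pos by (auto simp: L_def intro: finite_subset[of _ "{..n}"] dest: dvd_imp_le)

lemma L_odd: "l \<in> L \<Longrightarrow> odd l"
  using odd_n by (auto simp: L_def elim: dvdE)

lemma K_char_two: "l \<in> L \<Longrightarrow> char_two_field (K l)"
  using char_two_fieldI[OF F.char_two_cring_axioms K h] .

lemma cring_Q: "cring Q"
  unfolding Q_def using K by (intro cring_product_ring) (auto dest: fieldE(1))

lemma char_two_cring_P: "char_two_cring P"
proof -
  interpret cring P unfolding P_def by (intro cring_RDirProd F.is_cring cring_Q)
  have "\<one>\<^bsub>K l\<^esub> \<oplus>\<^bsub>K l\<^esub> \<one>\<^bsub>K l\<^esub> = \<zero>\<^bsub>K l\<^esub>" if "l \<in> L" for l
  proof -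
    interpret Kl: char_two_field "K l" using that by (rule K_char_two)
    show ?thesis by (rule Kl.one_add_one)
  qed
  then have "\<one>\<^bsub>P\<^esub> \<oplus>\<^bsub>P\<^esub> \<one>\<^bsub>P\<^esub> = \<zero>\<^bsub>P\<^esub>"
    by (auto simp: P_def Q_def F.one_add_one intro!: restrict_ext)
  then show ?thesis by unfold_locales
qed

sublocale P: char_two_cring P by (rule char_two_cring_P)

lemma finite_K: "l \<in> L \<Longrightarrow> finite (carrier (K l))"
  by (rule card_ge_0_finite) (simp add: card_K)

lemma finite_P: "finite (carrier P)"
  unfolding P_def Q_def using fin finite_L finite_K by (auto intro!: finite_PiE)

text \<open>Since d_l e_l = \<phi>(l), the exponents of q add up to the sum of \<phi>(l) over the
  divisors of n, which is n; the divisor 1 is the factor F.\<close>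

lemma card_P: "card (carrier P) = 2 ^ (n * k)"
proof -
  have de: "d l * e l = totient l" if "l \<in> L" for l
  proof -
    have "coprime l (2 ^ k)" using L_odd[OF that] by (simp add: coprime_commute)
    then show ?thesis unfolding d_def e_def by (simp add: order_divides_totient)
  qed
  have div: "{l. l dvd n} = insert 1 L" "1 \<notin> L" using n_pos by (auto simp: L_def intro: Suc_lessI)
  have "card (carrier P) = 2 ^ k * (\<Prod>l\<in>L. ((2 ^ k) ^ d l) ^ e l)"
    using finite_L by (simp add: P_def Q_def card_F card_cartesian_product card_PiE card_K cong: prod.cong)
  also have "\<dots> = (2 ^ k) ^ (1 + (\<Sum>l\<in>L. totient l))"
    by (simp add: power_mult[symmetric] de power_sum mult.assoc cong: prod.cong)
  also have "1 + (\<Sum>l\<in>L. totient l) = (\<Sum>l\<in>{l. l dvd n}. totient l)"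
    unfolding div(1) using finite_L div(2) by simp
  also have "\<dots> = n" by (rule totient_divisor_sum)
  finally show ?thesis by (simp add: power_mult[symmetric] mult.commute)
qed

lemma hP_hom: "hP \<in> ring_hom F P"
  by (rule ring_hom_memI)
    (auto simp: hP_def P_def Q_def ring_hom_closed[OF h] ring_hom_mult[OF h] ring_hom_add[OF h]
      ring_hom_one[OF h] intro!: restrict_ext)

lemma \<zeta>_props:
  assumes "l \<in> L"
  shows "\<zeta> l \<in> carrier (K l)" and "\<zeta> l [^]\<^bsub>K l\<^esub> (m::nat) = \<one>\<^bsub>K l\<^esub> \<longleftrightarrow> l dvd m"
  using \<zeta>[OF assms] char_two_field.has_order_def[OF K_char_two[OF assms]] by auto

lemma \<zeta>P_closed: "\<zeta>P \<in> carrier P"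
proof -
  have "\<zeta> l [^]\<^bsub>K l\<^esub> T l j \<in> carrier (K l)" if "l \<in> L" for l j
  proof -
    interpret Kl: char_two_field "K l" using that by (rule K_char_two)
    show ?thesis using \<zeta>_props(1)[OF that] by simp
  qed
  then show ?thesis by (auto simp: \<zeta>P_def P_def Q_def)
qed

lemma snd_\<zeta>P_power:
  assumes "l \<in> L" "j < e l"
  shows "snd (\<zeta>P [^]\<^bsub>P\<^esub> (m::nat)) l j = \<zeta> l [^]\<^bsub>K l\<^esub> (T l j * m)"
proof -
  interpret Kl: char_two_field "K l" using assms(1) by (rule K_char_two)
  show ?thesis
    using assms \<zeta>_props(1)[OF assms(1)]
    by (simp add: P_def Q_def nat_pow_RDirProd nat_pow_product_ring \<zeta>P_def Kl.nat_pow_pow)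
qed

lemma \<zeta>P_power: "\<zeta>P [^]\<^bsub>P\<^esub> n = \<one>\<^bsub>P\<^esub>"
proof (rule prod_eqI)
  show "fst (\<zeta>P [^]\<^bsub>P\<^esub> n) = fst \<one>\<^bsub>P\<^esub>"
    by (simp add: P_def nat_pow_RDirProd \<zeta>P_def)
  have mem: "snd (\<zeta>P [^]\<^bsub>P\<^esub> n) \<in> carrier Q" "snd \<one>\<^bsub>P\<^esub> \<in> carrier Q"
    using P.nat_pow_closed[OF \<zeta>P_closed, of n] P.one_closed by (auto simp: P_def)
  show "snd (\<zeta>P [^]\<^bsub>P\<^esub> n) = snd \<one>\<^bsub>P\<^esub>"
  proof (rule PiE_ext)
    fix l assume l: "l \<in> L"
    have "snd (\<zeta>P [^]\<^bsub>P\<^esub> n) l \<in> {..<e l} \<rightarrow>\<^sub>E carrier (K l)" "snd \<one>\<^bsub>P\<^esub> l \<in> {..<e l} \<rightarrow>\<^sub>E carrier (K l)"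
      using mem l by (auto simp: Q_def)
    then show "snd (\<zeta>P [^]\<^bsub>P\<^esub> n) l = snd \<one>\<^bsub>P\<^esub> l"
    proof (rule PiE_ext)
      fix j assume j: "j \<in> {..<e l}"
      have "l dvd T l j * n" using l by (simp add: L_def)
      then show "snd (\<zeta>P [^]\<^bsub>P\<^esub> n) l j = snd \<one>\<^bsub>P\<^esub> l j"
        using l j by (subst snd_\<zeta>P_power) (auto simp: \<zeta>_props(2) P_def Q_def)
    qed
  qed (use mem in \<open>simp_all add: Q_def\<close>)
qed

text \<open>This makes squaring injective on P, which fixes the number of squares in the
  augmentation kernel.\<close>

lemma P_reduced:
  assumes "x \<in> carrier P" and "x \<otimes>\<^bsub>P\<^esub> x = \<zero>\<^bsub>P\<^esub>"
  shows "x = \<zero>\<^bsub>P\<^esub>"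
proof -
  obtain a b where x: "x = (a, b)" "a \<in> carrier F" "b \<in> carrier Q"
    using assms(1) by (auto simp: P_def)
  have "a \<otimes> a = \<zero>" using assms(2) by (simp add: x(1) P_def)
  then have "a = \<zero>" using x(2) F.integral by blast
  have bQ: "b \<otimes>\<^bsub>Q\<^esub> b = \<zero>\<^bsub>Q\<^esub>" using assms(2) by (simp add: x(1) P_def)
  have "b = \<zero>\<^bsub>Q\<^esub>"
  proof (rule PiE_ext)
    fix l assume l: "l \<in> L"
    interpret Kl: char_two_field "K l" using l by (rule K_char_two)
    show "b l = \<zero>\<^bsub>Q\<^esub> l"
    proof (rule PiE_ext)
      fix j assume j: "j \<in> {..<e l}"
      have "(b \<otimes>\<^bsub>Q\<^esub> b) l j = \<zero>\<^bsub>K l\<^esub>" unfolding bQ using l j by (simp add: Q_def)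
      then have "b l j \<otimes>\<^bsub>K l\<^esub> b l j = \<zero>\<^bsub>K l\<^esub>" using l j by (simp add: Q_def)
      moreover have "b l j \<in> carrier (K l)" using x(3) l j by (auto simp: Q_def)
      ultimately show "b l j = \<zero>\<^bsub>Q\<^esub> l j" using Kl.integral l j by (auto simp: Q_def)
    next
      show "b l \<in> {..<e l} \<rightarrow>\<^sub>E carrier (K l)" using x(3) l by (auto simp: Q_def)
      show "\<zero>\<^bsub>Q\<^esub> l \<in> {..<e l} \<rightarrow>\<^sub>E carrier (K l)" using l by (simp add: Q_def)
    qed
  qed (use x(3) cring.cring_simprules(2)[OF cring_Q] in \<open>simp_all add: Q_def\<close>)
  then show ?thesis using \<open>a = \<zero>\<close> by (simp add: x(1) P_def)
qed

text \<open>A polynomial over F of degree below n that vanishes at one root of unity from each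
  Frobenius orbit vanishes at all n-th roots of unity, because powers of q fix its coefficients.
  Each divisor l then yields a Ramanujan relation in F, and together these determine the
  coefficients.\<close>

lemma evaluation_zero:
  assumes c: "\<And>i. i < n \<Longrightarrow> c i \<in> carrier F"
    and zero: "(\<Oplus>\<^bsub>P\<^esub>i\<in>{..<n}. hP (c i) \<otimes>\<^bsub>P\<^esub> \<zeta>P [^]\<^bsub>P\<^esub> i) = \<zero>\<^bsub>P\<^esub>" and "j < n"
  shows "c j = \<zero>"
proof (rule ramanujan_relations_imp_zero[OF F.char_two_field_axioms odd_n c \<open>j < n\<close>])
  have mem: "hP (c i) \<otimes>\<^bsub>P\<^esub> \<zeta>P [^]\<^bsub>P\<^esub> i \<in> carrier P" if "i < n" for i
    using ring_hom_closed[OF hP_hom c[OF that]] \<zeta>P_closed by simp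
  have component: "snd x l t \<in> carrier (K l)" if "x \<in> carrier P" "l \<in> L" "t < e l" for x l t
  proof -
    have "snd x \<in> (\<Pi>\<^sub>E l\<in>L. {..<e l} \<rightarrow>\<^sub>E carrier (K l))" using that(1) by (cases x) (simp add: P_def Q_def)
    then have "snd x l \<in> {..<e l} \<rightarrow>\<^sub>E carrier (K l)" using that(2) by (rule PiE_mem)
    then show ?thesis using that(3) by (rule PiE_mem[OF _ lessThan_iff[THEN iffD2]])
  qed
  fix l assume "l dvd n"
  show "(\<Oplus>i\<in>{..<n}. c i \<otimes> F.parity (ramanujan l (i + (n - j)))) = \<zero>"
  proof (cases "l = 1")
    \<comment> \<open>The trivial character is the component F of P, with root of unity 1; it says
      that the coefficients sum to zero.\<close>
    case True
    have "(\<Oplus>i\<in>{..<n}. fst (hP (c i) \<otimes>\<^bsub>P\<^esub> \<zeta>P [^]\<^bsub>P\<^esub> i)) = fst \<zero>\<^bsub>P\<^esub>"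
      unfolding zero[symmetric] using mem
      by (intro additive_hom_finsum[OF P.abelian_group_axioms F.abelian_group_axioms, symmetric])
        (auto simp: P_def)
    moreover have "(\<Oplus>i\<in>{..<n}. fst (hP (c i) \<otimes>\<^bsub>P\<^esub> \<zeta>P [^]\<^bsub>P\<^esub> i)) = (\<Oplus>i\<in>{..<n}. c i)"
      using c by (intro F.finsum_cong') (auto simp: P_def nat_pow_RDirProd hP_def \<zeta>P_def)
    ultimately have sum: "(\<Oplus>i\<in>{..<n}. c i) = \<zero>" by (simp add: P_def)
    show ?thesis
    proof (rule ramanujan_relation[OF F.char_two_field_axioms F.char_two_field_axioms, of id \<one>])
      show "F.has_order \<one> l" by (simp add: F.has_order_def True)
      show "(\<Oplus>i\<in>{..<n}. id (c i) \<otimes> \<one> [^] (a * i)) = \<zero>" for a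
      proof -
        have "(\<Oplus>i\<in>{..<n}. id (c i) \<otimes> \<one> [^] (a * i)) = (\<Oplus>i\<in>{..<n}. c i)"
          using c by (intro F.finsum_cong') auto
        then show ?thesis using sum by simp
      qed
    qed (use c True in \<open>auto simp: ring_hom_def\<close>)
  next
    case False
    then have l: "l \<in> L" using \<open>l dvd n\<close> n_pos by (cases "l = 0") (auto simp: L_def)
    let ?z = "\<lambda>m::nat. \<zeta> l [^]\<^bsub>K l\<^esub> m"
    let ?s = "\<lambda>a. \<Oplus>\<^bsub>K l\<^esub>i\<in>{..<n}. h l (c i) \<otimes>\<^bsub>K l\<^esub> ?z (a * i)"
    interpret Kl: char_two_field "K l" using l by (rule K_char_two)
    have \<zeta>l: "\<zeta> l \<in> carrier (K l)" by (rule \<zeta>_props(1)[OF l])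
    have hc: "h l (c i) \<in> carrier (K l)" if "i < n" for i using ring_hom_closed[OF h[OF l] c[OF that]] .
    have rep: "?s (T l t) = \<zero>\<^bsub>K l\<^esub>" if t: "t < e l" for t
    proof -
      have "(\<Oplus>\<^bsub>K l\<^esub>i\<in>{..<n}. snd (hP (c i) \<otimes>\<^bsub>P\<^esub> \<zeta>P [^]\<^bsub>P\<^esub> i) l t) = snd \<zero>\<^bsub>P\<^esub> l t"
        unfolding zero[symmetric]
      proof (rule additive_hom_finsum[OF P.abelian_group_axioms Kl.abelian_group_axioms, symmetric,
            where h = "\<lambda>x. snd x l t"])
        show "snd (x \<oplus>\<^bsub>P\<^esub> y) l t = snd x l t \<oplus>\<^bsub>K l\<^esub> snd y l t" for x y
          using l t by (cases x; cases y) (simp add: P_def Q_def)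
      qed (use mem l t component in auto)
      moreover have "snd (hP (c i) \<otimes>\<^bsub>P\<^esub> \<zeta>P [^]\<^bsub>P\<^esub> i) l t = h l (c i) \<otimes>\<^bsub>K l\<^esub> ?z (T l t * i)" for i
      proof -
        have "snd (x \<otimes>\<^bsub>P\<^esub> y) l t = snd x l t \<otimes>\<^bsub>K l\<^esub> snd y l t" for x y
          using l t by (cases x; cases y) (simp add: P_def Q_def)
        then show ?thesis using l t by (simp add: snd_\<zeta>P_power) (simp add: hP_def)
      qed
      ultimately show ?thesis using l t by (simp add: P_def Q_def)
    qed
    show ?thesis
    proof (rule ramanujan_relation[OF F.char_two_field_axioms Kl.char_two_field_axioms h[OF l] \<zeta>[OF l]
          L_odd[OF l] c])
      fix a assume "a \<in> totatives l"
      then obtain t s where t: "t < e l" and s: "[T l t * (2 ^ k) ^ s = a] (mod l)" using T[OF l] by blast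
      \<comment> \<open>Raising to the power q^s fixes F and carries the representative with
        exponent \<open>T l t\<close> to the root with exponent \<open>a\<close>.\<close>
      have pow: "x [^] ((2::nat) ^ (k * s)) = x" if "x \<in> carrier F" for x
      proof (induction s)
        case (Suc s)
        have "x [^] ((2::nat) ^ (k * Suc s)) = (x [^] ((2::nat) ^ (k * s))) [^] ((2::nat) ^ k)"
          using that by (simp add: F.nat_pow_pow power_add mult.commute)
        then show ?case using Suc F.power_card[OF fin that] by (simp add: card_F)
      qed (use that in simp)
      have hpow: "h l x [^]\<^bsub>K l\<^esub> ((2::nat) ^ (k * s)) = h l x" if "x \<in> carrier F" for x
      proof -
        have "h l (x [^] (m::nat)) = h l x [^]\<^bsub>K l\<^esub> m" for m
          using that by (induction m) (simp_all add: ring_hom_one[OF h[OF l]] ring_hom_mult[OF h[OF l]])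
        from this[of "2 ^ (k * s)"] show ?thesis by (simp only: pow[OF that])
      qed
      have \<zeta>a: "?z (T l t * i * 2 ^ (k * s)) = ?z (a * i)" for i
      proof -
        have mod: "?z (m mod l) = ?z m" for m
        proof -
          have "?z m = ?z (l * (m div l) + m mod l)" by simp
          also have "\<dots> = ?z (l * (m div l)) \<otimes>\<^bsub>K l\<^esub> ?z (m mod l)"
            using \<zeta>l by (simp only: Kl.nat_pow_mult)
          also have "?z (l * (m div l)) = \<one>\<^bsub>K l\<^esub>" by (simp add: \<zeta>_props(2)[OF l])
          finally show ?thesis using \<zeta>l by simp
        qed
        have "[T l t * i * 2 ^ (k * s) = a * i] (mod l)"
          using cong_scalar_right[OF s, of i] by (simp add: power_mult mult_ac)
        then show ?thesis by (metis mod cong_def)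
      qed
      have "\<zero>\<^bsub>K l\<^esub> = ?s (T l t) [^]\<^bsub>K l\<^esub> ((2::nat) ^ (k * s))"
        by (simp only: rep[OF t] Kl.zero_power_two)
      also have "\<dots> = (\<Oplus>\<^bsub>K l\<^esub>i\<in>{..<n}. (h l (c i) \<otimes>\<^bsub>K l\<^esub> ?z (T l t * i)) [^]\<^bsub>K l\<^esub> ((2::nat) ^ (k * s)))"
        using hc \<zeta>l by (intro Kl.finsum_frobenius) auto
      also have "\<dots> = ?s a"
      proof (rule Kl.finsum_cong')
        fix i assume "i \<in> {..<n}"
        then show "(h l (c i) \<otimes>\<^bsub>K l\<^esub> ?z (T l t * i)) [^]\<^bsub>K l\<^esub> ((2::nat) ^ (k * s))
            = h l (c i) \<otimes>\<^bsub>K l\<^esub> ?z (a * i)"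
          using hc \<zeta>l c by (simp add: Kl.nat_pow_distrib hpow Kl.nat_pow_pow \<zeta>a)
      qed (use hc \<zeta>l in auto)
      finally show "?s a = \<zero>\<^bsub>K l\<^esub>" by simp
    qed
  qed
qed

lemma units_group_algebra:
  "units_of (group_algebra F (integer_mod_group n \<times>\<times> Q12)) \<cong> units_of (block_ring P)"
proof (rule P.units_group_algebra_iso)
  show "char_two_cring F" by (rule F.char_two_cring_axioms)
  show "c i = \<zero>" if "\<And>i. i < n \<Longrightarrow> c i \<in> carrier F"
    "(\<Oplus>\<^bsub>P\<^esub>i\<in>{..<n}. hP (c i) \<otimes>\<^bsub>P\<^esub> \<zeta>P [^]\<^bsub>P\<^esub> i) = \<zero>\<^bsub>P\<^esub>" "i < n" for c i
    using that by (rule evaluation_zero)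
  show "\<one>\<^bsub>P\<^esub> \<noteq> \<zero>\<^bsub>P\<^esub>" by (simp add: P_def)
  show "card (carrier P) = card (carrier F) ^ n"
    by (simp add: card_P card_F power_mult[symmetric] mult.commute)
qed (fact hP_hom \<zeta>P_closed \<zeta>P_power n_pos finite_P fin)+

definition B where
  "B = (integer_mod_group (2 ^ k - 1) \<times>\<times> GL 2 F) \<times>\<times>
     product_group L (\<lambda>l. direct_power (integer_mod_group ((2 ^ k) ^ d l - 1) \<times>\<times> GL 2 (K l)) (e l))"

lemma group_C_GL: "ring R \<Longrightarrow> group (integer_mod_group m \<times>\<times> GL 2 R)"
  by (intro DirProd_group group_integer_mod_group group_GL)

lemma ring_K: "l \<in> L \<Longrightarrow> ring (K l)"
  by (rule cring.axioms(1)[OF fieldE(1)[OF K]])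

lemma group_B: "group B"
  unfolding B_def direct_power_def
  by (intro DirProd_group product_group group_integer_mod_group group_GL F.ring_axioms ring_K)

lemma units_GL_iso_C_GL:
  assumes "field R" and "finite (carrier R)"
  shows "units_of R \<times>\<times> GL m R \<cong> integer_mod_group (card (carrier R) - 1) \<times>\<times> GL m R"
proof -
  interpret field R by fact
  show ?thesis
    by (rule group.DirProd_iso_trans[OF units_group units_of_finite_field[OF assms(2)] iso_refl])
qed

text \<open>Distributing units and \<open>GL\<close> over the components together gives each field K
  one factor U(K) x GL(2, K), in which U(K) is cyclic of order |K| - 1.\<close>

lemma units_GL_P: "units_of P \<times>\<times> GL 2 P \<cong> B"
proof -
  let ?R = "\<lambda>l. product_ring {..<e l} (\<lambda>_. K l)"
  let ?U = "\<lambda>l. units_of (?R l) \<times>\<times> GL 2 (?R l)"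
  let ?D = "\<lambda>l. direct_power (integer_mod_group ((2 ^ k) ^ d l - 1) \<times>\<times> GL 2 (K l)) (e l)"
  have Kc: "cring (K l)" if "l \<in> L" for l using fieldE(1)[OF K[OF that]] .
  have Pc: "cring (?R l)" if "l \<in> L" for l
    by (intro cring_product_ring Kc[OF that])
  have gC: "group (integer_mod_group m \<times>\<times> GL 2 (K l))" if "l \<in> L" for l m
    by (rule group_C_GL[OF ring_K[OF that]])
  have gU: "group (units_of (K l) \<times>\<times> GL 2 (K l))" if "l \<in> L" for l
    by (rule group_units_GL[OF ring_K[OF that]])
  have gUP: "group (?U l)" if "l \<in> L" for l
    by (rule group_units_GL[OF cring.axioms(1)[OF Pc[OF that]]])
  have "?U l
      \<cong> ?D l" if l: "l \<in> L" for l
  proof -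
    have "?U l
        \<cong> product_group {..<e l} (\<lambda>_. units_of (K l) \<times>\<times> GL 2 (K l))"
      by (rule units_GL_product_ring[OF Kc[OF l]])
    also have "\<dots> \<cong> product_group {..<e l} (\<lambda>_. integer_mod_group ((2 ^ k) ^ d l - 1) \<times>\<times> GL 2 (K l))"
      using units_GL_iso_C_GL[OF K[OF l] finite_K[OF l], of 2]
      by (intro iso_product_groupI gU[OF l] gC[OF l]) (simp add: card_K[OF l])
    finally show ?thesis by (simp add: direct_power_def)
  qed
  then have "product_group L (\<lambda>l. ?U l)
      \<cong> product_group L (\<lambda>l. ?D l)"
    using gC by (intro iso_product_groupI gUP) (auto simp: direct_power_def)
  with units_GL_product_ring[OF Pc]
  have Q: "units_of Q \<times>\<times> GL 2 Q
      \<cong> product_group L (\<lambda>l. ?D l)"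
    unfolding Q_def by (rule iso_trans)
  have "units_of P \<times>\<times> GL 2 P \<cong> (units_of F \<times>\<times> GL 2 F) \<times>\<times> (units_of Q \<times>\<times> GL 2 Q)"
    unfolding P_def by (rule units_GL_RDirProd[OF F.is_cring cring_Q])
  also have "\<dots> \<cong> B"
    unfolding B_def using units_GL_iso_C_GL[OF F.field_axioms fin, of 2] card_F
    by (intro group.DirProd_iso_trans[OF group_units_GL[OF F.ring_axioms] _ Q]) simp
  finally show ?thesis .
qed

lemma units_iso:
  defines "A \<equiv> direct_power (integer_mod_group 2) (5 * n * k) \<times>\<times> direct_power (integer_mod_group 4) (n * k)"
  shows "\<exists>\<theta> \<in> hom B (AutoGroup A).
    units_of (group_algebra F (integer_mod_group n \<times>\<times> Q12)) \<cong> semidirect_product A B \<theta>"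
  using P.units_block_ring[OF card_P P_reduced group_B units_GL_P]
    iso_trans[OF units_group_algebra] unfolding A_def mult.assoc[of 5 n k] by blast

end

theorem theorem2p1:
  fixes F :: "('a, 'm) ring_scheme"
    and K :: "nat \<Rightarrow> ('k, 'r) ring_scheme"
    and n k q :: nat
    and d e :: "nat \<Rightarrow> nat"
  assumes "field F" and "finite (carrier F)" and "ring_char F = 2"
    and "card (carrier F) = q" and "q = 2 ^ k"
    and "odd n"
    and d: "\<And>l. d l = ord l q"
    and e: "\<And>l. e l = totient l div d l"
    and K: "\<And>l. l > 1 \<Longrightarrow> l dvd n \<Longrightarrow> extension_field_of_degree F (d l) (K (d l))"
  shows "let G = integer_mod_group n \<times>\<times> Q12;
             A = direct_power (integer_mod_group 2) (5 * n * k) \<times>\<times>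
                 direct_power (integer_mod_group 4) (n * k);
             B = (integer_mod_group (q - 1) \<times>\<times> GL 2 F) \<times>\<times>
                 product_group {l. l > 1 \<and> l dvd n}
                   (\<lambda>l. direct_power (integer_mod_group (q ^ d l - 1) \<times>\<times> GL 2 (K (d l))) (e l))
         in \<exists>\<theta> \<in> hom B (AutoGroup A).
              units_of (group_algebra F G) \<cong> semidirect_product A B \<theta>"
proof -
  interpret F: field F by fact
  interpret F: char_two_field F
    by unfold_locales (rule F.ring_char_two[OF \<open>ring_char F = 2\<close>])
  let ?L = "{l. l > 1 \<and> l dvd n}"
  have cop: "coprime l q" if "l \<in> ?L" for l
    using that \<open>odd n\<close> \<open>q = 2 ^ k\<close> by (auto simp: coprime_commute elim: dvdE)
  have ext: "field (K (d l))" "card (carrier (K (d l))) = q ^ d l"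
    "\<exists>h. h \<in> ring_hom F (K (d l))" if "l \<in> ?L" for l
    using K[of l] card_extension_field[OF \<open>field F\<close> \<open>finite (carrier F)\<close> K[of l]] that
    by (auto simp: \<open>card (carrier F) = q\<close> extension_field_of_degree_def)
  obtain h where h: "\<And>l. l \<in> ?L \<Longrightarrow> h l \<in> ring_hom F (K (d l))" using ext(3) by metis
  have "\<exists>z. char_two_field.has_order (K (d l)) z l" if l: "l \<in> ?L" for l
  proof -
    interpret Kl: char_two_field "K (d l)"
      by (rule char_two_fieldI[OF F.char_two_cring_axioms ext(1)[OF l] h[OF l]])
    \<comment> \<open>The degree d_l is chosen so that l divides q^(d_l) - 1, the order of the
      cyclic multiplicative group of the extension.\<close>
    have "[q ^ d l = 1] (mod l)" unfolding d by (rule Pocklington.ord)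
    then have "l dvd card (carrier (K (d l))) - 1" unfolding ext(2)[OF l] by (rule cong_to_1_nat)
    moreover have "finite (carrier (K (d l)))"
      by (rule card_ge_0_finite) (simp add: ext(2)[OF l] \<open>q = 2 ^ k\<close>)
    ultimately show ?thesis by (rule Kl.exists_has_order[rotated])
  qed
  then obtain z where z: "\<And>l. l \<in> ?L \<Longrightarrow> char_two_field.has_order (K (d l)) (z l) l" by metis
  have "\<exists>T. \<forall>a\<in>totatives l. \<exists>j<e l. \<exists>s. [T j * q ^ s = a] (mod l)" if "l \<in> ?L" for l
    unfolding e d using that cop[OF that] by (intro orbit_representatives) auto
  then obtain T where T: "\<And>l. l \<in> ?L \<Longrightarrow> \<forall>a\<in>totatives l. \<exists>j<e l. \<exists>s. [T l j * q ^ s = a] (mod l)" by metis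
  \<comment> \<open>The theorem indexes the extension fields by degree, the locale by l; hence
    \<open>\<lambda>l. K (d l)\<close>, where different l of equal degree share a field.\<close>
  interpret root_family F n k "\<lambda>l. K (d l)" h z T ?L d e
  proof (rule root_family.intro[OF F.char_two_field_axioms], rule root_family_axioms.intro)
    show "?L = {l. l > 1 \<and> l dvd n}" by (rule HOL.refl)
    show "d l = ord l (2 ^ k)" for l by (simp only: d \<open>q = 2 ^ k\<close>)
    show "e l = totient l div d l" for l by (rule e)
    show "finite (carrier F)" "odd n" by fact+
    show "card (carrier F) = 2 ^ k" by (simp only: \<open>card (carrier F) = q\<close> \<open>q = 2 ^ k\<close>)
    show "field (K (d l))" if "l \<in> ?L" for l by (rule ext(1)[OF that])
    show "h l \<in> ring_hom F (K (d l))" if "l \<in> ?L" for l by (rule h[OF that])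
    show "char_two_field.has_order (K (d l)) (z l) l" if "l \<in> ?L" for l by (rule z[OF that])
    show "card (carrier (K (d l))) = (2 ^ k) ^ d l" if "l \<in> ?L" for l
      using ext(2)[OF that] unfolding \<open>q = 2 ^ k\<close> .
    show "\<exists>j<e l. \<exists>s. [T l j * (2 ^ k) ^ s = a] (mod l)" if "l \<in> ?L" "a \<in> totatives l" for l a
      using T[OF that(1), rule_format, OF that(2)] unfolding \<open>q = 2 ^ k\<close> .
  qed
  show ?thesis
    using units_iso unfolding B_def Let_def \<open>q = 2 ^ k\<close> .
qed

end
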